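(* Let $\chi\in\widehat{\mathcal{B}}^+$. Then the induced representation $\pi=\mathrm{Ind}\,\chi$ of $\mathcal{A}$ is irreducible if and only if the stabilizer group $\mathrm{St}\,\chi$ is trivial.
   Context: $G$ is a discrete group with unit $e$ and $\mathcal{A}=\bigoplus_{g\in G}\mathcal{A}_g$ is a unital (complex) $G$-graded $*$-algebra ($\mathcal{A}_g\mathcal{A}_h\subseteq\mathcal{A}_{gh}$, $\mathcal{A}_g^*\subseteq\mathcal{A}_{g^{-1}}$) such that $\mathcal{B}:=\mathcal{A}_e$ is commutative and countably generated; $p:\mathcal{A}\to\mathcal{B}$ is the canonical projection $p(\sum_ga_g)=a_e$. $\sum\mathcal{A}^2$ is the set of finite sums of elements $a^*a$. $\widehat{\mathcal{B}}^+$ is the set of characters (nontrivial $*$-homomorphisms $\mathcal{B}\to\mathbb{C}$) that are nonnegative on $\sum\mathcal{A}^2\cap\mathcal{B}$. Standing assumptions: $\chi(c^*d)\chi(d^*c)=\chi(c^*c)\chi(d^*d)$ for all $\chi\in\widehat{\mathcal{B}}^+$, $g\in G$, $c,d\in\mathcal{A}_g$; and $\widehat{\mathcal{B}}^+$ is locally compact in the weakest topology making all functions $\chi\mapsto\chi(b)$, $b\in\mathcal{B}$, continuous. $\chi^g$ is defined if $\chi(a_g^*a_g)\neq0$ for some $a_g\in\mathcal{A}_g$, and then $\chi^g(b)=\chi(a_g^*ba_g)/\chi(a_g^*a_g)$ for $b\in\mathcal{B}$ (independent of $a_g$). $\mathrm{St}\,\chi=\{g\in G:\chi^g\text{ is defined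 and equals }\chi\}$, a subgroup of $G$. $*$-representations act on dense subspaces $\mathcal{D}(\pi)$ of Hilbert spaces, with $\langle\pi(a)\varphi,\psi\rangle=\langle\varphi,\pi(a^* )\psi\rangle$; $\pi$ is irreducible if a decomposition $\pi=\pi_1\oplus\pi_2$ (with $\mathcal{D}(\pi)=\mathcal{D}(\pi_1)\oplus\mathcal{D}(\pi_2)$) is only possible with $\mathcal{D}(\pi_1)=\{0\}$ or $\mathcal{D}(\pi_2)=\{0\}$. The closure of $\pi$ is its extension by continuity to the completion of $\mathcal{D}(\pi)$ in the topology given by the norms $\varphi\mapsto\|\varphi\|+\|\pi(a)\varphi\|$, $a\in\mathcal{A}$. For $\chi\in\widehat{\mathcal{B}}^+$, regarded as a one-dimensional $*$-representation of $\mathcal{B}$ on $\mathbb{C}$, the form $\langle a_1\otimes1,a_2\otimes1\rangle_0=\chi(p(a_2^*a_1))$ on $\mathcal{A}\otimes_{\mathcal{B}}\mathbb{C}$ is nonnegative, and $\mathrm{Ind}\,\chi$ is the closure of the $*$-representation $a\mapsto([b\otimes1]\mapsto[ab\otimes1])$ on the quotient of $\mathcal{A}\otimes_{\mathcal{B}}\mathbb{C}$ by the kernel of this form. *)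

theory Defs
  imports "HOL-Analysis.Analysis" "HOL-Algebra.Module" "HOL-Algebra.AbelCoset"
    "HOL-Algebra.Free_Abelian_Groups"
begin

section \<open>Graded *-algebras\<close>

text \<open>Being based on \<^class>\<open>ring_1\<close>, the class excludes only the zero algebra, which has no characters.\<close>

class complex_star_algebra = ring_1 +
  fixes scaleC :: "complex \<Rightarrow> 'a \<Rightarrow> 'a" (infixr \<open>*\<^sub>C\<close> 75)
    and adj :: "'a \<Rightarrow> 'a" (\<open>_\<^sup>\<star>\<close> [1000] 999)
  assumes scaleC_add_right: "c *\<^sub>C (a + b) = c *\<^sub>C a + c *\<^sub>C b"
    and scaleC_add_left: "(c + d) *\<^sub>C a = c *\<^sub>C a + d *\<^sub>C a"
    and scaleC_scaleC: "c *\<^sub>C d *\<^sub>C a = (c * d) *\<^sub>C a"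
    and scaleC_one: "1 *\<^sub>C a = a"
    and mult_scaleC_left: "(c *\<^sub>C a) * b = c *\<^sub>C (a * b)"
    and mult_scaleC_right: "a * (c *\<^sub>C b) = c *\<^sub>C (a * b)"
    and adj_adj: "(a\<^sup>\<star>)\<^sup>\<star> = a"
    and adj_add: "(a + b)\<^sup>\<star> = a\<^sup>\<star> + b\<^sup>\<star>"
    and adj_scaleC: "(c *\<^sub>C a)\<^sup>\<star> = cnj c *\<^sub>C a\<^sup>\<star>"
    and adj_mult: "(a * b)\<^sup>\<star> = b\<^sup>\<star> * a\<^sup>\<star>"

definition homogeneous_decomposition ::
  "('g, 'm) monoid_scheme \<Rightarrow> ('g \<Rightarrow> 'a set) \<Rightarrow> 'a::complex_star_algebra \<Rightarrow> ('g \<Rightarrow> 'a) \<Rightarrow> bool"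
  where "homogeneous_decomposition G A a f \<longleftrightarrow>
    (\<forall>g\<in>carrier G. f g \<in> A g) \<and> (\<forall>g. g \<notin> carrier G \<longrightarrow> f g = 0) \<and>
    finite {g. f g \<noteq> 0} \<and> a = (\<Sum>g | f g \<noteq> 0. f g)"

locale graded_star_algebra = group G
  for G :: "('g, 'm) monoid_scheme" (structure) +
  fixes A :: "'g \<Rightarrow> 'a::complex_star_algebra set"
  assumes zero_mem: "g \<in> carrier G \<Longrightarrow> 0 \<in> A g"
    and add_mem: "g \<in> carrier G \<Longrightarrow> a \<in> A g \<Longrightarrow> b \<in> A g \<Longrightarrow> a + b \<in> A g"
    and scaleC_mem: "g \<in> carrier G \<Longrightarrow> a \<in> A g \<Longrightarrow> c *\<^sub>C a \<in> A g"
    and mult_mem: "g \<in> carrier G \<Longrightarrow> h \<in> carrier G \<Longrightarrow> a \<in> A g \<Longrightarrow> b \<in> A h \<Longrightarrow> a * b \<in> A (g \<otimes> h)"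
    and adj_mem: "g \<in> carrier G \<Longrightarrow> a \<in> A g \<Longrightarrow> a\<^sup>\<star> \<in> A (inv g)"
    and direct_sum: "\<exists>!f. homogeneous_decomposition G A a f"

definition unit_projection ::
  "('g, 'm) monoid_scheme \<Rightarrow> ('g \<Rightarrow> 'a set) \<Rightarrow> 'a::complex_star_algebra \<Rightarrow> 'a"
  where "unit_projection G A a = (THE f. homogeneous_decomposition G A a f) \<one>\<^bsub>G\<^esub>"

inductive_set generated_star_algebra :: "'a::complex_star_algebra set \<Rightarrow> 'a set"
  for S :: "'a set" where
  "a \<in> S \<Longrightarrow> a \<in> generated_star_algebra S"
| "1 \<in> generated_star_algebra S"
| "a \<in> generated_star_algebra S \<Longrightarrow> b \<in> generated_star_algebra S \<Longrightarrow> a + b \<in> generated_star_algebra S"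
| "a \<in> generated_star_algebra S \<Longrightarrow> c *\<^sub>C a \<in> generated_star_algebra S"
| "a \<in> generated_star_algebra S \<Longrightarrow> b \<in> generated_star_algebra S \<Longrightarrow> a * b \<in> generated_star_algebra S"
| "a \<in> generated_star_algebra S \<Longrightarrow> a\<^sup>\<star> \<in> generated_star_algebra S"

definition countably_generated :: "'a::complex_star_algebra set \<Rightarrow> bool"
  where "countably_generated B \<longleftrightarrow> (\<exists>S. countable S \<and> generated_star_algebra S = B)"

definition sums_of_squares :: "'a::complex_star_algebra set"
  where "sums_of_squares = {\<Sum>a\<leftarrow>as. a\<^sup>\<star> * a | as. True}"

section \<open>Characters of the unit component\<close>

text \<open>A function on a subset of a type is represented by its extensional extension, so that
  equality of functions on the subset is equality in HOL.\<close>

definition characters :: "'a::complex_star_algebra set \<Rightarrow> ('a \<Rightarrow> complex) set"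
  where "characters B = {\<omega> \<in> extensional B.
    (\<forall>a\<in>B. \<forall>b\<in>B. \<omega> (a + b) = \<omega> a + \<omega> b \<and> \<omega> (a * b) = \<omega> a * \<omega> b) \<and>
    (\<forall>c. \<forall>a\<in>B. \<omega> (c *\<^sub>C a) = c * \<omega> a) \<and>
    (\<forall>a\<in>B. \<omega> (a\<^sup>\<star>) = cnj (\<omega> a)) \<and>
    (\<exists>a\<in>B. \<omega> a \<noteq> 0)}"

definition pos_characters :: "'a::complex_star_algebra set \<Rightarrow> ('a \<Rightarrow> complex) set"
  where "pos_characters B =
    {\<omega> \<in> characters B. \<forall>a \<in> sums_of_squares \<inter> B. \<omega> a \<in> \<real>\<^sub>\<ge>\<^sub>0}"

definition pos_characters_topology :: "'a::complex_star_algebra set \<Rightarrow> ('a \<Rightarrow> complex) topology"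
  where "pos_characters_topology B =
    topology_generated_by {{\<omega> \<in> pos_characters B. \<omega> b \<in> U} | b U. b \<in> B \<and> open U}"

locale induction_setting = graded_star_algebra G A
  for G :: "('g, 'm) monoid_scheme" (structure)
    and A :: "'g \<Rightarrow> 'a::complex_star_algebra set" +
  assumes unit_component_commute: "a \<in> A \<one> \<Longrightarrow> b \<in> A \<one> \<Longrightarrow> a * b = b * a"
    and unit_component_countably_generated: "countably_generated (A \<one>)"
    and pos_characters_mult: "\<omega> \<in> pos_characters (A \<one>) \<Longrightarrow> g \<in> carrier G \<Longrightarrow> c \<in> A g \<Longrightarrow> d \<in> A g \<Longrightarrow>
      \<omega> (c\<^sup>\<star> * d) * \<omega> (d\<^sup>\<star> * c) = \<omega> (c\<^sup>\<star> * c) * \<omega> (d\<^sup>\<star> * d)"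
    and pos_characters_locally_compact:
      "locally_compact_space (pos_characters_topology (A \<one>))"

definition conj_character_defined ::
  "('g \<Rightarrow> 'a::complex_star_algebra set) \<Rightarrow> ('a \<Rightarrow> complex) \<Rightarrow> 'g \<Rightarrow> bool"
  where "conj_character_defined A \<omega> g \<longleftrightarrow> (\<exists>a\<in>A g. \<omega> (a\<^sup>\<star> * a) \<noteq> 0)"

text \<open>The choice of \<open>a\<close> is irrelevant, by commutativity of the unit component:
  \<open>(c\<^sup>\<star> b c) (d\<^sup>\<star> d) = c\<^sup>\<star> (c d\<^sup>\<star>) b d = (c\<^sup>\<star> c) (d\<^sup>\<star> b d)\<close> for \<open>c\<close>, \<open>d\<close> of degree \<open>g\<close>.\<close>

definition conj_character :: "('g, 'm) monoid_scheme \<Rightarrow> ('g \<Rightarrow> 'a set) \<Rightarrow>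
    ('a::complex_star_algebra \<Rightarrow> complex) \<Rightarrow> 'g \<Rightarrow> 'a \<Rightarrow> complex"
  where "conj_character G A \<omega> g =
    (let a = (SOME a. a \<in> A g \<and> \<omega> (a\<^sup>\<star> * a) \<noteq> 0)
     in restrict (\<lambda>b. \<omega> (a\<^sup>\<star> * b * a) / \<omega> (a\<^sup>\<star> * a)) (A \<one>\<^bsub>G\<^esub>))"

definition character_stabilizer :: "('g, 'm) monoid_scheme \<Rightarrow> ('g \<Rightarrow> 'a set) \<Rightarrow>
    ('a::complex_star_algebra \<Rightarrow> complex) \<Rightarrow> 'g set"
  where "character_stabilizer G A \<omega> =
    {g \<in> carrier G. conj_character_defined A \<omega> g \<and> conj_character G A \<omega> g = \<omega>}"

section \<open>Inner product spaces with explicit carriers\<close>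

definition complex_field :: "complex ring"
  where "complex_field = \<lparr>carrier = UNIV, monoid.mult = (*), one = 1, ring.zero = 0, add = (+)\<rparr>"

text \<open>The record of modules comes with ring operations on the vectors; these are irrelevant
  here and set to \<^term>\<open>undefined\<close> in the constructions below.  The form \<open>ip\<close> is linear in its
  first argument.\<close>

record 'v inner_space = "(complex, 'v) module" +
  ip :: "'v \<Rightarrow> 'v \<Rightarrow> complex"

definition vnorm :: "('v, 'm) inner_space_scheme \<Rightarrow> 'v \<Rightarrow> real"
  where "vnorm V x = sqrt (Re (ip V x x))"

definition vdist :: "('v, 'm) inner_space_scheme \<Rightarrow> 'v \<Rightarrow> 'v \<Rightarrow> real"
  where "vdist V x y = vnorm V (x \<ominus>\<^bsub>V\<^esub> y)"

definition cauchy_sequences :: "('v, 'm) inner_space_scheme \<Rightarrow> (nat \<Rightarrow> 'v) set"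
  where "cauchy_sequences V = {s. range s \<subseteq> carrier V \<and>
    (\<forall>\<epsilon>>0. \<exists>N. \<forall>m\<ge>N. \<forall>n\<ge>N. vdist V (s m) (s n) < \<epsilon>)}"

locale inner_product_space = Module.module complex_field V
  for V :: "('v, 'm) inner_space_scheme" (structure) +
  assumes ip_add_left: "x \<in> carrier V \<Longrightarrow> y \<in> carrier V \<Longrightarrow> z \<in> carrier V \<Longrightarrow>
      ip V (x \<oplus> y) z = ip V x z + ip V y z"
    and ip_smult_left: "x \<in> carrier V \<Longrightarrow> y \<in> carrier V \<Longrightarrow> ip V (c \<odot>\<^bsub>V\<^esub> x) y = c * ip V x y"
    and ip_cnj: "x \<in> carrier V \<Longrightarrow> y \<in> carrier V \<Longrightarrow> ip V y x = cnj (ip V x y)"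
    and ip_nonneg: "x \<in> carrier V \<Longrightarrow> Re (ip V x x) \<ge> 0"
    and ip_definite: "x \<in> carrier V \<Longrightarrow> ip V x x = 0 \<Longrightarrow> x = \<zero>\<^bsub>V\<^esub>"

locale hilbert_space = inner_product_space V
  for V :: "('v, 'm) inner_space_scheme" (structure) +
  assumes complete: "s \<in> cauchy_sequences V \<Longrightarrow>
    \<exists>x\<in>carrier V. (\<lambda>n. vdist V (s n) x) \<longlonglongrightarrow> 0"

definition form_kernel :: "('v, 'm) inner_space_scheme \<Rightarrow> 'v set"
  where "form_kernel V = {x \<in> carrier V. \<forall>y\<in>carrier V. ip V x y = 0}"

definition quotient_space :: "'v inner_space \<Rightarrow> 'v set inner_space"
  where "quotient_space V = (let N = form_kernel V in
    \<lparr>carrier = a_rcosets\<^bsub>V\<^esub> N,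
     monoid.mult = undefined, one = undefined,
     ring.zero = N,
     add = (\<lambda>X Y. X <+>\<^bsub>V\<^esub> Y),
     smult = (\<lambda>c X. \<Union>x\<in>X. N +>\<^bsub>V\<^esub> (c \<odot>\<^bsub>V\<^esub> x)),
     ip = (\<lambda>X Y. THE w. \<exists>x\<in>X. \<exists>y\<in>Y. w = ip V x y)\<rparr>)"

definition null_equiv :: "('v, 'm) inner_space_scheme \<Rightarrow> (nat \<Rightarrow> 'v) rel"
  where "null_equiv V = {(s, t). s \<in> cauchy_sequences V \<and> t \<in> cauchy_sequences V \<and>
    (\<lambda>n. vdist V (s n) (t n)) \<longlonglongrightarrow> 0}"

definition hilbert_completion :: "'v inner_space \<Rightarrow> (nat \<Rightarrow> 'v) set inner_space"
  where "hilbert_completion V =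
    \<lparr>carrier = cauchy_sequences V // null_equiv V,
     monoid.mult = undefined, one = undefined,
     ring.zero = null_equiv V `` {\<lambda>n. \<zero>\<^bsub>V\<^esub>},
     add = (\<lambda>X Y. \<Union>s\<in>X. \<Union>t\<in>Y. null_equiv V `` {\<lambda>n. s n \<oplus>\<^bsub>V\<^esub> t n}),
     smult = (\<lambda>c X. \<Union>s\<in>X. null_equiv V `` {\<lambda>n. c \<odot>\<^bsub>V\<^esub> s n}),
     ip = (\<lambda>X Y. THE w. \<exists>s\<in>X. \<exists>t\<in>Y. (\<lambda>n. ip V (s n) (t n)) \<longlonglongrightarrow> w)\<rparr>"

definition completion_embedding :: "('v, 'm) inner_space_scheme \<Rightarrow> 'v \<Rightarrow> (nat \<Rightarrow> 'v) set"
  where "completion_embedding V x = null_equiv V `` {\<lambda>n. x}"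

section \<open>*-representations\<close>

record ('a, 'v) representation =
  rep_space :: "'v inner_space"
  rep_dom :: "'v set"
  rep_op :: "'a \<Rightarrow> 'v \<Rightarrow> 'v"

locale star_representation = hilbert_space "rep_space R"
  for R :: "('a::complex_star_algebra, 'v) representation" +
  assumes dom_submodule: "submodule (rep_dom R) complex_field (rep_space R)"
    and dom_dense: "x \<in> carrier (rep_space R) \<Longrightarrow> \<epsilon> > 0 \<Longrightarrow> \<exists>\<phi>\<in>rep_dom R. vdist (rep_space R) \<phi> x < \<epsilon>"
    and op_closed: "\<phi> \<in> rep_dom R \<Longrightarrow> rep_op R a \<phi> \<in> rep_dom R"
    and op_linear: "\<phi> \<in> rep_dom R \<Longrightarrow> \<psi> \<in> rep_dom R \<Longrightarrow>
      rep_op R a (\<phi> \<oplus>\<^bsub>rep_space R\<^esub> \<psi>) = rep_op R a \<phi> \<oplus>\<^bsub>rep_space R\<^esub> rep_op R a \<psi>"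
      "\<phi> \<in> rep_dom R \<Longrightarrow> rep_op R a (c \<odot>\<^bsub>rep_space R\<^esub> \<phi>) = c \<odot>\<^bsub>rep_space R\<^esub> rep_op R a \<phi>"
    and op_add: "\<phi> \<in> rep_dom R \<Longrightarrow> rep_op R (a + b) \<phi> = rep_op R a \<phi> \<oplus>\<^bsub>rep_space R\<^esub> rep_op R b \<phi>"
    and op_scaleC: "\<phi> \<in> rep_dom R \<Longrightarrow> rep_op R (c *\<^sub>C a) \<phi> = c \<odot>\<^bsub>rep_space R\<^esub> rep_op R a \<phi>"
    and op_mult: "\<phi> \<in> rep_dom R \<Longrightarrow> rep_op R (a * b) \<phi> = rep_op R a (rep_op R b \<phi>)"
    and op_one: "\<phi> \<in> rep_dom R \<Longrightarrow> rep_op R 1 \<phi> = \<phi>"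
    and op_adj: "\<phi> \<in> rep_dom R \<Longrightarrow> \<psi> \<in> rep_dom R \<Longrightarrow>
      ip (rep_space R) (rep_op R a \<phi>) \<psi> = ip (rep_space R) \<phi> (rep_op R (a\<^sup>\<star>) \<psi>)"

definition orthogonal_sum_of :: "('a, 'v) representation \<Rightarrow> ('a, 'v) representation \<Rightarrow>
    ('a, 'v) representation \<Rightarrow> bool"
  where "orthogonal_sum_of R R1 R2 \<longleftrightarrow> (let V = rep_space R; V1 = rep_space R1; V2 = rep_space R2 in
    V1 = V\<lparr>carrier := carrier V1\<rparr> \<and> V2 = V\<lparr>carrier := carrier V2\<rparr> \<and>
    carrier V = carrier V1 <+>\<^bsub>V\<^esub> carrier V2 \<and>
    (\<forall>x\<in>carrier V1. \<forall>y\<in>carrier V2. ip V x y = 0) \<and>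
    rep_dom R = rep_dom R1 <+>\<^bsub>V\<^esub> rep_dom R2 \<and>
    (\<forall>a. \<forall>\<phi>\<in>rep_dom R1. \<forall>\<psi>\<in>rep_dom R2. rep_op R a (\<phi> \<oplus>\<^bsub>V\<^esub> \<psi>) = rep_op R1 a \<phi> \<oplus>\<^bsub>V\<^esub> rep_op R2 a \<psi>))"

definition irreducible_rep :: "('a::complex_star_algebra, 'v) representation \<Rightarrow> bool"
  where "irreducible_rep R \<longleftrightarrow>
    (\<forall>R1 R2. star_representation R1 \<and> star_representation R2 \<and> orthogonal_sum_of R R1 R2 \<longrightarrow>
      rep_dom R1 = {\<zero>\<^bsub>rep_space R\<^esub>} \<or> rep_dom R2 = {\<zero>\<^bsub>rep_space R\<^esub>})"

text \<open>The topology on the domain given by the norms \<open>\<phi> \<mapsto> \<parallel>\<phi>\<parallel> + \<parallel>\<pi>(a)\<phi>\<parallel>\<close> is the one induced by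
  \<open>\<phi> \<mapsto> (\<phi>, (\<pi>(a)\<phi>)\<^sub>a)\<close> from the complete product space of copies of the Hilbert space.  Hence the
  completion consists of the limits \<open>(\<phi>, \<psi>)\<close> of the graphs along filters on the domain;
  \<open>\<phi>\<close> determines \<open>\<psi>\<close> since \<open>\<pi>(a)\<close> has a densely defined adjoint, and \<open>\<psi> a\<close> is the value at \<open>\<phi>\<close>
  of the extension of \<open>\<pi>(a)\<close> by continuity.  The algebra need not be countably generated,
  so sequences would not be enough.\<close>

definition graph_limit :: "('a, 'v) representation \<Rightarrow> 'v \<Rightarrow> ('a \<Rightarrow> 'v) \<Rightarrow> bool"
  where "graph_limit R \<phi> \<psi> \<longleftrightarrow> \<phi> \<in> carrier (rep_space R) \<and> range \<psi> \<subseteq> carrier (rep_space R) \<and>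
    (\<exists>F. F \<noteq> bot \<and> eventually (\<lambda>\<xi>. \<xi> \<in> rep_dom R) F \<and>
      ((\<lambda>\<xi>. vdist (rep_space R) \<xi> \<phi>) \<longlongrightarrow> 0) F \<and>
      (\<forall>a. ((\<lambda>\<xi>. vdist (rep_space R) (rep_op R a \<xi>) (\<psi> a)) \<longlongrightarrow> 0) F))"

definition rep_closure :: "('a, 'v) representation \<Rightarrow> ('a, 'v) representation"
  where "rep_closure R =
    \<lparr>rep_space = rep_space R,
     rep_dom = {\<phi>. \<exists>\<psi>. graph_limit R \<phi> \<psi>},
     rep_op = (\<lambda>a \<phi>. THE v. \<exists>\<psi>. graph_limit R \<phi> \<psi> \<and> v = \<psi> a)\<rparr>"

section \<open>Induced representations\<close>

text \<open>The tensor product over the unit component \<open>B\<close> of the algebra (a right \<open>B\<close>-module) and of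
  the complex numbers (a left \<open>B\<close>-module through \<open>\<omega>\<close>): the free abelian group on all pairs modulo
  the subgroup generated by the balancing relations.\<close>

type_synonym 'a tensor = "('a \<times> complex \<Rightarrow>\<^sub>0 int) set"

definition tensor_relations ::
  "'a::complex_star_algebra set \<Rightarrow> ('a \<Rightarrow> complex) \<Rightarrow> ('a \<times> complex \<Rightarrow>\<^sub>0 int) set"
  where "tensor_relations B \<omega> =
    {frag_of (a + a', z) - frag_of (a, z) - frag_of (a', z) | a a' z. True} \<union>
    {frag_of (a, z + w) - frag_of (a, z) - frag_of (a, w) | a z w. True} \<union>
    {frag_of (a * b, z) - frag_of (a, \<omega> b * z) | a b z. b \<in> B}"

definition tensor_kernel :: "'a::complex_star_algebra set \<Rightarrow> ('a \<Rightarrow> complex) \<Rightarrow> 'a tensor"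
  where "tensor_kernel B \<omega> = generate (free_Abelian_group UNIV) (tensor_relations B \<omega>)"

definition tensor_group :: "'a::complex_star_algebra set \<Rightarrow> ('a \<Rightarrow> complex) \<Rightarrow> 'a tensor monoid"
  where "tensor_group B \<omega> = free_Abelian_group UNIV Mod tensor_kernel B \<omega>"

definition tensor :: "'a::complex_star_algebra set \<Rightarrow> ('a \<Rightarrow> complex) \<Rightarrow> 'a \<Rightarrow> complex \<Rightarrow> 'a tensor"
  where "tensor B \<omega> a z = tensor_kernel B \<omega> #>\<^bsub>free_Abelian_group UNIV\<^esub> frag_of (a, z)"

text \<open>Every element of the tensor product is of the form \<open>a \<otimes> 1\<close>, so it suffices to prescribe
  the operations on these.\<close>

definition tensor_space :: "('g, 'm) monoid_scheme \<Rightarrow> ('g \<Rightarrow> 'a::complex_star_algebra set) \<Rightarrow>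
    ('a \<Rightarrow> complex) \<Rightarrow> 'a tensor inner_space"
  where "tensor_space G A \<omega> = (let B = A \<one>\<^bsub>G\<^esub>; T = tensor_group B \<omega> in
    \<lparr>carrier = carrier T,
     monoid.mult = undefined, one = undefined,
     ring.zero = \<one>\<^bsub>T\<^esub>,
     add = (\<lambda>s t. s \<otimes>\<^bsub>T\<^esub> t),
     smult = (\<lambda>c t. THE u. \<exists>a. t = tensor B \<omega> a 1 \<and> u = tensor B \<omega> (c *\<^sub>C a) 1),
     ip = (\<lambda>s t. THE w. \<exists>a1 a2. s = tensor B \<omega> a1 1 \<and> t = tensor B \<omega> a2 1 \<and>
       w = \<omega> (unit_projection G A (a2\<^sup>\<star> * a1)))\<rparr>)"

type_synonym 'a ind_vector = "(nat \<Rightarrow> 'a tensor set) set"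

definition ind_vector :: "('g, 'm) monoid_scheme \<Rightarrow> ('g \<Rightarrow> 'a::complex_star_algebra set) \<Rightarrow>
    ('a \<Rightarrow> complex) \<Rightarrow> 'a \<Rightarrow> 'a ind_vector"
  where "ind_vector G A \<omega> a = (let T = tensor_space G A \<omega> in
    completion_embedding (quotient_space T) (form_kernel T +>\<^bsub>T\<^esub> tensor (A \<one>\<^bsub>G\<^esub>) \<omega> a 1))"

definition pre_induced_rep :: "('g, 'm) monoid_scheme \<Rightarrow> ('g \<Rightarrow> 'a::complex_star_algebra set) \<Rightarrow>
    ('a \<Rightarrow> complex) \<Rightarrow> ('a, 'a ind_vector) representation"
  where "pre_induced_rep G A \<omega> =
    \<lparr>rep_space = hilbert_completion (quotient_space (tensor_space G A \<omega>)),
     rep_dom = range (ind_vector G A \<omega>),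
     rep_op = (\<lambda>a \<phi>. THE \<psi>. \<exists>b. \<phi> = ind_vector G A \<omega> b \<and> \<psi> = ind_vector G A \<omega> (a * b))\<rparr>"

definition induced_rep :: "('g, 'm) monoid_scheme \<Rightarrow> ('g \<Rightarrow> 'a::complex_star_algebra set) \<Rightarrow>
    ('a \<Rightarrow> complex) \<Rightarrow> ('a, 'a ind_vector) representation"
  where "induced_rep G A \<omega> = rep_closure (pre_induced_rep G A \<omega>)"

end

theory Submission
  imports Defs
begin

text \<open>Write \<open>v a\<close> for the class of \<open>a \<otimes> 1\<close> in the induced representation and \<open>\<Phi> a = \<omega> (p a)\<close>, where \<open>p\<close> is
the projection onto the unit component \<open>B\<close>; then \<open>\<langle>v a, v b\<rangle> = \<Phi> (b\<^sup>\<star> a)\<close>.  The grading makes the images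
\<open>H g\<close> of the homogeneous components \<open>A g\<close> pairwise orthogonal, and the standing assumption on the
characters is the equality case of the Cauchy-Schwarz inequality, so every \<open>H g\<close> is at most a line
(\<open>v_proportional\<close>).  On a nonzero \<open>H g\<close> the algebra \<open>B\<close> acts through the conjugate character of
\<open>g\<close> (\<open>conj_character_eigenvector\<close>).

If the stabilizer is trivial, \<open>\<omega>\<close> occurs only on the line spanned by the cyclic vector \<open>v 1\<close>
(\<open>eigenvector_of_trivial_stabilizer\<close>).  In an orthogonal decomposition, both components of \<open>v 1\<close> are
again eigenvectors of \<open>B\<close> for \<open>\<omega>\<close>, hence multiples of \<open>v 1\<close>; being orthogonal, one of them is
zero, and by cyclicity so is the corresponding summand.

If the stabilizer contains \<open>k\<close> different from the unit, choose \<open>c\<close> of degree \<open>k\<close> with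
\<open>\<omega> (c\<^sup>\<star> c) = 1\<close>.  Invariance of \<open>\<omega>\<close> under \<open>k\<close> turns into the trace property \<open>\<Phi> (d c) = \<Phi> (c d)\<close>,
so that \<open>v a \<mapsto> v (a c)\<close> extends to a unitary \<open>U\<close> which commutes with the representation and moves
\<open>H g\<close> to \<open>H (g k)\<close>.  It remains to find a nontrivial reflection \<open>S = S\<^sup>\<star> = S\<^sup>-\<^sup>1\<close> among the functions of
\<open>U\<close>, because its two eigenspaces decompose the representation.  If \<open>k\<close> has finite order \<open>n\<close>, scale \<open>c\<close>
such that \<open>U\<^sup>n = 1\<close>, and take \<open>S = 2 P - 1\<close> with \<open>P\<close> the mean of the powers of \<open>U\<close>.  If \<open>k\<close> has
infinite order, \<open>U\<close> is a direct sum of bilateral shifts and \<open>S\<close> is a square wave of \<open>U\<close>: with the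
Fourier coefficients \<open>\<beta> m = 2 / (\<i> \<pi> m)\<close> for odd \<open>m\<close> and \<open>\<beta> m = 0\<close> otherwise, \<open>S = \<Sum>m. \<beta> m U\<^sup>m\<close>, and
\<open>S\<^sup>2 = 1\<close> is the statement that \<open>\<beta>\<close> is its own inverse under convolution
(\<open>square_wave_convolution\<close>).

The domain needs care: a bounded operator commuting with an unbounded representation need not
respect the domain of the closure.  Here \<open>S\<close> is a strong limit of right multiplications by
elements of the algebra, and these preserve the domain of the original representation and commute
with it; hence \<open>S\<close> preserves limits of graphs (\<open>graph_limit_S\<close>).\<close>

section \<open>Inner product spaces with carriers\<close>

lemma complex_field_simps [simp]:
  "carrier complex_field = UNIV" "a \<otimes>\<^bsub>complex_field\<^esub> b = a * b" "a \<oplus>\<^bsub>complex_field\<^esub> b = a + b"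
  "\<one>\<^bsub>complex_field\<^esub> = 1" "\<zero>\<^bsub>complex_field\<^esub> = 0"
  by (simp_all add: complex_field_def)

lemma cring_complex_field: "cring complex_field"
proof (rule cringI)
  show "abelian_group complex_field"
  proof (rule abelian_groupI)
    show "\<exists>y\<in>carrier complex_field. y \<oplus>\<^bsub>complex_field\<^esub> x = \<zero>\<^bsub>complex_field\<^esub>" for x
      by (rule bexI[of _ "- x"]) simp_all
  qed simp_all
  show "comm_monoid complex_field"
    by (rule comm_monoidI) auto
qed (auto simp: algebra_simps)

lemma a_inv_complex_field [simp]: "\<ominus>\<^bsub>complex_field\<^esub> c = - c"
proof -
  interpret cring complex_field by (rule cring_complex_field)
  show ?thesis
    by (rule sum_zero_eq_neg[symmetric]) auto
qed

text \<open>The form on the tensor product is degenerate in general, while everything up to the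
Cauchy-Schwarz inequality needs positivity only; so this part is developed for semidefinite forms.\<close>
locale semi_inner_product_space = Module.module complex_field V
  for V :: "('v, 'm) inner_space_scheme" (structure) +
  assumes ip_add_left: "x \<in> carrier V \<Longrightarrow> y \<in> carrier V \<Longrightarrow> z \<in> carrier V \<Longrightarrow>
      ip V (x \<oplus> y) z = ip V x z + ip V y z"
    and ip_smult_left: "x \<in> carrier V \<Longrightarrow> y \<in> carrier V \<Longrightarrow> ip V (c \<odot>\<^bsub>V\<^esub> x) y = c * ip V x y"
    and ip_cnj: "x \<in> carrier V \<Longrightarrow> y \<in> carrier V \<Longrightarrow> ip V y x = cnj (ip V x y)"
    and ip_nonneg: "x \<in> carrier V \<Longrightarrow> Re (ip V x x) \<ge> 0"

sublocale inner_product_space \<subseteq> semi_inner_product_space V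
  by unfold_locales (auto intro: ip_add_left ip_smult_left ip_cnj ip_nonneg)

context semi_inner_product_space
begin

lemma smult_carrier [simp, intro]: "x \<in> carrier V \<Longrightarrow> c \<odot> x \<in> carrier V"
  using smult_closed[of c x] by simp

lemma smult_smult: "x \<in> carrier V \<Longrightarrow> c \<odot> (d \<odot> x) = (c * d) \<odot> x"
  using smult_assoc1[of c d x] by simp

lemma smult_add_left: "x \<in> carrier V \<Longrightarrow> (c + d) \<odot> x = c \<odot> x \<oplus> d \<odot> x"
  using smult_l_distr[of c d x] by simp

lemma smult_add_right: "x \<in> carrier V \<Longrightarrow> y \<in> carrier V \<Longrightarrow> c \<odot> (x \<oplus> y) = c \<odot> x \<oplus> c \<odot> y"
  using smult_r_distr[of c x y] by simp

lemma smult_one' [simp]: "x \<in> carrier V \<Longrightarrow> 1 \<odot> x = x"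
  using smult_one[of x] by simp

lemma smult_zero_left [simp]: "x \<in> carrier V \<Longrightarrow> 0 \<odot> x = \<zero>"
  using smult_l_null[of x] by simp

lemma smult_zero_right [simp]: "c \<odot> \<zero> = \<zero>"
  using smult_r_null[of c] by simp

lemma a_inv_eq_smult: "x \<in> carrier V \<Longrightarrow> \<ominus> x = (- 1) \<odot> x"
  using smult_l_minus[of 1 x] by simp

lemma minus_eq_smult: "x \<in> carrier V \<Longrightarrow> y \<in> carrier V \<Longrightarrow> x \<ominus> y = x \<oplus> (- 1) \<odot> y"
  by (simp add: M.minus_eq a_inv_eq_smult)

lemma ip_add_right: "x \<in> carrier V \<Longrightarrow> y \<in> carrier V \<Longrightarrow> z \<in> carrier V \<Longrightarrow>
    ip V z (x \<oplus> y) = ip V z x + ip V z y"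
  by (subst (1 2 3) ip_cnj) (auto simp: ip_add_left)

lemma ip_smult_right: "x \<in> carrier V \<Longrightarrow> y \<in> carrier V \<Longrightarrow> ip V y (c \<odot> x) = cnj c * ip V y x"
  by (subst (1 2) ip_cnj) (auto simp: ip_smult_left)

lemma ip_zero_left [simp]: "y \<in> carrier V \<Longrightarrow> ip V \<zero> y = 0"
  using ip_smult_left[of y y 0] by simp

lemma ip_zero_right [simp]: "y \<in> carrier V \<Longrightarrow> ip V y \<zero> = 0"
  using ip_smult_right[of y y 0] by simp

lemma ip_minus_left: "x \<in> carrier V \<Longrightarrow> y \<in> carrier V \<Longrightarrow> z \<in> carrier V \<Longrightarrow>
    ip V (x \<ominus> y) z = ip V x z - ip V y z"
  by (simp add: minus_eq_smult ip_add_left ip_smult_left)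

lemma ip_minus_right: "x \<in> carrier V \<Longrightarrow> y \<in> carrier V \<Longrightarrow> z \<in> carrier V \<Longrightarrow>
    ip V z (x \<ominus> y) = ip V z x - ip V z y"
  by (simp add: minus_eq_smult ip_add_right ip_smult_right)

lemma ip_self: "x \<in> carrier V \<Longrightarrow> ip V x x = complex_of_real ((vnorm V x)\<^sup>2)"
  using ip_cnj[of x x] ip_nonneg[of x] by (auto simp: vnorm_def complex_eq_iff)

lemma vnorm_nonneg [simp]: "x \<in> carrier V \<Longrightarrow> vnorm V x \<ge> 0"
  using ip_nonneg[of x] by (simp add: vnorm_def)

lemma cauchy_schwarz:
  assumes "x \<in> carrier V" "y \<in> carrier V"
  shows "cmod (ip V x y) \<le> vnorm V x * vnorm V y"
proof -
  define a b w where "a = (vnorm V x)\<^sup>2" and "b = (vnorm V y)\<^sup>2" and "w = ip V x y"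
  have pos: "a + (cmod c)\<^sup>2 * b - 2 * Re (cnj c * w) \<ge> 0" for c
  proof -
    \<comment> \<open>the usual quadratic function of the coefficient; below it is evaluated at real multiples of \<open>w\<close>\<close>
    have "0 \<le> Re (ip V (x \<ominus> c \<odot> y) (x \<ominus> c \<odot> y))"
      using assms by (intro ip_nonneg) auto
    also have "ip V (x \<ominus> c \<odot> y) (x \<ominus> c \<odot> y) =
        complex_of_real a + (c * cnj c) * complex_of_real b - (cnj c * w + cnj (cnj c * w))"
      using assms ip_cnj[of x y]
      by (simp add: ip_minus_left ip_minus_right ip_smult_left ip_smult_right
          ip_self[OF assms(1)] ip_self[OF assms(2)] a_def b_def w_def algebra_simps)
    finally show ?thesis
      by (simp add: complex_norm_square[symmetric] del: complex_cnj_mult of_real_power)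
  qed
  have real: "a + t\<^sup>2 * (cmod w)\<^sup>2 * b - 2 * t * (cmod w)\<^sup>2 \<ge> 0" for t :: real
  proof -
    have "cnj (of_real t * w) * w = of_real (t * (cmod w)\<^sup>2)"
      by (simp add: complex_norm_square mult_ac del: of_real_power)
    then have "Re (cnj (of_real t * w) * w) = t * (cmod w)\<^sup>2"
      by (simp only: Re_complex_of_real)
    then show ?thesis
      using pos[of "of_real t * w"]
      by (simp only: norm_mult norm_of_real power_mult_distrib power2_abs mult.assoc)
  qed
  have ab: "a \<ge> 0" "b \<ge> 0" by (auto simp: a_def b_def)
  have "(cmod w)\<^sup>2 \<le> a * b"
  proof (cases "b = 0")
    case True
    show ?thesis
    proof (rule ccontr)
      assume "\<not> ?thesis"
      then have "(cmod w)\<^sup>2 > 0" using True by simp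
      then show False
        \<comment> \<open>the quadratic term vanishes, so a large multiple makes the linear term win\<close>
        using real[of "(a + 1) / (2 * (cmod w)\<^sup>2)"] True by (simp add: field_simps)
    qed
  next
    case False
    then show ?thesis
      using real[of "1 / b"] ab by (simp add: power2_eq_square field_simps)
  qed
  then have "(cmod w)\<^sup>2 \<le> (vnorm V x * vnorm V y)\<^sup>2"
    by (simp add: a_def b_def power_mult_distrib)
  then show ?thesis
    using assms by (simp add: w_def power2_le_iff_abs_le)
qed

lemma ip_null_left: "x \<in> carrier V \<Longrightarrow> y \<in> carrier V \<Longrightarrow> ip V x x = 0 \<Longrightarrow> ip V x y = 0"
  using cauchy_schwarz[of x y] by (simp add: vnorm_def)

lemma vnorm_add_le:
  assumes "x \<in> carrier V" "y \<in> carrier V"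
  shows "vnorm V (x \<oplus> y) \<le> vnorm V x + vnorm V y"
proof -
  have "complex_of_real ((vnorm V (x \<oplus> y))\<^sup>2) =
      complex_of_real ((vnorm V x)\<^sup>2 + (vnorm V y)\<^sup>2) + (ip V x y + cnj (ip V x y))"
    using assms ip_cnj[of x y] ip_self[of x] ip_self[of y] ip_self[of "x \<oplus> y"]
    by (simp add: ip_add_left ip_add_right algebra_simps)
  then have "(vnorm V (x \<oplus> y))\<^sup>2 = (vnorm V x)\<^sup>2 + (vnorm V y)\<^sup>2 + 2 * Re (ip V x y)"
    by (auto dest!: arg_cong[where f=Re] simp del: of_real_power of_real_add)
  also have "\<dots> \<le> (vnorm V x + vnorm V y)\<^sup>2"
    unfolding power2_sum
    using cauchy_schwarz[OF assms] complex_Re_le_cmod[of "ip V x y"] by linarith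
  finally show ?thesis
    by (rule power2_le_imp_le) (simp add: assms add_nonneg_nonneg)
qed

lemma vnorm_smult:
  assumes "x \<in> carrier V"
  shows "vnorm V (c \<odot> x) = cmod c * vnorm V x"
proof -
  have "ip V (c \<odot> x) (c \<odot> x) = of_real ((cmod c)\<^sup>2) * ip V x x"
    using assms by (simp add: ip_smult_left ip_smult_right complex_norm_square mult_ac del: of_real_power)
  then show ?thesis
    by (simp add: vnorm_def real_sqrt_mult)
qed

lemma vdist_nonneg [simp]: "x \<in> carrier V \<Longrightarrow> y \<in> carrier V \<Longrightarrow> vdist V x y \<ge> 0"
  by (simp add: vdist_def)

lemma vnorm_zero [simp]: "vnorm V \<zero> = 0"
  by (simp add: vnorm_def)

lemma minus_self: "x \<in> carrier V \<Longrightarrow> x \<ominus> x = \<zero>"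
  by (simp add: M.minus_eq M.r_neg)

lemma vdist_self [simp]: "x \<in> carrier V \<Longrightarrow> vdist V x x = 0"
  by (simp add: vdist_def minus_self)

lemma vdist_smult:
  assumes "x \<in> carrier V" "y \<in> carrier V"
  shows "vdist V (c \<odot> x) (c \<odot> y) = cmod c * vdist V x y"
proof -
  have "c \<odot> x \<ominus> c \<odot> y = c \<odot> (x \<ominus> y)"
    using assms by (simp add: minus_eq_smult smult_smult smult_add_right mult.commute)
  then show ?thesis
    using assms by (simp add: vdist_def vnorm_smult)
qed

lemma vdist_commute:
  assumes "x \<in> carrier V" "y \<in> carrier V"
  shows "vdist V x y = vdist V y x"
proof -
  have "x \<ominus> y = (- 1) \<odot> (y \<ominus> x)"
    using assms by (simp add: minus_eq_smult smult_smult smult_add_right M.a_comm)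
  then show ?thesis
    using assms by (simp add: vdist_def vnorm_smult)
qed

lemma vdist_triangle:
  assumes "x \<in> carrier V" "y \<in> carrier V" "z \<in> carrier V"
  shows "vdist V x z \<le> vdist V x y + vdist V y z"
proof -
  have "x \<ominus> z = (x \<ominus> y) \<oplus> (y \<ominus> z)"
    using assms by (simp add: M.minus_eq M.a_assoc M.r_neg2 M.r_neg1)
  then show ?thesis
    using assms vnorm_add_le[of "x \<ominus> y" "y \<ominus> z"] by (simp add: vdist_def)
qed

lemma vdist_add_le:
  assumes "x \<in> carrier V" "y \<in> carrier V" "x' \<in> carrier V" "y' \<in> carrier V"
  shows "vdist V (x \<oplus> y) (x' \<oplus> y') \<le> vdist V x x' + vdist V y y'"
proof -
  have "(x \<oplus> y) \<ominus> (x' \<oplus> y') = (x \<ominus> x') \<oplus> (y \<ominus> y')"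
    using assms by (simp add: M.minus_eq M.minus_add M.a_ac)
  then show ?thesis
    using assms vnorm_add_le[of "x \<ominus> x'" "y \<ominus> y'"] by (simp add: vdist_def)
qed

lemma vdist_sq:
  assumes "x \<in> carrier V" "y \<in> carrier V"
  shows "(vdist V x y)\<^sup>2 = Re (ip V x x - ip V x y - ip V y x + ip V y y)"
  using assms ip_nonneg[of "x \<ominus> y"]
  by (simp add: vdist_def vnorm_def ip_minus_left ip_minus_right)

lemma vnorm_le_vdist:
  assumes "x \<in> carrier V" "y \<in> carrier V"
  shows "vnorm V x \<le> vdist V x y + vnorm V y"
proof -
  have "x = (x \<ominus> y) \<oplus> y"
    using assms by (simp add: M.minus_eq M.a_assoc M.l_neg)
  then show ?thesis
    using assms vnorm_add_le[of "x \<ominus> y" y] by (simp add: vdist_def)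
qed

lemma ip_diff_le:
  assumes "x \<in> carrier V" "y \<in> carrier V" "x' \<in> carrier V" "y' \<in> carrier V"
  shows "cmod (ip V x y - ip V x' y') \<le> vdist V x x' * vnorm V y + vnorm V x' * vdist V y y'"
proof -
  have "ip V x y - ip V x' y' = ip V (x \<ominus> x') y + ip V x' (y \<ominus> y')"
    using assms by (simp add: ip_minus_left ip_minus_right)
  also have "cmod \<dots> \<le> cmod (ip V (x \<ominus> x') y) + cmod (ip V x' (y \<ominus> y'))"
    by (rule norm_triangle_ineq)
  also have "\<dots> \<le> vdist V x x' * vnorm V y + vnorm V x' * vdist V y y'"
    unfolding vdist_def using assms by (intro add_mono cauchy_schwarz) auto
  finally show ?thesis .
qed

lemma ip_tendsto:
  assumes "((\<lambda>i. vdist V (s i) x) \<longlongrightarrow> 0) F" "((\<lambda>i. vdist V (t i) y) \<longlongrightarrow> 0) F"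
    and "eventually (\<lambda>i. s i \<in> carrier V) F" "eventually (\<lambda>i. t i \<in> carrier V) F"
    and "x \<in> carrier V" "y \<in> carrier V"
  shows "((\<lambda>i. ip V (s i) (t i)) \<longlongrightarrow> ip V x y) F"
proof -
  have "((\<lambda>i. vdist V (s i) x * (vdist V (t i) y + vnorm V y) + vnorm V x * vdist V (t i) y) \<longlongrightarrow>
      0 * (0 + vnorm V y) + vnorm V x * 0) F"
    by (intro tendsto_intros assms)
  then have lim: "((\<lambda>i. vdist V (s i) x * (vdist V (t i) y + vnorm V y) + vnorm V x * vdist V (t i) y)
      \<longlongrightarrow> 0) F"
    by simp
  have le: "eventually (\<lambda>i. cmod (ip V (s i) (t i) - ip V x y) \<le>
      vdist V (s i) x * (vdist V (t i) y + vnorm V y) + vnorm V x * vdist V (t i) y) F"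
    using assms(3,4)
  proof eventually_elim
    case (elim i)
    have "vdist V (s i) x * vnorm V (t i) \<le> vdist V (s i) x * (vdist V (t i) y + vnorm V y)"
      using elim assms(5,6) by (intro mult_left_mono vnorm_le_vdist) auto
    then show ?case
      using ip_diff_le[of "s i" "t i" x y] elim assms(5,6) by linarith
  qed
  have "((\<lambda>i. ip V (s i) (t i) - ip V x y) \<longlongrightarrow> 0) F"
    by (rule Lim_null_comparison[OF le lim])
  then show ?thesis
    by (rule LIM_zero_cancel)
qed

end

text \<open>The subtraction of a subspace record refers to its own carrier, so it is not syntactically that of
the ambient space; expanding the squared distance by the form avoids it.\<close>
lemma vdist_cong:
  assumes "semi_inner_product_space V" "semi_inner_product_space W"
    and "x \<in> carrier V" "y \<in> carrier V" "x \<in> carrier W" "y \<in> carrier W"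
    and "ip V = ip W"
  shows "vdist V x y = vdist W x y"
proof -
  interpret V: semi_inner_product_space V by fact
  interpret W: semi_inner_product_space W by fact
  have "(vdist V x y)\<^sup>2 = (vdist W x y)\<^sup>2"
    using assms(3-) by (simp add: V.vdist_sq W.vdist_sq)
  then show ?thesis using assms(3-6) by simp
qed

context inner_product_space
begin

lemma vdist_eq_0_iff:
  assumes "x \<in> carrier V" "y \<in> carrier V"
  shows "vdist V x y = 0 \<longleftrightarrow> x = y"
proof
  assume "vdist V x y = 0"
  then have "x \<ominus> y = \<zero>"
    using assms ip_definite[of "x \<ominus> y"] by (simp add: ip_self vdist_def)
  then show "x = y"
    using assms by (metis M.minus_eq M.minus_minus M.a_inv_closed M.minus_equality M.a_comm)
qed (use assms in auto)

end

text \<open>The module laws are equations, so they pass to every image under a map that is compatible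
  with the operations.\<close>

lemma module_image:
  fixes M :: "(complex, 'u, 'm) module_scheme" and V :: "(complex, 'v, 'n) module_scheme"
  assumes "Module.module complex_field M"
    and carrier: "carrier V = f ` carrier M"
    and zero: "\<zero>\<^bsub>V\<^esub> = f \<zero>\<^bsub>M\<^esub>"
    and add: "\<And>x y. x \<in> carrier M \<Longrightarrow> y \<in> carrier M \<Longrightarrow> f x \<oplus>\<^bsub>V\<^esub> f y = f (x \<oplus>\<^bsub>M\<^esub> y)"
    and smult: "\<And>c x. x \<in> carrier M \<Longrightarrow> c \<odot>\<^bsub>V\<^esub> f x = f (c \<odot>\<^bsub>M\<^esub> x)"
  shows "Module.module complex_field V"
proof -
  interpret Module.module complex_field M by fact
  have [simp]: "c \<odot>\<^bsub>M\<^esub> x \<in> carrier M" if "x \<in> carrier M" for c x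
    using smult_closed[of c x] that by simp
  show ?thesis
  proof (rule moduleI)
    show "cring complex_field" by (rule cring_complex_field)
    show "abelian_group V"
    proof (rule abelian_groupI)
      fix x assume "x \<in> carrier V"
      then obtain u where u: "u \<in> carrier M" "x = f u" by (auto simp: carrier)
      show "\<exists>y\<in>carrier V. y \<oplus>\<^bsub>V\<^esub> x = \<zero>\<^bsub>V\<^esub>"
        by (rule bexI[of _ "f (\<ominus>\<^bsub>M\<^esub> u)"]) (use u in \<open>auto simp: carrier add zero M.l_neg\<close>)
    qed (auto simp: carrier zero add M.a_ac)
  next
    fix a b x assume "x \<in> carrier V"
    then show "(a \<oplus>\<^bsub>complex_field\<^esub> b) \<odot>\<^bsub>V\<^esub> x = (a \<odot>\<^bsub>V\<^esub> x) \<oplus>\<^bsub>V\<^esub> (b \<odot>\<^bsub>V\<^esub> x)"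
      using smult_l_distr[of a b] by (auto simp: carrier add smult)
  next
    fix a b x assume "x \<in> carrier V"
    then show "(a \<otimes>\<^bsub>complex_field\<^esub> b) \<odot>\<^bsub>V\<^esub> x = a \<odot>\<^bsub>V\<^esub> (b \<odot>\<^bsub>V\<^esub> x)"
      using smult_assoc1[of a b] by (auto simp: carrier smult)
  next
    fix a x y assume "x \<in> carrier V" "y \<in> carrier V"
    then show "a \<odot>\<^bsub>V\<^esub> (x \<oplus>\<^bsub>V\<^esub> y) = (a \<odot>\<^bsub>V\<^esub> x) \<oplus>\<^bsub>V\<^esub> (a \<odot>\<^bsub>V\<^esub> y)"
      using smult_r_distr[of a] by (auto simp: carrier add smult)
  next
    fix x assume "x \<in> carrier V"
    then show "\<one>\<^bsub>complex_field\<^esub> \<odot>\<^bsub>V\<^esub> x = x"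
      using smult_one by (auto simp: carrier smult)
  qed (auto simp: carrier smult)
qed

section \<open>Quotient by the kernel of the form\<close>

context semi_inner_product_space
begin

lemma form_kernelD: "h \<in> form_kernel V \<Longrightarrow> h \<in> carrier V"
    "h \<in> form_kernel V \<Longrightarrow> y \<in> carrier V \<Longrightarrow> ip V h y = 0"
  by (auto simp: form_kernel_def)

lemma form_kernel_right: "h \<in> form_kernel V \<Longrightarrow> y \<in> carrier V \<Longrightarrow> ip V y h = 0"
  using ip_cnj[of h y] by (auto simp: form_kernel_def)

lemma form_kernel_smult: "h \<in> form_kernel V \<Longrightarrow> c \<odot> h \<in> form_kernel V"
  by (auto simp: form_kernel_def ip_smult_left)

lemma form_kernel_subgroup: "subgroup (form_kernel V) (add_monoid V)"
proof -
  have "submodule (form_kernel V) complex_field V"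
    by (rule submoduleI)
      (auto simp: form_kernel_def ip_add_left ip_smult_left a_inv_eq_smult)
  then show ?thesis
    by (rule submodule.axioms)
qed

lemma form_kernel_abelian_subgroup: "abelian_subgroup (form_kernel V) V"
  by (rule abelian_subgroupI3) (rule additive_subgroup.intro[OF form_kernel_subgroup],
      rule M.abelian_group_axioms)

text \<open>All elements of a coset of the kernel give the same coset, which is what makes the operations of
the quotient independent of representatives.\<close>
lemma kernel_coset_eqI:
  "x \<in> carrier V \<Longrightarrow> h \<in> form_kernel V \<Longrightarrow> form_kernel V +> (h \<oplus> x) = form_kernel V +> x"
  by (rule M.a_repr_independence[symmetric])
    (auto simp: a_r_coset_def' form_kernel_subgroup)

lemma kernel_coset_add:
  "x \<in> carrier V \<Longrightarrow> y \<in> carrier V \<Longrightarrow>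
    (form_kernel V +> x) <+> (form_kernel V +> y) = form_kernel V +> (x \<oplus> y)"
  by (rule abelian_subgroup.a_rcos_sum[OF form_kernel_abelian_subgroup])

end

lemma quotient_space_carrier:
  "carrier (quotient_space V) = (\<lambda>x. form_kernel V +>\<^bsub>V\<^esub> x) ` carrier V"
  by (auto simp: quotient_space_def Let_def A_RCOSETS_def')

context
  fixes V :: "'v inner_space" (structure)
  assumes semi: "semi_inner_product_space V"
begin

interpretation semi_inner_product_space V by (rule semi)

lemma quotient_space_zero: "\<zero>\<^bsub>quotient_space V\<^esub> = form_kernel V +> \<zero>"
  using M.a_coset_add_zero[OF subsetI[OF form_kernelD(1)]]
  by (simp add: quotient_space_def Let_def)

lemma quotient_space_add:
  assumes "x \<in> carrier V" "y \<in> carrier V"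
  shows "(form_kernel V +> x) \<oplus>\<^bsub>quotient_space V\<^esub> (form_kernel V +> y) = form_kernel V +> (x \<oplus> y)"
  using kernel_coset_add[OF assms] by (simp add: quotient_space_def Let_def)

lemma quotient_space_smult:
  assumes "x \<in> carrier V"
  shows "c \<odot>\<^bsub>quotient_space V\<^esub> (form_kernel V +> x) = form_kernel V +> (c \<odot> x)"
proof -
  have "form_kernel V +> (c \<odot> z) = form_kernel V +> (c \<odot> x)" if "z \<in> form_kernel V +> x" for z
  proof -
    obtain h where h: "h \<in> form_kernel V" "z = h \<oplus> x"
      using \<open>z \<in> form_kernel V +> x\<close> by (auto simp: a_r_coset_def')
    then show ?thesis
      using assms kernel_coset_eqI[of "c \<odot> x" "c \<odot> h"]
      by (simp add: form_kernelD smult_add_right form_kernel_smult)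
  qed
  moreover have "x \<in> form_kernel V +> x"
    by (rule abelian_subgroup.a_rcos_self[OF form_kernel_abelian_subgroup assms])
  ultimately have "(\<Union>z\<in>form_kernel V +> x. form_kernel V +> (c \<odot> z)) = form_kernel V +> (c \<odot> x)"
    by (intro SUP_eq_const) blast+
  then show ?thesis
    by (simp add: quotient_space_def Let_def)
qed

lemma quotient_space_ip:
  assumes "x \<in> carrier V" "y \<in> carrier V"
  shows "ip (quotient_space V) (form_kernel V +> x) (form_kernel V +> y) = ip V x y"
proof -
  have "ip V x' y' = ip V x y" if "x' \<in> form_kernel V +> x" "y' \<in> form_kernel V +> y" for x' y'
  proof -
    obtain h where "h \<in> form_kernel V" "x' = h \<oplus> x"
      using \<open>x' \<in> form_kernel V +> x\<close> by (auto simp: a_r_coset_def')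
    moreover obtain k where "k \<in> form_kernel V" "y' = k \<oplus> y"
      using \<open>y' \<in> form_kernel V +> y\<close> by (auto simp: a_r_coset_def')
    ultimately show ?thesis
      using assms
      by (simp add: form_kernelD form_kernel_right ip_add_left ip_add_right)
  qed
  moreover have "x \<in> form_kernel V +> x" "y \<in> form_kernel V +> y"
    by (rule abelian_subgroup.a_rcos_self[OF form_kernel_abelian_subgroup], fact)+
  ultimately have "(THE w. \<exists>x'\<in>form_kernel V +> x. \<exists>y'\<in>form_kernel V +> y. w = ip V x' y') = ip V x y"
    by (intro the_equality) blast+
  then show ?thesis
    by (simp add: quotient_space_def Let_def)
qed

text \<open>Definiteness is Cauchy-Schwarz: a vector of length zero is orthogonal to every vector, so it
belongs to the kernel of the form.\<close>
theorem quotient_space_inner_product_space: "inner_product_space (quotient_space V)"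
proof -
  interpret Q: Module.module complex_field "quotient_space V"
    by (rule module_image[where M=V and f="\<lambda>x. form_kernel V +> x"])
      (auto simp: quotient_space_carrier quotient_space_zero quotient_space_add
        quotient_space_smult module_axioms)
  show ?thesis
  proof unfold_locales
    fix x y assume "x \<in> carrier (quotient_space V)" "y \<in> carrier (quotient_space V)"
    then obtain x' y' where xy: "x' \<in> carrier V" "y' \<in> carrier V"
        "x = form_kernel V +> x'" "y = form_kernel V +> y'"
      by (auto simp: quotient_space_carrier)
    show "ip (quotient_space V) (c \<odot>\<^bsub>quotient_space V\<^esub> x) y = c * ip (quotient_space V) x y" for c
      using xy by (simp add: quotient_space_smult quotient_space_ip ip_smult_left)
    show "ip (quotient_space V) y x = cnj (ip (quotient_space V) x y)"
      using xy ip_cnj[of x' y'] by (simp add: quotient_space_ip)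
    fix z assume "z \<in> carrier (quotient_space V)"
    then obtain z' where z: "z' \<in> carrier V" "z = form_kernel V +> z'"
      by (auto simp: quotient_space_carrier)
    show "ip (quotient_space V) (x \<oplus>\<^bsub>quotient_space V\<^esub> y) z
        = ip (quotient_space V) x z + ip (quotient_space V) y z"
      using xy z by (simp add: quotient_space_add quotient_space_ip ip_add_left)
  next
    fix x assume "x \<in> carrier (quotient_space V)"
    then obtain x' where x: "x' \<in> carrier V" "x = form_kernel V +> x'"
      by (auto simp: quotient_space_carrier)
    show "Re (ip (quotient_space V) x x) \<ge> 0"
      using x ip_nonneg by (simp add: quotient_space_ip)
    assume "ip (quotient_space V) x x = 0"
    then have "ip V x' x' = 0"
      using x by (simp add: quotient_space_ip)
    then have "x' \<in> form_kernel V"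
      using x ip_null_left[of x'] by (simp add: form_kernel_def)
    then show "x = \<zero>\<^bsub>quotient_space V\<^esub>"
      using x kernel_coset_eqI[of \<zero> x'] by (simp add: quotient_space_zero)
  qed
qed

end

section \<open>Hilbert space completion\<close>

lemma tendsto_zero_le:
  fixes f g :: "nat \<Rightarrow> real"
  assumes "g \<longlonglongrightarrow> 0" "\<And>n. 0 \<le> f n" "\<And>n. f n \<le> g n"
  shows "f \<longlonglongrightarrow> 0"
  using assms(2,3) by (intro tendsto_sandwich[OF _ _ tendsto_const assms(1)]) auto

context semi_inner_product_space
begin

lemma cauchy_carrier [simp]: "s \<in> cauchy_sequences V \<Longrightarrow> s n \<in> carrier V"
  by (auto simp: cauchy_sequences_def)

lemma cauchy_sequencesD: "s \<in> cauchy_sequences V \<Longrightarrow> \<epsilon> > 0 \<Longrightarrow>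
    \<exists>N. \<forall>m\<ge>N. \<forall>n\<ge>N. vdist V (s m) (s n) < \<epsilon>"
  by (auto simp: cauchy_sequences_def)

lemma cauchy_sequencesI: "(\<And>n. s n \<in> carrier V) \<Longrightarrow>
    (\<And>\<epsilon>. \<epsilon> > 0 \<Longrightarrow> \<exists>N. \<forall>m\<ge>N. \<forall>n\<ge>N. vdist V (s m) (s n) < \<epsilon>) \<Longrightarrow> s \<in> cauchy_sequences V"
  by (auto simp: cauchy_sequences_def)

lemma cauchy_const: "x \<in> carrier V \<Longrightarrow> (\<lambda>n. x) \<in> cauchy_sequences V"
  by (rule cauchy_sequencesI) auto

lemma cauchy_add:
  assumes s: "s \<in> cauchy_sequences V" and t: "t \<in> cauchy_sequences V"
  shows "(\<lambda>n. s n \<oplus> t n) \<in> cauchy_sequences V"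
proof (rule cauchy_sequencesI)
  fix \<epsilon> :: real assume "\<epsilon> > 0"
  then obtain N1 N2 where N: "\<forall>m\<ge>N1. \<forall>n\<ge>N1. vdist V (s m) (s n) < \<epsilon> / 2"
      "\<forall>m\<ge>N2. \<forall>n\<ge>N2. vdist V (t m) (t n) < \<epsilon> / 2"
    using cauchy_sequencesD[OF s, of "\<epsilon> / 2"] cauchy_sequencesD[OF t, of "\<epsilon> / 2"] by auto
  show "\<exists>N. \<forall>m\<ge>N. \<forall>n\<ge>N. vdist V (s m \<oplus> t m) (s n \<oplus> t n) < \<epsilon>"
  proof (intro exI[of _ "max N1 N2"] allI impI)
    fix m n assume "max N1 N2 \<le> m" "max N1 N2 \<le> n"
    then have "vdist V (s m) (s n) < \<epsilon> / 2" "vdist V (t m) (t n) < \<epsilon> / 2" using N by auto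
    then show "vdist V (s m \<oplus> t m) (s n \<oplus> t n) < \<epsilon>"
      using vdist_add_le[of "s m" "t m" "s n" "t n"] s t by simp
  qed
qed (use assms in auto)

lemma cauchy_smult:
  assumes s: "s \<in> cauchy_sequences V"
  shows "(\<lambda>n. c \<odot> s n) \<in> cauchy_sequences V"
proof (rule cauchy_sequencesI)
  fix \<epsilon> :: real assume e: "\<epsilon> > 0"
  have c: "cmod c + 1 > 0" by (simp add: add_nonneg_pos)
  then obtain N where N: "\<forall>m\<ge>N. \<forall>n\<ge>N. vdist V (s m) (s n) < \<epsilon> / (cmod c + 1)"
    using cauchy_sequencesD[OF s, of "\<epsilon> / (cmod c + 1)"] e by auto
  show "\<exists>N. \<forall>m\<ge>N. \<forall>n\<ge>N. vdist V (c \<odot> s m) (c \<odot> s n) < \<epsilon>"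
  proof (intro exI[of _ N] allI impI)
    fix m n assume "N \<le> m" "N \<le> n"
    then have "vdist V (s m) (s n) * (cmod c + 1) < \<epsilon>"
      using N c by (simp add: pos_less_divide_eq)
    moreover have "vdist V (s m) (s n) \<ge> 0"
      using s by simp
    moreover have "vdist V (c \<odot> s m) (c \<odot> s n) = cmod c * vdist V (s m) (s n)"
      using s by (simp add: vdist_smult)
    ultimately show "vdist V (c \<odot> s m) (c \<odot> s n) < \<epsilon>"
      by (simp add: algebra_simps)
  qed
qed (use assms in auto)

lemma cauchy_bounded:
  assumes s: "s \<in> cauchy_sequences V"
  obtains K where "K > 0" "\<And>n. vnorm V (s n) \<le> K"
proof -
  obtain N where N: "\<forall>m\<ge>N. \<forall>n\<ge>N. vdist V (s m) (s n) < 1"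
    using cauchy_sequencesD[OF s, of 1] by auto
  define K where "K = 1 + (\<Sum>i\<le>N. vnorm V (s i))"
  have le: "vnorm V (s i) \<le> (\<Sum>i\<le>N. vnorm V (s i))" if "i \<le> N" for i
    using that s by (intro member_le_sum) auto
  have "vnorm V (s n) \<le> K" for n
  proof (cases "n \<le> N")
    case True
    then show ?thesis using le[of n] by (simp add: K_def)
  next
    case False
    then have "vdist V (s n) (s N) < 1"
      using N by simp
    then show ?thesis
      using vnorm_le_vdist[of "s n" "s N"] s le[of N] by (simp add: K_def)
  qed
  moreover have "K > 0"
    using s unfolding K_def by (intro add_pos_nonneg sum_nonneg) auto
  ultimately show ?thesis using that by blast
qed

text \<open>Cauchy sequences are bounded, so the form is uniformly continuous along them.\<close>
lemma convergent_ip: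
  assumes s: "s \<in> cauchy_sequences V" and t: "t \<in> cauchy_sequences V"
  shows "convergent (\<lambda>n. ip V (s n) (t n))"
proof -
  obtain K where K: "K > 0" "\<And>n. vnorm V (s n) \<le> K" using cauchy_bounded[OF s] by auto
  obtain L where L: "L > 0" "\<And>n. vnorm V (t n) \<le> L" using cauchy_bounded[OF t] by auto
  have "Cauchy (\<lambda>n. ip V (s n) (t n))"
  proof (rule metric_CauchyI)
    fix \<epsilon> :: real assume e: "\<epsilon> > 0"
    obtain N1 where N1: "\<forall>m\<ge>N1. \<forall>n\<ge>N1. vdist V (s m) (s n) < \<epsilon> / (2 * L)"
      using cauchy_sequencesD[OF s, of "\<epsilon> / (2 * L)"] e L by auto
    obtain N2 where N2: "\<forall>m\<ge>N2. \<forall>n\<ge>N2. vdist V (t m) (t n) < \<epsilon> / (2 * K)"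
      using cauchy_sequencesD[OF t, of "\<epsilon> / (2 * K)"] e K by auto
    show "\<exists>N. \<forall>m\<ge>N. \<forall>n\<ge>N. dist (ip V (s m) (t m)) (ip V (s n) (t n)) < \<epsilon>"
    proof (intro exI[of _ "max N1 N2"] allI impI)
      fix m n assume "max N1 N2 \<le> m" "max N1 N2 \<le> n"
      then have d: "vdist V (s m) (s n) < \<epsilon> / (2 * L)" "vdist V (t m) (t n) < \<epsilon> / (2 * K)"
        using N1 N2 by auto
      have "vdist V (s m) (s n) * vnorm V (t m) \<le> vdist V (s m) (s n) * L"
        using L s by (intro mult_left_mono) auto
      also have "\<dots> < \<epsilon> / 2"
        using d(1) L by (simp add: field_simps)
      finally have 1: "vdist V (s m) (s n) * vnorm V (t m) < \<epsilon> / 2" .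
      have "vnorm V (s n) * vdist V (t m) (t n) \<le> K * vdist V (t m) (t n)"
        using K t by (intro mult_right_mono) auto
      also have "\<dots> < \<epsilon> / 2"
        using d(2) K by (simp add: field_simps)
      finally show "dist (ip V (s m) (t m)) (ip V (s n) (t n)) < \<epsilon>"
        using 1 ip_diff_le[of "s m" "t m" "s n" "t n"] s t by (simp add: dist_norm)
    qed
  qed
  then show ?thesis by (rule Cauchy_convergent)
qed

lemma null_equivD: "(s, t) \<in> null_equiv V \<Longrightarrow>
    s \<in> cauchy_sequences V \<and> t \<in> cauchy_sequences V \<and> (\<lambda>n. vdist V (s n) (t n)) \<longlonglongrightarrow> 0"
  by (simp add: null_equiv_def)

lemma equiv_null_equiv: "equiv (cauchy_sequences V) (null_equiv V)"
proof (rule equivI)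
  show "null_equiv V \<subseteq> cauchy_sequences V \<times> cauchy_sequences V"
    by (auto simp: null_equiv_def)
  show "refl_on (cauchy_sequences V) (null_equiv V)"
    by (auto simp: refl_on_def null_equiv_def)
  show "sym (null_equiv V)"
  proof (rule symI)
    fix s t assume "(s, t) \<in> null_equiv V"
    then show "(t, s) \<in> null_equiv V"
      using vdist_commute by (auto simp: null_equiv_def)
  qed
  show "trans (null_equiv V)"
  proof (rule transI)
    fix s t u assume "(s, t) \<in> null_equiv V" "(t, u) \<in> null_equiv V"
    note st = null_equivD[OF this(1)] null_equivD[OF this(2)]
    have "(\<lambda>n. vdist V (s n) (t n) + vdist V (t n) (u n)) \<longlonglongrightarrow> 0 + 0"
      using st by (intro tendsto_add) auto
    then have "(\<lambda>n. vdist V (s n) (u n)) \<longlonglongrightarrow> 0"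
      using st by (rule_tac tendsto_zero_le[where g="\<lambda>n. vdist V (s n) (t n) + vdist V (t n) (u n)"])
        (auto intro: vdist_triangle)
    then show "(s, u) \<in> null_equiv V"
      using st by (auto simp: null_equiv_def)
  qed
qed

lemma null_equiv_add:
  assumes "(s, s') \<in> null_equiv V" "(t, t') \<in> null_equiv V"
  shows "(\<lambda>n. s n \<oplus> t n, \<lambda>n. s' n \<oplus> t' n) \<in> null_equiv V"
proof -
  note st = null_equivD[OF assms(1)] null_equivD[OF assms(2)]
  have "(\<lambda>n. vdist V (s n) (s' n) + vdist V (t n) (t' n)) \<longlonglongrightarrow> 0 + 0"
    using st by (intro tendsto_add) auto
  then have "(\<lambda>n. vdist V (s n \<oplus> t n) (s' n \<oplus> t' n)) \<longlonglongrightarrow> 0"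
    using st by (rule_tac tendsto_zero_le[where g="\<lambda>n. vdist V (s n) (s' n) + vdist V (t n) (t' n)"])
      (auto intro: vdist_add_le)
  then show ?thesis
    using st by (auto simp: null_equiv_def cauchy_add)
qed

lemma null_equiv_smult:
  assumes "(s, s') \<in> null_equiv V"
  shows "(\<lambda>n. c \<odot> s n, \<lambda>n. c \<odot> s' n) \<in> null_equiv V"
proof -
  note st = null_equivD[OF assms(1)]
  have "(\<lambda>n. cmod c * vdist V (s n) (s' n)) \<longlonglongrightarrow> cmod c * 0"
    using st by (intro tendsto_mult_left) auto
  then show ?thesis
    using st by (auto simp: null_equiv_def cauchy_smult vdist_smult)
qed

lemma null_equiv_ip:
  assumes "(s, s') \<in> null_equiv V" "(t, t') \<in> null_equiv V"
    and "(\<lambda>n. ip V (s n) (t n)) \<longlonglongrightarrow> w"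
  shows "(\<lambda>n. ip V (s' n) (t' n)) \<longlonglongrightarrow> w"
proof -
  note st = null_equivD[OF assms(1)] null_equivD[OF assms(2)]
  obtain K where K: "\<And>n. vnorm V (s n) \<le> K" using cauchy_bounded st by metis
  obtain L where L: "\<And>n. vnorm V (t' n) \<le> L" using cauchy_bounded st by metis
  have lim: "(\<lambda>n. vdist V (s n) (s' n) * L + K * vdist V (t n) (t' n)) \<longlonglongrightarrow> 0 * L + K * 0"
    using st by (intro tendsto_intros) auto
  have "cmod (ip V (s' n) (t' n) - ip V (s n) (t n))
      \<le> vdist V (s n) (s' n) * L + K * vdist V (t n) (t' n)" for n
  proof -
    have "vdist V (s' n) (s n) * vnorm V (t' n) \<le> vdist V (s' n) (s n) * L"
      using L st by (intro mult_left_mono) auto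
    moreover have "vnorm V (s n) * vdist V (t' n) (t n) \<le> K * vdist V (t' n) (t n)"
      using K st by (intro mult_right_mono) auto
    moreover have "vdist V (s' n) (s n) = vdist V (s n) (s' n)" "vdist V (t' n) (t n) = vdist V (t n) (t' n)"
      using st by (auto intro: vdist_commute)
    ultimately show ?thesis
      using ip_diff_le[of "s' n" "t' n" "s n" "t n"] st by auto
  qed
  then have "(\<lambda>n. ip V (s' n) (t' n) - ip V (s n) (t n)) \<longlonglongrightarrow> 0"
    by (intro Lim_null_comparison[OF _ lim[simplified]]) auto
  from tendsto_add[OF this assms(3)] show ?thesis by simp
qed

end

context
  fixes V :: "'v inner_space" (structure)
  assumes inner: "inner_product_space V"
begin

interpretation inner_product_space V by (rule inner)

abbreviation (input) seq_class where "seq_class s \<equiv> null_equiv V `` {s}"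
abbreviation (input) \<C> where "\<C> \<equiv> hilbert_completion V"

lemma completion_class_eq_iff:
  "s \<in> cauchy_sequences V \<Longrightarrow> t \<in> cauchy_sequences V \<Longrightarrow>
    seq_class s = seq_class t \<longleftrightarrow> (\<lambda>n. vdist V (s n) (t n)) \<longlonglongrightarrow> 0"
  by (simp add: eq_equiv_class_iff[OF equiv_null_equiv]) (simp add: null_equiv_def)

lemma completion_carrier: "carrier \<C> = (\<lambda>s. seq_class s) ` cauchy_sequences V"
  by (auto simp: hilbert_completion_def quotient_def)

lemma completion_zero: "\<zero>\<^bsub>\<C>\<^esub> = seq_class (\<lambda>n. \<zero>)"
  by (simp add: hilbert_completion_def)

lemma self_in_class: "s \<in> cauchy_sequences V \<Longrightarrow> s \<in> seq_class s"
  using equiv_null_equiv by (rule equiv_class_self)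

lemma completion_add:
  assumes "s \<in> cauchy_sequences V" "t \<in> cauchy_sequences V"
  shows "seq_class s \<oplus>\<^bsub>\<C>\<^esub> seq_class t = seq_class (\<lambda>n. s n \<oplus> t n)"
proof -
  have "seq_class (\<lambda>n. s' n \<oplus> t' n) = seq_class (\<lambda>n. s n \<oplus> t n)" if "s' \<in> seq_class s" "t' \<in> seq_class t" for s' t'
    using that by (intro equiv_class_eq[OF equiv_null_equiv, symmetric] null_equiv_add) auto
  then have "(\<Union>s'\<in>seq_class s. \<Union>t'\<in>seq_class t. seq_class (\<lambda>n. s' n \<oplus> t' n)) = seq_class (\<lambda>n. s n \<oplus> t n)"
    using self_in_class[OF assms(1)] self_in_class[OF assms(2)]
    by (intro SUP_eq_const) blast+
  then show ?thesis
    by (simp add: hilbert_completion_def)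
qed

lemma completion_smult:
  assumes "s \<in> cauchy_sequences V"
  shows "c \<odot>\<^bsub>\<C>\<^esub> seq_class s = seq_class (\<lambda>n. c \<odot> s n)"
proof -
  have "seq_class (\<lambda>n. c \<odot> s' n) = seq_class (\<lambda>n. c \<odot> s n)" if "s' \<in> seq_class s" for s'
    using that by (intro equiv_class_eq[OF equiv_null_equiv, symmetric] null_equiv_smult) auto
  then have "(\<Union>s'\<in>seq_class s. seq_class (\<lambda>n. c \<odot> s' n)) = seq_class (\<lambda>n. c \<odot> s n)"
    using self_in_class[OF assms(1)]
    by (intro SUP_eq_const) blast+
  then show ?thesis
    by (simp add: hilbert_completion_def)
qed

lemma completion_ip:
  assumes "s \<in> cauchy_sequences V" "t \<in> cauchy_sequences V"
  shows "(\<lambda>n. ip V (s n) (t n)) \<longlonglongrightarrow> ip \<C> (seq_class s) (seq_class t)"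
proof -
  obtain w where w: "(\<lambda>n. ip V (s n) (t n)) \<longlonglongrightarrow> w"
    using convergent_ip[OF assms] by (auto simp: convergent_def)
  have "w' = w" if "s' \<in> seq_class s" "t' \<in> seq_class t" "(\<lambda>n. ip V (s' n) (t' n)) \<longlonglongrightarrow> w'" for s' t' w'
    using LIMSEQ_unique[OF that(3) null_equiv_ip[of s s' t t', OF _ _ w]] that by auto
  then have "(THE w. \<exists>s'\<in>seq_class s. \<exists>t'\<in>seq_class t. (\<lambda>n. ip V (s' n) (t' n)) \<longlonglongrightarrow> w) = w"
    using w self_in_class assms by (intro the_equality) blast+
  then show ?thesis
    using w by (simp add: hilbert_completion_def)
qed

lemma module_completion: "Module.module complex_field \<C>"
proof (rule module_image[where f="\<lambda>s. seq_class s"])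
  let ?M = "\<lparr>carrier = cauchy_sequences V, monoid.mult = undefined, one = undefined,
    ring.zero = \<lambda>n. \<zero>, add = \<lambda>s t n. s n \<oplus> t n, smult = \<lambda>c s n. c \<odot> s n\<rparr>
    :: (complex, nat \<Rightarrow> 'v) module"
  show "Module.module complex_field ?M"
  proof (rule moduleI)
    show "abelian_group ?M"
    proof (rule abelian_groupI)
      fix s assume s: "s \<in> carrier ?M"
      then have "(\<lambda>n. (- 1) \<odot> s n) \<oplus>\<^bsub>?M\<^esub> s = \<zero>\<^bsub>?M\<^esub>"
        by (simp add: M.l_neg flip: a_inv_eq_smult)
      then show "\<exists>t\<in>carrier ?M. t \<oplus>\<^bsub>?M\<^esub> s = \<zero>\<^bsub>?M\<^esub>"
        using s by (intro bexI[of _ "\<lambda>n. (- 1) \<odot> s n"]) (simp_all add: cauchy_smult)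
    qed (auto simp: cauchy_add cauchy_const M.a_ac)
  qed (auto simp: cring_complex_field cauchy_smult smult_add_left smult_add_right smult_smult)
qed (auto simp: completion_carrier completion_zero completion_add completion_smult)

lemma inner_product_space_completion: "inner_product_space \<C>"
proof -
  interpret H: Module.module complex_field \<C> by (rule module_completion)
  show ?thesis
  proof unfold_locales
    fix x y assume "x \<in> carrier \<C>" "y \<in> carrier \<C>"
    then obtain s t where st: "s \<in> cauchy_sequences V" "t \<in> cauchy_sequences V" "x = seq_class s" "y = seq_class t"
      by (auto simp: completion_carrier)
    note lim = completion_ip[OF st(1,2)]
    show "ip \<C> (c \<odot>\<^bsub>\<C>\<^esub> x) y = c * ip \<C> x y" for c
    proof (rule LIMSEQ_unique)
      show "(\<lambda>n. ip V (c \<odot> s n) (t n)) \<longlonglongrightarrow> ip \<C> (c \<odot>\<^bsub>\<C>\<^esub> x) y"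
        using st by (simp add: completion_smult completion_ip cauchy_smult)
      show "(\<lambda>n. ip V (c \<odot> s n) (t n)) \<longlonglongrightarrow> c * ip \<C> x y"
        using tendsto_mult_left[OF lim, of c] st by (simp add: ip_smult_left)
    qed
    show "ip \<C> y x = cnj (ip \<C> x y)"
    proof (rule LIMSEQ_unique)
      show "(\<lambda>n. ip V (t n) (s n)) \<longlonglongrightarrow> ip \<C> y x"
        using st by (simp add: completion_ip)
      show "(\<lambda>n. ip V (t n) (s n)) \<longlonglongrightarrow> cnj (ip \<C> x y)"
        using tendsto_cnj[OF lim] st ip_cnj[of "s _" "t _"] by simp
    qed
    fix z assume "z \<in> carrier \<C>"
    then obtain u where u: "u \<in> cauchy_sequences V" "z = seq_class u"
      by (auto simp: completion_carrier)
    show "ip \<C> (x \<oplus>\<^bsub>\<C>\<^esub> y) z = ip \<C> x z + ip \<C> y z"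
    proof (rule LIMSEQ_unique)
      show "(\<lambda>n. ip V (s n \<oplus> t n) (u n)) \<longlonglongrightarrow> ip \<C> (x \<oplus>\<^bsub>\<C>\<^esub> y) z"
        using st u by (simp add: completion_add completion_ip cauchy_add)
      show "(\<lambda>n. ip V (s n \<oplus> t n) (u n)) \<longlonglongrightarrow> ip \<C> x z + ip \<C> y z"
        using tendsto_add[OF completion_ip[OF st(1) u(1)] completion_ip[OF st(2) u(1)]] st u
        by (simp add: ip_add_left)
    qed
  next
    fix x assume "x \<in> carrier \<C>"
    then obtain s where s: "s \<in> cauchy_sequences V" "x = seq_class s"
      by (auto simp: completion_carrier)
    note lim = tendsto_Re[OF completion_ip[OF s(1) s(1)]]
    show "Re (ip \<C> x x) \<ge> 0"
      unfolding s(2) by (rule tendsto_lowerbound[OF lim]) (use s ip_nonneg in auto)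
    assume "ip \<C> x x = 0"
    then have "(\<lambda>n. sqrt (Re (ip V (s n) (s n)))) \<longlonglongrightarrow> 0"
      using tendsto_real_sqrt[OF lim] s by simp
    then have "(\<lambda>n. vdist V (s n) \<zero>) \<longlonglongrightarrow> 0"
      using s by (simp add: vdist_def vnorm_def minus_eq_smult)
    then show "x = \<zero>\<^bsub>\<C>\<^esub>"
      using s by (simp add: completion_zero completion_class_eq_iff cauchy_const)
  qed
qed

interpretation H: inner_product_space \<C> by (rule inner_product_space_completion)

lemma class_carrier: "s \<in> cauchy_sequences V \<Longrightarrow> seq_class s \<in> carrier \<C>"
  by (auto simp: completion_carrier)

lemma completion_vdist:
  assumes "s \<in> cauchy_sequences V" "t \<in> cauchy_sequences V"
  shows "(\<lambda>n. vdist V (s n) (t n)) \<longlonglongrightarrow> vdist \<C> (seq_class s) (seq_class t)"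
proof -
  have "seq_class s \<ominus>\<^bsub>\<C>\<^esub> seq_class t = seq_class (\<lambda>n. s n \<ominus> t n)" "(\<lambda>n. s n \<ominus> t n) \<in> cauchy_sequences V"
    using assms by (simp_all add: H.minus_eq_smult class_carrier completion_smult completion_add
        cauchy_smult cauchy_add minus_eq_smult)
  then show ?thesis
    using tendsto_real_sqrt[OF tendsto_Re[OF completion_ip]] by (simp add: vdist_def vnorm_def)
qed

lemma completion_embedding_carrier: "x \<in> carrier V \<Longrightarrow> completion_embedding V x \<in> carrier \<C>"
  unfolding completion_embedding_def by (intro class_carrier cauchy_const)

lemma completion_embedding_add: "x \<in> carrier V \<Longrightarrow> y \<in> carrier V \<Longrightarrow>
    completion_embedding V x \<oplus>\<^bsub>\<C>\<^esub> completion_embedding V y = completion_embedding V (x \<oplus> y)"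
  unfolding completion_embedding_def by (simp add: completion_add cauchy_const)

lemma completion_embedding_smult: "x \<in> carrier V \<Longrightarrow>
    c \<odot>\<^bsub>\<C>\<^esub> completion_embedding V x = completion_embedding V (c \<odot> x)"
  unfolding completion_embedding_def by (simp add: completion_smult cauchy_const)

lemma completion_embedding_ip: "x \<in> carrier V \<Longrightarrow> y \<in> carrier V \<Longrightarrow>
    ip \<C> (completion_embedding V x) (completion_embedding V y) = ip V x y"
  unfolding completion_embedding_def
  using completion_ip[OF cauchy_const cauchy_const, of x y] by (simp add: LIMSEQ_const_iff)

lemma embedding_tendsto:
  assumes d: "d \<in> cauchy_sequences V"
  shows "(\<lambda>k. vdist \<C> (completion_embedding V (d k)) (seq_class d)) \<longlonglongrightarrow> 0"
proof (rule LIMSEQ_I)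
  fix r :: real assume "r > 0"
  then obtain N where N: "\<forall>m\<ge>N. \<forall>n\<ge>N. vdist V (d m) (d n) < r / 2"
    using cauchy_sequencesD[OF d, of "r / 2"] by auto
  have "vdist \<C> (completion_embedding V (d k)) (seq_class d) < r" if "k \<ge> N" for k
  proof -
    have "(\<lambda>n. vdist V (d k) (d n)) \<longlonglongrightarrow> vdist \<C> (completion_embedding V (d k)) (seq_class d)"
      unfolding completion_embedding_def using d by (intro completion_vdist cauchy_const) auto
    then have "vdist \<C> (completion_embedding V (d k)) (seq_class d) \<le> r / 2"
      by (rule tendsto_upperbound) (use N that in \<open>auto simp: eventually_sequentially intro: less_imp_le\<close>)
    then show ?thesis using \<open>r > 0\<close> by simp
  qed
  then show "\<exists>N. \<forall>k\<ge>N. norm (vdist \<C> (completion_embedding V (d k)) (seq_class d) - 0) < r"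
    using d by (intro exI[of _ N]) (auto simp: completion_embedding_carrier class_carrier)
qed

lemma completion_embedding_dense:
  assumes "x \<in> carrier \<C>" "\<epsilon> > 0"
  shows "\<exists>y\<in>carrier V. vdist \<C> (completion_embedding V y) x < \<epsilon>"
proof -
  obtain d where d: "d \<in> cauchy_sequences V" "x = seq_class d"
    using assms by (auto simp: completion_carrier)
  obtain N where "vdist \<C> (completion_embedding V (d N)) x < \<epsilon>"
    using eventually_happens'[OF _ order_tendstoD(2)[OF embedding_tendsto[OF d(1)] assms(2)]] d(2)
    by auto
  then show ?thesis using d(1) by (intro bexI[of _ "d N"]) simp_all
qed

text \<open>Given a Cauchy sequence of classes, approximate its \<open>k\<close>-th member up to \<open>1 / (k + 1)\<close> by an
embedded vector \<open>d k\<close>.  The sequence \<open>d\<close> is Cauchy, and its class is the limit.\<close>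
theorem hilbert_space_completion: "hilbert_space \<C>"
proof unfold_locales
  fix S assume S: "S \<in> cauchy_sequences \<C>"
  note Sc = H.cauchy_carrier[OF S]
  have "\<exists>y\<in>carrier V. vdist \<C> (completion_embedding V y) (S k) < 1 / real (Suc k)" for k
    using Sc by (intro completion_embedding_dense) auto
  then obtain d where d: "\<And>k. d k \<in> carrier V"
      "\<And>k. vdist \<C> (completion_embedding V (d k)) (S k) < 1 / real (Suc k)"
    by metis
  note ec = completion_embedding_carrier[OF d(1)]
  have dd: "vdist V x y = vdist \<C> (completion_embedding V x) (completion_embedding V y)"
    if "x \<in> carrier V" "y \<in> carrier V" for x y
    unfolding completion_embedding_def
    using completion_vdist[OF cauchy_const cauchy_const, of x y] that by (simp add: LIMSEQ_const_iff)
  have dS: "(\<lambda>k. vdist \<C> (completion_embedding V (d k)) (S k)) \<longlonglongrightarrow> 0"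
  proof (rule tendsto_sandwich[OF _ _ tendsto_const LIMSEQ_inverse_real_of_nat])
    show "\<forall>\<^sub>F k in sequentially. 0 \<le> vdist \<C> (completion_embedding V (d k)) (S k)"
      using ec Sc by simp
    show "\<forall>\<^sub>F k in sequentially. vdist \<C> (completion_embedding V (d k)) (S k) \<le> inverse (real (Suc k))"
      using d(2) by (intro always_eventually allI) (simp add: inverse_eq_divide less_imp_le)
  qed
  have dC: "d \<in> cauchy_sequences V"
  proof (rule cauchy_sequencesI)
    fix \<epsilon> :: real assume "\<epsilon> > 0"
    then have e3: "\<epsilon> / 3 > 0" by simp
    obtain N1 where N1: "\<forall>k\<ge>N1. vdist \<C> (completion_embedding V (d k)) (S k) < \<epsilon> / 3"
      using order_tendstoD(2)[OF dS e3] unfolding eventually_sequentially by blast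
    obtain N2 where N2: "\<forall>m\<ge>N2. \<forall>n\<ge>N2. vdist \<C> (S m) (S n) < \<epsilon> / 3"
      using H.cauchy_sequencesD[OF S e3] by blast
    show "\<exists>N. \<forall>m\<ge>N. \<forall>n\<ge>N. vdist V (d m) (d n) < \<epsilon>"
    proof (intro exI[of _ "max N1 N2"] allI impI)
      fix m n assume mn: "max N1 N2 \<le> m" "max N1 N2 \<le> n"
      let ?e = "\<lambda>k. completion_embedding V (d k)"
      have "vdist V (d m) (d n) = vdist \<C> (?e m) (?e n)"
        using d by (simp add: dd)
      also have "\<dots> \<le> vdist \<C> (?e m) (S m) + vdist \<C> (S m) (?e n)"
        using ec Sc by (intro H.vdist_triangle)
      also have "vdist \<C> (S m) (?e n) \<le> vdist \<C> (S m) (S n) + vdist \<C> (S n) (?e n)"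
        using ec Sc by (intro H.vdist_triangle)
      also have "vdist \<C> (S n) (?e n) = vdist \<C> (?e n) (S n)"
        using ec Sc by (intro H.vdist_commute)
      finally show "vdist V (d m) (d n) < \<epsilon>"
        using N1[rule_format, of m] N1[rule_format, of n] N2[rule_format, of m n] mn by simp
    qed
  qed (rule d(1))
  have cd: "seq_class d \<in> carrier \<C>" using dC by (rule class_carrier)
  have "(\<lambda>k. vdist \<C> (completion_embedding V (d k)) (S k)
      + vdist \<C> (completion_embedding V (d k)) (seq_class d)) \<longlonglongrightarrow> 0 + 0"
    by (intro tendsto_add dS embedding_tendsto[OF dC])
  then have "(\<lambda>k. vdist \<C> (completion_embedding V (d k)) (S k)
      + vdist \<C> (completion_embedding V (d k)) (seq_class d)) \<longlonglongrightarrow> 0"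
    by simp
  then have "(\<lambda>k. vdist \<C> (S k) (seq_class d)) \<longlonglongrightarrow> 0"
  proof (rule tendsto_zero_le)
    show "0 \<le> vdist \<C> (S n) (seq_class d)" for n
      using Sc cd by simp
    show "vdist \<C> (S n) (seq_class d) \<le> vdist \<C> (completion_embedding V (d n)) (S n)
        + vdist \<C> (completion_embedding V (d n)) (seq_class d)" for n
      using H.vdist_triangle[OF Sc[of n] ec[of n] cd] H.vdist_commute[OF Sc[of n] ec[of n]] by simp
  qed
  then show "\<exists>x\<in>carrier \<C>. (\<lambda>n. vdist \<C> (S n) x) \<longlonglongrightarrow> 0"
    using cd by blast
qed

end

lemma adj_one [simp]: "(1::'a::complex_star_algebra)\<^sup>\<star> = 1"
proof -
  have "(1\<^sup>\<star> * 1)\<^sup>\<star> = (1\<^sup>\<star> * (1::'a))" by (simp only: adj_mult adj_adj)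
  then show ?thesis by (simp add: adj_adj)
qed

text \<open>The difference of the two vectors is orthogonal to vectors arbitrarily close to itself.\<close>
lemma (in inner_product_space) eq_if_ip_eq_on_dense:
  assumes x: "x \<in> carrier V" and y: "y \<in> carrier V" and D: "D \<subseteq> carrier V"
    and dense: "\<And>z \<epsilon>. z \<in> carrier V \<Longrightarrow> \<epsilon> > 0 \<Longrightarrow> \<exists>\<phi>\<in>D. vdist V \<phi> z < \<epsilon>"
    and eq: "\<And>\<phi>. \<phi> \<in> D \<Longrightarrow> ip V x \<phi> = ip V y \<phi>"
  shows "x = y"
proof (rule ccontr)
  assume "x \<noteq> y"
  define z where "z = x \<ominus> y"
  have z: "z \<in> carrier V" using x y by (simp add: z_def)
  have "vnorm V z \<noteq> 0"
    using vdist_eq_0_iff[OF x y] \<open>x \<noteq> y\<close> by (simp add: vdist_def z_def)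
  then have pos: "vnorm V z > 0" using vnorm_nonneg[OF z] by linarith
  then obtain \<phi> where \<phi>: "\<phi> \<in> D" "vdist V \<phi> z < vnorm V z" using dense[OF z] by blast
  have \<phi>V: "\<phi> \<in> carrier V" using \<phi> D by blast
  have "ip V z \<phi> = 0"
    using x y \<phi>V eq[OF \<phi>(1)] by (simp add: z_def ip_minus_left)
  then have "cmod (ip V z z) \<le> vnorm V z * vdist V z \<phi>"
    using ip_diff_le[OF z z z \<phi>V] z by simp
  also have "\<dots> < vnorm V z * vnorm V z"
    using pos \<phi>(2) vdist_commute[OF z \<phi>V] by simp
  also have "cmod (ip V z z) = vnorm V z * vnorm V z"
    using z by (simp add: ip_self norm_mult power2_eq_square)
  finally show False by simp
qed

section \<open>The closure of a representation\<close>

context star_representation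
begin

abbreviation (input) "H \<equiv> rep_space R"

lemma dom_carrier: "\<phi> \<in> rep_dom R \<Longrightarrow> \<phi> \<in> carrier H"
  using submoduleE(1)[OF dom_submodule] by blast

lemma dom_add: "\<phi> \<in> rep_dom R \<Longrightarrow> \<psi> \<in> rep_dom R \<Longrightarrow> \<phi> \<oplus>\<^bsub>H\<^esub> \<psi> \<in> rep_dom R"
  using submoduleE(5)[OF dom_submodule] by blast

lemma dom_smult: "\<phi> \<in> rep_dom R \<Longrightarrow> c \<odot>\<^bsub>H\<^esub> \<phi> \<in> rep_dom R"
  using submoduleE(4)[OF dom_submodule] by simp

lemma op_carrier: "\<phi> \<in> rep_dom R \<Longrightarrow> rep_op R a \<phi> \<in> carrier H"
  by (intro dom_carrier op_closed)

lemma eq_if_ip_eq_on_dom: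
  "x \<in> carrier H \<Longrightarrow> y \<in> carrier H \<Longrightarrow> (\<And>\<phi>. \<phi> \<in> rep_dom R \<Longrightarrow> ip H x \<phi> = ip H y \<phi>) \<Longrightarrow> x = y"
  by (rule eq_if_ip_eq_on_dense[of x y "rep_dom R"]) (auto simp: dom_carrier dom_dense)

lemma graph_limit_carrier:
  assumes "graph_limit R \<phi> \<psi>" shows "\<phi> \<in> carrier H" "\<psi> a \<in> carrier H"
  using assms by (auto simp: graph_limit_def)

text \<open>This lemma and the next express limits of graphs along filters by approximation on finitely
many operators at a time, the form in which limits of limits are handled.\<close>
lemma graph_limit_approx:
  assumes gl: "graph_limit R \<phi> \<psi>" and "finite F" "\<epsilon> > 0"
  obtains \<xi> where "\<xi> \<in> rep_dom R" "vdist H \<xi> \<phi> < \<epsilon>" "\<And>a. a \<in> F \<Longrightarrow> vdist H (rep_op R a \<xi>) (\<psi> a) < \<epsilon>"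
proof -
  obtain L where L: "L \<noteq> bot" "eventually (\<lambda>\<xi>. \<xi> \<in> rep_dom R) L"
      "((\<lambda>\<xi>. vdist H \<xi> \<phi>) \<longlongrightarrow> 0) L" "\<And>a. ((\<lambda>\<xi>. vdist H (rep_op R a \<xi>) (\<psi> a)) \<longlongrightarrow> 0) L"
    using gl unfolding graph_limit_def by blast
  have "eventually (\<lambda>\<xi>. \<forall>a\<in>F. vdist H (rep_op R a \<xi>) (\<psi> a) < \<epsilon>) L"
    using \<open>finite F\<close> order_tendstoD(2)[OF L(4) \<open>\<epsilon> > 0\<close>] by (intro eventually_ball_finite) auto
  with L(2) order_tendstoD(2)[OF L(3) \<open>\<epsilon> > 0\<close>]
  have "eventually (\<lambda>\<xi>. \<xi> \<in> rep_dom R \<and> vdist H \<xi> \<phi> < \<epsilon> \<and>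
      (\<forall>a\<in>F. vdist H (rep_op R a \<xi>) (\<psi> a) < \<epsilon>)) L"
    by eventually_elim blast
  then show ?thesis
    using eventually_happens'[OF L(1)] that by blast
qed

lemma graph_limitI:
  assumes \<phi>: "\<phi> \<in> carrier H" and \<psi>: "\<And>a. \<psi> a \<in> carrier H"
    and approx: "\<And>F \<epsilon>. finite F \<Longrightarrow> \<epsilon> > 0 \<Longrightarrow>
      \<exists>\<xi>\<in>rep_dom R. vdist H \<xi> \<phi> < \<epsilon> \<and> (\<forall>a\<in>F. vdist H (rep_op R a \<xi>) (\<psi> a) < \<epsilon>)"
  shows "graph_limit R \<phi> \<psi>"
proof -
  have "\<exists>\<xi>. finite F \<longrightarrow> \<xi> \<in> rep_dom R \<and> vdist H \<xi> \<phi> < 1 / real (Suc n) \<and>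
      (\<forall>a\<in>F. vdist H (rep_op R a \<xi>) (\<psi> a) < 1 / real (Suc n))" for F n
    using approx[of F "1 / real (Suc n)"] by (cases "finite F") auto
  then obtain \<xi> where \<xi>: "\<And>F n. finite F \<Longrightarrow> \<xi> F n \<in> rep_dom R"
      "\<And>F n. finite F \<Longrightarrow> vdist H (\<xi> F n) \<phi> < 1 / real (Suc n)"
      "\<And>F n a. finite F \<Longrightarrow> a \<in> F \<Longrightarrow> vdist H (rep_op R a (\<xi> F n)) (\<psi> a) < 1 / real (Suc n)"
    by metis
  \<comment> \<open>the chosen approximations form a net indexed by finite sets of operators and tolerances\<close>
  define L where "L = finite_subsets_at_top (UNIV :: 'a set) \<times>\<^sub>F sequentially"
  have ev: "eventually (\<lambda>p. finite (fst p) \<and> a \<in> fst p \<and> 1 / real (Suc (snd p)) < \<epsilon>) L"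
    if "\<epsilon> > 0" for a \<epsilon>
  proof -
    have 1: "eventually (\<lambda>F. finite F \<and> a \<in> F) (finite_subsets_at_top (UNIV :: 'a set))"
      by (auto simp: eventually_finite_subsets_at_top intro!: exI[of _ "{a}"])
    have 2: "eventually (\<lambda>n. 1 / real (Suc n) < \<epsilon>) sequentially"
      using order_tendstoD(2)[OF LIMSEQ_inverse_real_of_nat \<open>\<epsilon> > 0\<close>]
      by (simp add: inverse_eq_divide)
    show ?thesis
      unfolding L_def using eventually_prodI[OF 1 2] by (simp add: conj_assoc)
  qed
  have lim: "((\<lambda>p. f (\<xi> (fst p) (snd p))) \<longlongrightarrow> 0) L"
    if f: "\<And>F n. finite F \<Longrightarrow> a \<in> F \<Longrightarrow> f (\<xi> F n) < 1 / real (Suc n)"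
      and f0: "\<And>F n. finite F \<Longrightarrow> f (\<xi> F n) \<ge> 0" for f :: "'v \<Rightarrow> real" and a
  proof (rule tendstoI)
    fix e :: real assume "e > 0"
    from ev[OF this, of a] show "eventually (\<lambda>p. dist (f (\<xi> (fst p) (snd p))) 0 < e) L"
    proof eventually_elim
      case (elim p)
      then show ?case
        using f[of "fst p" "snd p"] f0[of "fst p" "snd p"] by simp
    qed
  qed
  show ?thesis
    unfolding graph_limit_def
  proof (intro conjI exI[of _ "filtermap (\<lambda>p. \<xi> (fst p) (snd p)) L"] allI)
    show "filtermap (\<lambda>p. \<xi> (fst p) (snd p)) L \<noteq> bot"
      by (simp add: L_def filtermap_bot_iff prod_filter_eq_bot)
    show "eventually (\<lambda>\<xi>. \<xi> \<in> rep_dom R) (filtermap (\<lambda>p. \<xi> (fst p) (snd p)) L)"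
      unfolding eventually_filtermap
      using ev[of 1 undefined] \<xi>(1) by (auto elim!: eventually_mono)
    show "((\<lambda>\<xi>. vdist H \<xi> \<phi>) \<longlongrightarrow> 0) (filtermap (\<lambda>p. \<xi> (fst p) (snd p)) L)"
      unfolding filterlim_filtermap
      by (rule lim) (use \<xi>(1,2) \<phi> in \<open>auto simp: dom_carrier\<close>)
    show "((\<lambda>\<xi>. vdist H (rep_op R a \<xi>) (\<psi> a)) \<longlongrightarrow> 0) (filtermap (\<lambda>p. \<xi> (fst p) (snd p)) L)" for a
      unfolding filterlim_filtermap
      by (rule lim[of a "\<lambda>\<xi>. vdist H (rep_op R a \<xi>) (\<psi> a)"]) (use \<xi>(1,3) \<psi> in \<open>auto simp: op_carrier\<close>)
  qed (use \<phi> \<psi> in auto)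
qed

lemma graph_limit_of_dom:
  assumes "\<xi> \<in> rep_dom R" shows "graph_limit R \<xi> (\<lambda>a. rep_op R a \<xi>)"
  using assms by (intro graph_limitI bexI[of _ \<xi>]) (auto simp: dom_carrier op_carrier)

text \<open>Continuity of the form transports the adjoint relation to limits of graphs.  Together with density
of the domain it shows that the limit is determined by its first component.\<close>
lemma graph_limit_adj_dom:
  assumes gl: "graph_limit R \<phi> \<psi>" and \<eta>: "\<eta> \<in> rep_dom R"
  shows "ip H (\<psi> a) \<eta> = ip H \<phi> (rep_op R (a\<^sup>\<star>) \<eta>)"
proof -
  note c = graph_limit_carrier[OF gl] dom_carrier[OF \<eta>] op_carrier[OF \<eta>]
  obtain L where L: "L \<noteq> bot" "eventually (\<lambda>\<xi>. \<xi> \<in> rep_dom R) L"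
      "((\<lambda>\<xi>. vdist H \<xi> \<phi>) \<longlongrightarrow> 0) L" "\<And>a. ((\<lambda>\<xi>. vdist H (rep_op R a \<xi>) (\<psi> a)) \<longlongrightarrow> 0) L"
    using gl unfolding graph_limit_def by blast
  have "((\<lambda>\<xi>. ip H (rep_op R a \<xi>) \<eta>) \<longlongrightarrow> ip H (\<psi> a) \<eta>) L"
    using L c by (intro ip_tendsto) (auto elim!: eventually_mono simp: op_carrier)
  moreover have "((\<lambda>\<xi>. ip H \<xi> (rep_op R (a\<^sup>\<star>) \<eta>)) \<longlongrightarrow> ip H \<phi> (rep_op R (a\<^sup>\<star>) \<eta>)) L"
    using L c by (intro ip_tendsto) (auto elim!: eventually_mono simp: dom_carrier)
  moreover have "eventually (\<lambda>\<xi>. ip H \<xi> (rep_op R (a\<^sup>\<star>) \<eta>) = ip H (rep_op R a \<xi>) \<eta>) L"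
    using L(2) by eventually_elim (simp add: op_adj \<eta>)
  ultimately show ?thesis
    by (rule tendsto_unique[OF L(1) _ Lim_transform_eventually])
qed

lemma graph_limit_unique:
  assumes "graph_limit R \<phi> \<psi>" "graph_limit R \<phi> \<psi>'"
  shows "\<psi> = \<psi>'"
proof
  show "\<psi> a = \<psi>' a" for a
    by (rule eq_if_ip_eq_on_dom) (use assms in \<open>auto simp: graph_limit_carrier graph_limit_adj_dom\<close>)
qed

lemma graph_limit_adj:
  assumes gl: "graph_limit R \<phi> \<psi>" and gl': "graph_limit R \<phi>' \<psi>'"
  shows "ip H (\<psi> a) \<phi>' = ip H \<phi> (\<psi>' (a\<^sup>\<star>))"
proof -
  note c = graph_limit_carrier[OF gl] graph_limit_carrier[OF gl']
  obtain L where L: "L \<noteq> bot" "eventually (\<lambda>\<xi>. \<xi> \<in> rep_dom R) L"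
      "((\<lambda>\<xi>. vdist H \<xi> \<phi>') \<longlongrightarrow> 0) L" "\<And>a. ((\<lambda>\<xi>. vdist H (rep_op R a \<xi>) (\<psi>' a)) \<longlongrightarrow> 0) L"
    using gl' unfolding graph_limit_def by blast
  have "((\<lambda>\<xi>. ip H (\<psi> a) \<xi>) \<longlongrightarrow> ip H (\<psi> a) \<phi>') L"
    using L c by (intro ip_tendsto) (auto elim!: eventually_mono simp: dom_carrier)
  moreover have "((\<lambda>\<xi>. ip H \<phi> (rep_op R (a\<^sup>\<star>) \<xi>)) \<longlongrightarrow> ip H \<phi> (\<psi>' (a\<^sup>\<star>))) L"
    using L c by (intro ip_tendsto) (auto elim!: eventually_mono simp: op_carrier)
  moreover have "eventually (\<lambda>\<xi>. ip H \<phi> (rep_op R (a\<^sup>\<star>) \<xi>) = ip H (\<psi> a) \<xi>) L"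
    using L(2) by eventually_elim (simp add: graph_limit_adj_dom[OF gl])
  ultimately show ?thesis
    by (rule tendsto_unique[OF L(1) _ Lim_transform_eventually])
qed

lemma graph_limit_add:
  assumes gl: "graph_limit R \<phi> \<psi>" and gl': "graph_limit R \<phi>' \<psi>'"
  shows "graph_limit R (\<phi> \<oplus>\<^bsub>H\<^esub> \<phi>') (\<lambda>a. \<psi> a \<oplus>\<^bsub>H\<^esub> \<psi>' a)"
proof (rule graph_limitI)
  note c = graph_limit_carrier[OF gl] graph_limit_carrier[OF gl']
  show "\<phi> \<oplus>\<^bsub>H\<^esub> \<phi>' \<in> carrier H" "\<psi> a \<oplus>\<^bsub>H\<^esub> \<psi>' a \<in> carrier H" for a
    using c by auto
  fix F :: "'a set" and \<epsilon> :: real assume "finite F" "\<epsilon> > 0"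
  then have e2: "\<epsilon> / 2 > 0" by simp
  obtain \<xi> where \<xi>: "\<xi> \<in> rep_dom R" "vdist H \<xi> \<phi> < \<epsilon> / 2"
      "\<And>a. a \<in> F \<Longrightarrow> vdist H (rep_op R a \<xi>) (\<psi> a) < \<epsilon> / 2"
    by (rule graph_limit_approx[OF gl \<open>finite F\<close> e2]) blast
  obtain \<xi>' where \<xi>': "\<xi>' \<in> rep_dom R" "vdist H \<xi>' \<phi>' < \<epsilon> / 2"
      "\<And>a. a \<in> F \<Longrightarrow> vdist H (rep_op R a \<xi>') (\<psi>' a) < \<epsilon> / 2"
    by (rule graph_limit_approx[OF gl' \<open>finite F\<close> e2]) blast
  show "\<exists>\<xi>\<in>rep_dom R. vdist H \<xi> (\<phi> \<oplus>\<^bsub>H\<^esub> \<phi>') < \<epsilon> \<and>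
      (\<forall>a\<in>F. vdist H (rep_op R a \<xi>) (\<psi> a \<oplus>\<^bsub>H\<^esub> \<psi>' a) < \<epsilon>)"
  proof (intro bexI[of _ "\<xi> \<oplus>\<^bsub>H\<^esub> \<xi>'"] conjI ballI)
    show "vdist H (\<xi> \<oplus>\<^bsub>H\<^esub> \<xi>') (\<phi> \<oplus>\<^bsub>H\<^esub> \<phi>') < \<epsilon>"
      using vdist_add_le[of \<xi> \<xi>' \<phi> \<phi>'] \<xi>(1,2) \<xi>'(1,2) c by (simp add: dom_carrier)
    show "vdist H (rep_op R a (\<xi> \<oplus>\<^bsub>H\<^esub> \<xi>')) (\<psi> a \<oplus>\<^bsub>H\<^esub> \<psi>' a) < \<epsilon>" if "a \<in> F" for a
      using vdist_add_le[of "rep_op R a \<xi>" "rep_op R a \<xi>'" "\<psi> a" "\<psi>' a"] \<xi>(1) \<xi>'(1)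
        \<xi>(3)[OF that] \<xi>'(3)[OF that] c by (simp add: op_carrier op_linear)
  qed (use \<xi> \<xi>' dom_add in auto)
qed

lemma graph_limit_smult:
  assumes gl: "graph_limit R \<phi> \<psi>"
  shows "graph_limit R (c \<odot>\<^bsub>H\<^esub> \<phi>) (\<lambda>a. c \<odot>\<^bsub>H\<^esub> \<psi> a)"
proof (rule graph_limitI)
  note c = graph_limit_carrier[OF gl]
  show "c \<odot>\<^bsub>H\<^esub> \<phi> \<in> carrier H" "c \<odot>\<^bsub>H\<^esub> \<psi> a \<in> carrier H" for a
    using c by auto
  fix F :: "'a set" and \<epsilon> :: real assume "finite F" and e: "\<epsilon> > 0"
  have c1: "cmod c + 1 > 0" by (simp add: add_nonneg_pos)
  obtain \<xi> where \<xi>: "\<xi> \<in> rep_dom R" "vdist H \<xi> \<phi> < \<epsilon> / (cmod c + 1)"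
      "\<And>a. a \<in> F \<Longrightarrow> vdist H (rep_op R a \<xi>) (\<psi> a) < \<epsilon> / (cmod c + 1)"
    by (rule graph_limit_approx[OF gl \<open>finite F\<close> divide_pos_pos[OF e c1]]) blast
  have small: "cmod c * d < \<epsilon>" if "d < \<epsilon> / (cmod c + 1)" "d \<ge> 0" for d
  proof -
    have "cmod c * d + d < \<epsilon>"
      using that(1) c1 by (simp add: pos_less_divide_eq algebra_simps)
    then show ?thesis using that(2) by simp
  qed
  show "\<exists>\<xi>\<in>rep_dom R. vdist H \<xi> (c \<odot>\<^bsub>H\<^esub> \<phi>) < \<epsilon> \<and>
      (\<forall>a\<in>F. vdist H (rep_op R a \<xi>) (c \<odot>\<^bsub>H\<^esub> \<psi> a) < \<epsilon>)"
  proof (intro bexI[of _ "c \<odot>\<^bsub>H\<^esub> \<xi>"] conjI ballI)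
    show "vdist H (c \<odot>\<^bsub>H\<^esub> \<xi>) (c \<odot>\<^bsub>H\<^esub> \<phi>) < \<epsilon>"
      using small[OF \<xi>(2)] \<xi>(1) c by (simp add: dom_carrier vdist_smult)
    show "vdist H (rep_op R a (c \<odot>\<^bsub>H\<^esub> \<xi>)) (c \<odot>\<^bsub>H\<^esub> \<psi> a) < \<epsilon>" if "a \<in> F" for a
      using small[OF \<xi>(3)[OF that]] \<xi>(1) c by (simp add: op_carrier op_linear vdist_smult)
  qed (use \<xi> dom_smult in auto)
qed

lemma graph_limit_op:
  assumes gl: "graph_limit R \<phi> \<psi>"
  shows "graph_limit R (\<psi> a) (\<lambda>b. \<psi> (b * a))"
proof (rule graph_limitI)
  fix F :: "'a set" and \<epsilon> :: real assume "finite F" and e: "\<epsilon> > 0"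
  then have fin: "finite (insert a ((\<lambda>b. b * a) ` F))" by simp
  obtain \<xi> where \<xi>: "\<xi> \<in> rep_dom R" "vdist H \<xi> \<phi> < \<epsilon>"
      "\<And>b. b \<in> insert a ((\<lambda>b. b * a) ` F) \<Longrightarrow> vdist H (rep_op R b \<xi>) (\<psi> b) < \<epsilon>"
    by (rule graph_limit_approx[OF gl fin e]) blast
  show "\<exists>\<xi>\<in>rep_dom R. vdist H \<xi> (\<psi> a) < \<epsilon> \<and> (\<forall>b\<in>F. vdist H (rep_op R b \<xi>) (\<psi> (b * a)) < \<epsilon>)"
  proof (intro bexI[of _ "rep_op R a \<xi>"] conjI ballI)
    show "vdist H (rep_op R b (rep_op R a \<xi>)) (\<psi> (b * a)) < \<epsilon>" if "b \<in> F" for b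
      using \<xi>(3)[of "b * a"] that \<xi>(1) by (simp add: op_mult)
  qed (use \<xi> op_closed in auto)
qed (use graph_limit_carrier[OF gl] in auto)

lemma rep_closure_space [simp]: "rep_space (rep_closure R) = H"
  by (simp add: rep_closure_def)

lemma rep_closure_dom: "\<phi> \<in> rep_dom (rep_closure R) \<longleftrightarrow> (\<exists>\<psi>. graph_limit R \<phi> \<psi>)"
  by (simp add: rep_closure_def)

lemma rep_closure_op: "graph_limit R \<phi> \<psi> \<Longrightarrow> rep_op (rep_closure R) a \<phi> = \<psi> a"
  unfolding rep_closure_def by (auto intro!: the_equality dest: graph_limit_unique)

lemma rep_closure_extends:
  "\<phi> \<in> rep_dom R \<Longrightarrow> \<phi> \<in> rep_dom (rep_closure R)"
  "\<phi> \<in> rep_dom R \<Longrightarrow> rep_op (rep_closure R) a \<phi> = rep_op R a \<phi>"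
  using graph_limit_of_dom rep_closure_op by (auto simp: rep_closure_dom)

text \<open>Sums, multiples and images of limits of graphs are limits of graphs.  Compatibility with the
operations of the algebra is tested against the dense original domain, where the adjoint relation
reduces it to the given representation.\<close>
theorem star_representation_closure: "star_representation (rep_closure R)"
proof -
  note [simp] = graph_limit_carrier graph_limit_adj_dom
  show ?thesis
  proof (rule star_representation.intro)
    show "hilbert_space (rep_space (rep_closure R))"
      by (simp add: hilbert_space_axioms)
    show "star_representation_axioms (rep_closure R)"
    proof (unfold star_representation_axioms_def rep_closure_space, intro conjI allI impI)
      have zero: "graph_limit R \<zero>\<^bsub>H\<^esub> (\<lambda>a. \<zero>\<^bsub>H\<^esub>)"
      proof -
        have "\<zero>\<^bsub>H\<^esub> \<in> rep_dom R"
          using subgroup.one_closed[OF submodule.axioms(1)[OF dom_submodule]] by simp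
        then have gl: "graph_limit R \<zero>\<^bsub>H\<^esub> (\<lambda>a. rep_op R a \<zero>\<^bsub>H\<^esub>)"
          by (rule graph_limit_of_dom)
        from graph_limit_smult[OF this, of 0] show ?thesis
          by (simp add: graph_limit_carrier[OF gl] del: graph_limit_carrier)
      qed
      show "submodule (rep_dom (rep_closure R)) complex_field H"
      proof (rule submoduleI)
        show "\<ominus>\<^bsub>H\<^esub> \<phi> \<in> rep_dom (rep_closure R)" if "\<phi> \<in> rep_dom (rep_closure R)" for \<phi>
        proof -
          obtain \<psi> where \<psi>: "graph_limit R \<phi> \<psi>"
            using \<open>\<phi> \<in> rep_dom (rep_closure R)\<close> by (auto simp: rep_closure_dom)
          from graph_limit_smult[OF this, of "- 1"] show ?thesis
            using \<psi> unfolding rep_closure_dom by (auto simp: a_inv_eq_smult)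
        qed
        show "\<phi> \<oplus>\<^bsub>H\<^esub> \<phi>' \<in> rep_dom (rep_closure R)"
          if "\<phi> \<in> rep_dom (rep_closure R)" "\<phi>' \<in> rep_dom (rep_closure R)" for \<phi> \<phi>'
          using that graph_limit_add unfolding rep_closure_dom by blast
        show "c \<odot>\<^bsub>H\<^esub> \<phi> \<in> rep_dom (rep_closure R)" if "\<phi> \<in> rep_dom (rep_closure R)" for c \<phi>
          using that graph_limit_smult unfolding rep_closure_dom by blast
      qed (use zero in \<open>auto simp: rep_closure_dom graph_limit_carrier\<close>)
      show "\<exists>\<phi>\<in>rep_dom (rep_closure R). vdist H \<phi> x < \<epsilon>" if "x \<in> carrier H" "\<epsilon> > 0" for x \<epsilon>
        using dom_dense[OF that] rep_closure_extends(1) by blast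
    next
      fix \<phi> a assume "\<phi> \<in> rep_dom (rep_closure R)"
      then obtain \<psi> where \<psi>: "graph_limit R \<phi> \<psi>" by (auto simp: rep_closure_dom)
      show "rep_op (rep_closure R) a \<phi> \<in> rep_dom (rep_closure R)"
        using graph_limit_op[OF \<psi>] \<psi> by (auto simp: rep_closure_dom rep_closure_op)
      show "rep_op (rep_closure R) a (c \<odot>\<^bsub>H\<^esub> \<phi>) = c \<odot>\<^bsub>H\<^esub> rep_op (rep_closure R) a \<phi>" for c
        using rep_closure_op[OF graph_limit_smult[OF \<psi>]] rep_closure_op[OF \<psi>] by simp
      show "rep_op (rep_closure R) (a * b) \<phi> = rep_op (rep_closure R) a (rep_op (rep_closure R) b \<phi>)" for b
        using rep_closure_op[OF graph_limit_op[OF \<psi>]] rep_closure_op[OF \<psi>] by simp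
      show "rep_op (rep_closure R) (a + b) \<phi> = rep_op (rep_closure R) a \<phi> \<oplus>\<^bsub>H\<^esub> rep_op (rep_closure R) b \<phi>" for b
        unfolding rep_closure_op[OF \<psi>]
        by (rule eq_if_ip_eq_on_dom) (use \<psi> in \<open>auto simp: ip_add_left ip_add_right adj_add op_add dom_carrier op_carrier\<close>)
      show "rep_op (rep_closure R) (c *\<^sub>C a) \<phi> = c \<odot>\<^bsub>H\<^esub> rep_op (rep_closure R) a \<phi>" for c
        unfolding rep_closure_op[OF \<psi>]
        by (rule eq_if_ip_eq_on_dom) (use \<psi> in \<open>auto simp: ip_smult_left ip_smult_right adj_scaleC op_scaleC dom_carrier op_carrier\<close>)
      show "rep_op (rep_closure R) 1 \<phi> = \<phi>"
        unfolding rep_closure_op[OF \<psi>]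
        by (rule eq_if_ip_eq_on_dom) (use \<psi> in \<open>auto simp: op_one\<close>)
      fix \<phi>' assume "\<phi>' \<in> rep_dom (rep_closure R)"
      then obtain \<psi>' where \<psi>': "graph_limit R \<phi>' \<psi>'" by (auto simp: rep_closure_dom)
      show "rep_op (rep_closure R) a (\<phi> \<oplus>\<^bsub>H\<^esub> \<phi>') = rep_op (rep_closure R) a \<phi> \<oplus>\<^bsub>H\<^esub> rep_op (rep_closure R) a \<phi>'"
        using rep_closure_op[OF graph_limit_add[OF \<psi> \<psi>']] rep_closure_op[OF \<psi>] rep_closure_op[OF \<psi>'] by simp
      show "ip H (rep_op (rep_closure R) a \<phi>) \<phi>' = ip H \<phi> (rep_op (rep_closure R) (a\<^sup>\<star>) \<phi>')"
        using graph_limit_adj[OF \<psi> \<psi>'] rep_closure_op[OF \<psi>] rep_closure_op[OF \<psi>'] by simp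
    qed
  qed
qed

end

section \<open>Reflections in the commutant\<close>

text \<open>A self-adjoint unitary in the commutant that respects the domain; its eigenspaces for the
eigenvalues \<open>1\<close> and \<open>- 1\<close> are the two summands of a decomposition.\<close>
locale commuting_reflection = star_representation R
  for R :: "('a::complex_star_algebra, 'v) representation" +
  fixes S :: "'v \<Rightarrow> 'v"
  assumes S_carrier: "x \<in> carrier (rep_space R) \<Longrightarrow> S x \<in> carrier (rep_space R)"
    and S_add: "x \<in> carrier (rep_space R) \<Longrightarrow> y \<in> carrier (rep_space R) \<Longrightarrow>
      S (x \<oplus>\<^bsub>rep_space R\<^esub> y) = S x \<oplus>\<^bsub>rep_space R\<^esub> S y"
    and S_smult: "x \<in> carrier (rep_space R) \<Longrightarrow> S (c \<odot>\<^bsub>rep_space R\<^esub> x) = c \<odot>\<^bsub>rep_space R\<^esub> S x"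
    and S_involution: "x \<in> carrier (rep_space R) \<Longrightarrow> S (S x) = x"
    and S_isometry: "x \<in> carrier (rep_space R) \<Longrightarrow> y \<in> carrier (rep_space R) \<Longrightarrow>
      ip (rep_space R) (S x) (S y) = ip (rep_space R) x y"
    and S_dom: "\<phi> \<in> rep_dom R \<Longrightarrow> S \<phi> \<in> rep_dom R"
    and S_commute: "\<phi> \<in> rep_dom R \<Longrightarrow> rep_op R a (S \<phi>) = S (rep_op R a \<phi>)"
begin

definition eigenspace :: "complex \<Rightarrow> 'v set"
  where "eigenspace s = {x \<in> carrier H. S x = s \<odot>\<^bsub>H\<^esub> x}"

definition eigen_part :: "complex \<Rightarrow> ('a, 'v) representation"
  where "eigen_part s = \<lparr>rep_space = H\<lparr>carrier := eigenspace s\<rparr>,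
    rep_dom = rep_dom R \<inter> eigenspace s, rep_op = rep_op R\<rparr>"

text \<open>For \<open>s = 1\<close> and \<open>s = - 1\<close> this is the orthogonal projection onto the eigenspace of \<open>s\<close>.  It maps the domain to
itself, so the domain splits together with the space.\<close>
definition eigen_projection :: "complex \<Rightarrow> 'v \<Rightarrow> 'v"
  where "eigen_projection s x = (1 / 2) \<odot>\<^bsub>H\<^esub> (x \<oplus>\<^bsub>H\<^esub> s \<odot>\<^bsub>H\<^esub> S x)"

lemma S_vdist:
  assumes "x \<in> carrier H" "y \<in> carrier H"
  shows "vdist H (S x) (S y) = vdist H x y"
proof -
  have "(vdist H (S x) (S y))\<^sup>2 = (vdist H x y)\<^sup>2"
    using assms by (simp add: vdist_sq S_carrier S_isometry)
  then show ?thesis using assms by (simp add: S_carrier)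
qed

lemma eigen_projection_carrier: "x \<in> carrier H \<Longrightarrow> eigen_projection s x \<in> carrier H"
  by (simp add: eigen_projection_def S_carrier)

lemma eigen_projection_eigenspace:
  assumes "x \<in> carrier H" "s * s = 1"
  shows "eigen_projection s x \<in> eigenspace s"
proof -
  have "S (eigen_projection s x) = (1 / 2) \<odot>\<^bsub>H\<^esub> S x \<oplus>\<^bsub>H\<^esub> (1 / 2 * s) \<odot>\<^bsub>H\<^esub> x"
    using assms(1) unfolding eigen_projection_def
    by (simp add: S_carrier S_add S_smult S_involution smult_add_right smult_smult)
  also have "\<dots> = (1 / 2 * s) \<odot>\<^bsub>H\<^esub> x \<oplus>\<^bsub>H\<^esub> (1 / 2 * (s * s)) \<odot>\<^bsub>H\<^esub> S x"
    using assms by (simp add: S_carrier M.a_comm)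
  also have "\<dots> = s \<odot>\<^bsub>H\<^esub> eigen_projection s x"
    using assms(1) unfolding eigen_projection_def
    by (simp add: S_carrier smult_add_right smult_smult)
  finally show ?thesis
    using assms(1) by (simp add: eigenspace_def eigen_projection_carrier)
qed

lemma eigen_projection_dom: "\<phi> \<in> rep_dom R \<Longrightarrow> eigen_projection s \<phi> \<in> rep_dom R"
  unfolding eigen_projection_def by (intro dom_smult dom_add S_dom)

lemma eigen_projection_fix:
  assumes "x \<in> eigenspace s" "s * s = 1"
  shows "eigen_projection s x = x"
proof -
  have "eigen_projection s x = (1 / 2) \<odot>\<^bsub>H\<^esub> x \<oplus>\<^bsub>H\<^esub> (1 / 2) \<odot>\<^bsub>H\<^esub> x"
    using assms by (simp add: eigenspace_def eigen_projection_def smult_smult smult_add_right)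
  also have "\<dots> = (1 / 2 + 1 / 2) \<odot>\<^bsub>H\<^esub> x"
    using assms by (simp only: smult_add_left eigenspace_def mem_Collect_eq)
  finally show ?thesis using assms by (simp add: eigenspace_def)
qed

lemma eigen_projection_vdist:
  assumes x: "x \<in> carrier H" and y: "y \<in> carrier H" and s: "cmod s = 1"
  shows "vdist H (eigen_projection s x) (eigen_projection s y) \<le> vdist H x y"
proof -
  have "vdist H (eigen_projection s x) (eigen_projection s y)
      = 1 / 2 * vdist H (x \<oplus>\<^bsub>H\<^esub> s \<odot>\<^bsub>H\<^esub> S x) (y \<oplus>\<^bsub>H\<^esub> s \<odot>\<^bsub>H\<^esub> S y)"
    unfolding eigen_projection_def using x y by (subst vdist_smult) (auto simp: S_carrier)
  also have "\<dots> \<le> 1 / 2 * (vdist H x y + vdist H (s \<odot>\<^bsub>H\<^esub> S x) (s \<odot>\<^bsub>H\<^esub> S y))"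
    using x y by (intro mult_left_mono vdist_add_le) (auto simp: S_carrier)
  also have "vdist H (s \<odot>\<^bsub>H\<^esub> S x) (s \<odot>\<^bsub>H\<^esub> S y) = vdist H x y"
    using x y s by (simp add: vdist_smult S_carrier S_vdist)
  finally show ?thesis by simp
qed

lemma eigen_projection_sum:
  assumes "x \<in> carrier H"
  shows "eigen_projection 1 x \<oplus>\<^bsub>H\<^esub> eigen_projection (- 1) x = x"
proof -
  define h where "h = (1 / 2 :: complex)"
  have "eigen_projection 1 x \<oplus>\<^bsub>H\<^esub> eigen_projection (- 1) x
      = (h \<odot>\<^bsub>H\<^esub> x \<oplus>\<^bsub>H\<^esub> h \<odot>\<^bsub>H\<^esub> S x) \<oplus>\<^bsub>H\<^esub> (h \<odot>\<^bsub>H\<^esub> x \<oplus>\<^bsub>H\<^esub> (- h) \<odot>\<^bsub>H\<^esub> S x)"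
    using assms unfolding eigen_projection_def h_def[symmetric]
    by (simp add: S_carrier smult_add_right smult_smult)
  also have "\<dots> = (h \<odot>\<^bsub>H\<^esub> x \<oplus>\<^bsub>H\<^esub> h \<odot>\<^bsub>H\<^esub> x) \<oplus>\<^bsub>H\<^esub> (h \<odot>\<^bsub>H\<^esub> S x \<oplus>\<^bsub>H\<^esub> (- h) \<odot>\<^bsub>H\<^esub> S x)"
    using assms by (simp add: S_carrier M.a_ac)
  also have "\<dots> = (h + h) \<odot>\<^bsub>H\<^esub> x \<oplus>\<^bsub>H\<^esub> (h + - h) \<odot>\<^bsub>H\<^esub> S x"
    using assms by (simp only: smult_add_left S_carrier)
  also have "\<dots> = x"
    using assms by (simp add: h_def S_carrier)
  finally show ?thesis .
qed

lemma eigenspace_submodule: "submodule (eigenspace s) complex_field H"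
proof (rule submoduleI)
  have *: "c \<odot>\<^bsub>H\<^esub> x \<in> eigenspace s" if "x \<in> eigenspace s" for c x
    using that by (simp add: eigenspace_def S_smult smult_smult mult.commute)
  show "c \<odot>\<^bsub>H\<^esub> x \<in> eigenspace s" if "x \<in> eigenspace s" for c x
    using that by (rule *)
  show "\<ominus>\<^bsub>H\<^esub> x \<in> eigenspace s" if "x \<in> eigenspace s" for x
    using *[OF that, of "- 1"] that by (simp add: a_inv_eq_smult eigenspace_def)
  have "S \<zero>\<^bsub>H\<^esub> = \<zero>\<^bsub>H\<^esub>"
    using S_smult[of "\<zero>\<^bsub>H\<^esub>" 0] by (simp add: S_carrier)
  then show "\<zero>\<^bsub>H\<^esub> \<in> eigenspace s" by (simp add: eigenspace_def)
  show "x \<oplus>\<^bsub>H\<^esub> y \<in> eigenspace s" if "x \<in> eigenspace s" "y \<in> eigenspace s" for x y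
    using that by (simp add: eigenspace_def S_add smult_add_right)
qed (auto simp: eigenspace_def)

text \<open>The eigenspace is closed since \<open>S\<close> is isometric.\<close>
lemma eigen_part_hilbert_space: "hilbert_space (H\<lparr>carrier := eigenspace s\<rparr>)" (is "hilbert_space ?V")
proof -
  have sub: "x \<in> carrier H" if "x \<in> eigenspace s" for x
    using that by (simp add: eigenspace_def)
  interpret V: Module.module complex_field ?V
    by (rule submodule.submodule_is_module[OF eigenspace_submodule]) (rule module_axioms)
  interpret V: inner_product_space ?V
    by unfold_locales (auto simp: sub ip_add_left ip_smult_left ip_nonneg intro: ip_cnj ip_definite)
  have vdist: "vdist ?V x y = vdist H x y" if "x \<in> eigenspace s" "y \<in> eigenspace s" for x y
    by (rule vdist_cong[OF V.semi_inner_product_space_axioms semi_inner_product_space_axioms])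
      (use that in \<open>simp_all add: sub\<close>)
  show ?thesis
  proof unfold_locales
    fix t assume t: "t \<in> cauchy_sequences ?V"
    have te: "t n \<in> eigenspace s" for n using V.cauchy_carrier[OF t] by simp
    have "t \<in> cauchy_sequences H"
      using V.cauchy_sequencesD[OF t] by (intro cauchy_sequencesI) (auto simp: te sub vdist)
    then obtain x where x: "x \<in> carrier H" "(\<lambda>n. vdist H (t n) x) \<longlonglongrightarrow> 0"
      using complete by blast
    have "vdist H (S x) (s \<odot>\<^bsub>H\<^esub> x) \<le> vdist H (t n) x + cmod s * vdist H (t n) x" for n
    proof -
      have "vdist H (S x) (s \<odot>\<^bsub>H\<^esub> x) \<le> vdist H (S x) (S (t n)) + vdist H (S (t n)) (s \<odot>\<^bsub>H\<^esub> x)"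
        using x te by (intro vdist_triangle) (auto simp: S_carrier sub)
      also have "vdist H (S x) (S (t n)) = vdist H (t n) x"
        using x te by (simp add: S_vdist sub vdist_commute)
      also have "S (t n) = s \<odot>\<^bsub>H\<^esub> t n"
        using te by (simp add: eigenspace_def)
      finally show ?thesis
        using x te by (simp add: vdist_smult sub)
    qed
    moreover have "(\<lambda>n. vdist H (t n) x + cmod s * vdist H (t n) x) \<longlonglongrightarrow> 0 + cmod s * 0"
      by (intro tendsto_intros x)
    ultimately have "vdist H (S x) (s \<odot>\<^bsub>H\<^esub> x) \<le> 0 + cmod s * 0"
      by (intro tendsto_lowerbound[where F=sequentially]) auto
    then have "vdist H (S x) (s \<odot>\<^bsub>H\<^esub> x) = 0"
      using vdist_nonneg[OF S_carrier[OF x(1)] smult_carrier[OF x(1), of s]] by simp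
    then have "x \<in> eigenspace s"
      using x by (simp add: eigenspace_def vdist_eq_0_iff S_carrier)
    then show "\<exists>x\<in>carrier ?V. (\<lambda>n. vdist ?V (t n) x) \<longlonglongrightarrow> 0"
      using x(2) by (intro bexI[of _ x]) (auto simp: vdist te)
  qed
qed

lemma star_representation_eigen_part:
  assumes s: "s * s = 1"
  shows "star_representation (eigen_part s)"
proof -
  have sub: "x \<in> carrier H" if "x \<in> eigenspace s" for x
    using that by (simp add: eigenspace_def)
  have "(cmod s)\<^sup>2 = 1" using arg_cong[OF s, of cmod] by (simp add: norm_mult power2_eq_square)
  then have norm_s: "cmod s = 1" by (simp add: power2_eq_1_iff) (smt (verit) norm_ge_zero)
  let ?V = "H\<lparr>carrier := eigenspace s\<rparr>"
  interpret V: hilbert_space ?V by (rule eigen_part_hilbert_space)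
  have vdist: "vdist ?V x y = vdist H x y" if "x \<in> eigenspace s" "y \<in> eigenspace s" for x y
    by (rule vdist_cong[OF V.semi_inner_product_space_axioms semi_inner_product_space_axioms])
      (use that in \<open>simp_all add: sub\<close>)
  have op_eigen: "rep_op R a \<phi> \<in> eigenspace s" if "\<phi> \<in> rep_dom R" "\<phi> \<in> eigenspace s" for a \<phi>
    using that S_commute[of \<phi> a] by (simp add: eigenspace_def op_carrier op_linear(2))
  have sm: "submodule (rep_dom R \<inter> eigenspace s) complex_field ?V"
  proof (rule V.submoduleI)
    show "\<ominus>\<^bsub>?V\<^esub> x \<in> rep_dom R \<inter> eigenspace s" if "x \<in> rep_dom R \<inter> eigenspace s" for x
      using that V.smult_carrier[of x "- 1"] V.a_inv_eq_smult[of x] dom_smult[of x "- 1"] by simp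
    show "\<zero>\<^bsub>?V\<^esub> \<in> rep_dom R \<inter> eigenspace s"
      using V.zero_closed subgroup.one_closed[OF submodule.axioms(1)[OF dom_submodule]] by simp
    show "x \<oplus>\<^bsub>?V\<^esub> y \<in> rep_dom R \<inter> eigenspace s"
      if "x \<in> rep_dom R \<inter> eigenspace s" "y \<in> rep_dom R \<inter> eigenspace s" for x y
      using that V.add.m_closed[of x y] by (simp add: dom_add)
    show "c \<odot>\<^bsub>?V\<^esub> x \<in> rep_dom R \<inter> eigenspace s" if "x \<in> rep_dom R \<inter> eigenspace s" for c x
      using that V.smult_carrier[of x c] by (simp add: dom_smult)
  qed auto
  show ?thesis
  proof (rule star_representation.intro)
    show "hilbert_space (rep_space (eigen_part s))"
      by (simp add: eigen_part_def V.hilbert_space_axioms)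
    show "star_representation_axioms (eigen_part s)"
    proof (rule star_representation_axioms.intro)
      show "submodule (rep_dom (eigen_part s)) complex_field (rep_space (eigen_part s))"
        using sm by (simp add: eigen_part_def)
      fix x and \<epsilon> :: real assume "x \<in> carrier (rep_space (eigen_part s))" and e: "\<epsilon> > 0"
      then have x: "x \<in> eigenspace s" by (simp add: eigen_part_def)
      obtain \<phi> where \<phi>: "\<phi> \<in> rep_dom R" "vdist H \<phi> x < \<epsilon>"
        using dom_dense[OF sub[OF x] e] by blast
      \<comment> \<open>projecting an approximating vector of the domain keeps it in the domain and does not increase the distance\<close>
      have "vdist H (eigen_projection s \<phi>) x \<le> vdist H \<phi> x"
        using eigen_projection_vdist[OF dom_carrier[OF \<phi>(1)] sub[OF x] norm_s]
          eigen_projection_fix[OF x s] by simp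
      then show "\<exists>\<phi>\<in>rep_dom (eigen_part s). vdist (rep_space (eigen_part s)) \<phi> x < \<epsilon>"
        using \<phi> x s
        by (intro bexI[of _ "eigen_projection s \<phi>"])
          (auto simp: eigen_part_def vdist eigen_projection_eigenspace eigen_projection_dom dom_carrier)
    qed (auto simp: eigen_part_def op_eigen op_closed op_linear op_add op_scaleC op_mult op_one op_adj)
  qed
qed

text \<open>A summand is zero only if \<open>S\<close> acts on the whole domain as the opposite sign.\<close>
theorem not_irreducible:
  assumes "\<exists>\<phi>\<in>rep_dom R. S \<phi> \<noteq> \<phi>" "\<exists>\<phi>\<in>rep_dom R. S \<phi> \<noteq> (- 1) \<odot>\<^bsub>H\<^esub> \<phi>"
  shows "\<not> irreducible_rep R"
proof
  assume irr: "irreducible_rep R"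
  have orth: "ip H x y = 0" if "x \<in> eigenspace 1" "y \<in> eigenspace (- 1)" for x y
  proof -
    have "ip H x y = ip H (S x) (S y)"
      by (rule S_isometry[symmetric]) (use that in \<open>auto simp: eigenspace_def\<close>)
    also have "\<dots> = - ip H x y"
      using that by (simp add: eigenspace_def ip_smult_right)
    finally show ?thesis by simp
  qed
  have sum: "x \<in> D \<inter> eigenspace 1 <+>\<^bsub>H\<^esub> D \<inter> eigenspace (- 1)"
    if "x \<in> D" "D \<subseteq> carrier H" and D: "\<And>x s. x \<in> D \<Longrightarrow> eigen_projection s x \<in> D" for D x
  proof -
    have x: "x \<in> carrier H" using that by blast
    have "eigen_projection 1 x \<in> D \<inter> eigenspace 1" "eigen_projection (- 1) x \<in> D \<inter> eigenspace (- 1)"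
      using D[OF \<open>x \<in> D\<close>] x by (auto simp: eigen_projection_eigenspace)
    then have "eigen_projection 1 x \<oplus>\<^bsub>H\<^esub> eigen_projection (- 1) x
        \<in> D \<inter> eigenspace 1 <+>\<^bsub>H\<^esub> D \<inter> eigenspace (- 1)"
      unfolding set_add_def' by blast
    then show ?thesis by (simp add: eigen_projection_sum x)
  qed
  have "orthogonal_sum_of R (eigen_part 1) (eigen_part (- 1))"
    unfolding orthogonal_sum_of_def Let_def
  proof (intro conjI ballI allI)
    have c: "carrier H \<inter> eigenspace s = eigenspace s" for s
      by (auto simp: eigenspace_def)
    show "carrier H = carrier (rep_space (eigen_part 1)) <+>\<^bsub>H\<^esub> carrier (rep_space (eigen_part (- 1)))"
    proof
      show "carrier H \<subseteq> carrier (rep_space (eigen_part 1)) <+>\<^bsub>H\<^esub> carrier (rep_space (eigen_part (- 1)))"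
      proof
        fix x assume "x \<in> carrier H"
        from sum[OF this subset_refl eigen_projection_carrier]
        show "x \<in> carrier (rep_space (eigen_part 1)) <+>\<^bsub>H\<^esub> carrier (rep_space (eigen_part (- 1)))"
          by (simp add: eigen_part_def c)
      qed
    qed (auto simp: eigen_part_def eigenspace_def set_add_def')
    show "rep_dom R = rep_dom (eigen_part 1) <+>\<^bsub>H\<^esub> rep_dom (eigen_part (- 1))"
    proof
      show "rep_dom R \<subseteq> rep_dom (eigen_part 1) <+>\<^bsub>H\<^esub> rep_dom (eigen_part (- 1))"
      proof
        fix x assume "x \<in> rep_dom R"
        from sum[OF this subsetI[OF dom_carrier] eigen_projection_dom]
        show "x \<in> rep_dom (eigen_part 1) <+>\<^bsub>H\<^esub> rep_dom (eigen_part (- 1))"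
          by (simp add: eigen_part_def)
      qed
    qed (auto simp: eigen_part_def set_add_def' dom_add)
  qed (auto simp: eigen_part_def orth op_linear)
  then have "star_representation (eigen_part 1) \<and> star_representation (eigen_part (- 1)) \<and>
      orthogonal_sum_of R (eigen_part 1) (eigen_part (- 1))"
    by (simp add: star_representation_eigen_part)
  then have zero: "rep_dom (eigen_part 1) = {\<zero>\<^bsub>H\<^esub>} \<or> rep_dom (eigen_part (- 1)) = {\<zero>\<^bsub>H\<^esub>}"
    using irr unfolding irreducible_rep_def by blast
  have S: "S \<phi> = (- s) \<odot>\<^bsub>H\<^esub> \<phi>"
    if s: "rep_dom (eigen_part s) = {\<zero>\<^bsub>H\<^esub>}" "s = 1 \<or> s = - 1" and \<phi>: "\<phi> \<in> rep_dom R" for s \<phi>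
  proof -
    have ss: "s * s = 1" "(- s) * (- s) = 1" using s(2) by auto
    note \<phi>H = dom_carrier[OF \<phi>]
    have "eigen_projection s \<phi> \<in> rep_dom (eigen_part s)"
      using eigen_projection_eigenspace[OF \<phi>H ss(1)] eigen_projection_dom[OF \<phi>, of s]
      by (simp add: eigen_part_def)
    then have "eigen_projection s \<phi> = \<zero>\<^bsub>H\<^esub>"
      using s(1) by simp
    then have "eigen_projection (- s) \<phi> = \<phi>"
      using s(2) eigen_projection_sum[OF \<phi>H] eigen_projection_carrier[OF \<phi>H] by auto
    then have "\<phi> \<in> eigenspace (- s)"
      using eigen_projection_eigenspace[OF \<phi>H ss(2)] by simp
    then show ?thesis
      by (simp add: eigenspace_def)
  qed
  from zero show False
  proof
    assume "rep_dom (eigen_part 1) = {\<zero>\<^bsub>H\<^esub>}"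
    from S[OF this] show False using assms(2) by auto
  next
    assume "rep_dom (eigen_part (- 1)) = {\<zero>\<^bsub>H\<^esub>}"
    from S[OF this] show False using assms(1) dom_carrier by auto
  qed
qed

end

section \<open>Graded algebras\<close>

context complex_star_algebra
begin

lemma scaleC_zero_left [simp]: "0 *\<^sub>C a = 0"
  using scaleC_add_left[of 0 0 a] by simp

lemma scaleC_zero_right [simp]: "c *\<^sub>C 0 = 0"
  using scaleC_add_right[of c 0 0] by simp

lemma scaleC_minus_one: "(- 1) *\<^sub>C a = - a"
  using scaleC_add_left[of "- 1" 1 a] by (simp add: scaleC_one eq_neg_iff_add_eq_0)

lemma adj_zero [simp]: "0\<^sup>\<star> = 0"
  using adj_add[of 0 0] by simp

lemma adj_minus: "(- a)\<^sup>\<star> = - a\<^sup>\<star>"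
  using adj_add[of "- a" a] by (simp add: eq_neg_iff_add_eq_0)

lemma adj_diff: "(a - b)\<^sup>\<star> = a\<^sup>\<star> - b\<^sup>\<star>"
  using adj_add[of a "- b"] by (simp add: adj_minus)

lemma adj_sum: "(sum f I)\<^sup>\<star> = (\<Sum>i\<in>I. (f i)\<^sup>\<star>)"
  by (induction I rule: infinite_finite_induct) (simp_all add: adj_add)

end

context graded_star_algebra
begin

abbreviation (input) p where "p \<equiv> unit_projection G A"

lemma decomposition_sum:
  assumes "homogeneous_decomposition G A a f" "finite T" "\<And>g. f g \<noteq> 0 \<Longrightarrow> g \<in> T"
  shows "a = sum f T"
proof -
  have "sum f {g. f g \<noteq> 0} = sum f T"
    using assms(2,3) by (intro sum.mono_neutral_left) auto
  then show ?thesis using assms(1) by (simp add: homogeneous_decomposition_def)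
qed

lemma unit_projection_eqI:
  "homogeneous_decomposition G A a f \<Longrightarrow> p a = f \<one>"
  unfolding unit_projection_def using the1_equality[OF direct_sum] by fastforce

lemma decomposition_add:
  assumes a: "homogeneous_decomposition G A a f" and b: "homogeneous_decomposition G A b f'"
  shows "homogeneous_decomposition G A (a + b) (\<lambda>g. f g + f' g)"
proof -
  define T where "T = {g. f g \<noteq> 0} \<union> {g. f' g \<noteq> 0}"
  have T: "finite T" using a b by (auto simp: T_def homogeneous_decomposition_def)
  have sub: "{g. f g + f' g \<noteq> 0} \<subseteq> T" by (auto simp: T_def)
  have "a + b = sum f T + sum f' T"
    using decomposition_sum[OF a T] decomposition_sum[OF b T] by (simp add: T_def)
  also have "\<dots> = (\<Sum>g\<in>T. f g + f' g)" by (simp add: sum.distrib)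
  also have "\<dots> = (\<Sum>g | f g + f' g \<noteq> 0. f g + f' g)"
    using T sub by (intro sum.mono_neutral_right) auto
  finally have "a + b = (\<Sum>g | f g + f' g \<noteq> 0. f g + f' g)" .
  then show ?thesis
    using a b finite_subset[OF sub T] by (auto simp: homogeneous_decomposition_def add_mem)
qed

lemma decomposition_homogeneous:
  assumes "g \<in> carrier G" "a \<in> A g"
  shows "homogeneous_decomposition G A a (\<lambda>h. if h = g then a else 0)"
proof -
  have "{h. (if h = g then a else 0) \<noteq> 0} = (if a = 0 then {} else {g})" by auto
  then show ?thesis
    using assms zero_mem by (auto simp: homogeneous_decomposition_def)
qed

text \<open>Induction over sums of homogeneous elements, which reduces identities for the projection to a
comparison of degrees.\<close>
lemma homogeneous_induct [case_names homogeneous add]: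
  assumes hom: "\<And>g a. g \<in> carrier G \<Longrightarrow> a \<in> A g \<Longrightarrow> P a"
    and add: "\<And>a b. P a \<Longrightarrow> P b \<Longrightarrow> P (a + b)"
  shows "P a"
proof -
  obtain f where f: "homogeneous_decomposition G A a f" using direct_sum by blast
  have "finite T \<Longrightarrow> P (sum f T)" for T
  proof (induction T rule: finite_induct)
    case empty
    then show ?case using hom[of \<one> 0] zero_mem by simp
  next
    case (insert g T)
    have "P (f g)"
    proof (cases "g \<in> carrier G")
      case True
      then show ?thesis using f hom by (auto simp: homogeneous_decomposition_def)
    next
      case False
      then show ?thesis
        using f hom[of \<one> 0] zero_mem by (auto simp: homogeneous_decomposition_def)
    qed
    then show ?case using insert add by simp
  qed
  then show ?thesis using f by (auto simp: homogeneous_decomposition_def)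
qed

lemma projection_add: "p (a + b) = p a + p b"
proof -
  obtain f f' where "homogeneous_decomposition G A a f" "homogeneous_decomposition G A b f'"
    using direct_sum by blast
  then show ?thesis
    using unit_projection_eqI[OF decomposition_add] by (simp add: unit_projection_eqI)
qed

lemma projection_homogeneous: "g \<in> carrier G \<Longrightarrow> a \<in> A g \<Longrightarrow> p a = (if g = \<one> then a else 0)"
  using unit_projection_eqI[OF decomposition_homogeneous] by auto

lemma projection_zero [simp]: "p 0 = 0"
  using projection_homogeneous[of \<one> 0] zero_mem by simp

lemma projection_mem [simp]: "p a \<in> A \<one>"
  by (induction a rule: homogeneous_induct)
    (auto simp: projection_homogeneous projection_add zero_mem add_mem)

lemma projection_scaleC: "p (c *\<^sub>C a) = c *\<^sub>C p a"
  by (induction a rule: homogeneous_induct)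
    (simp_all add: scaleC_mem projection_homogeneous projection_add scaleC_add_right)

lemma projection_adj: "p (a\<^sup>\<star>) = (p a)\<^sup>\<star>"
proof (induction a rule: homogeneous_induct)
  case (homogeneous g a)
  then have "p (a\<^sup>\<star>) = (if inv g = \<one> then a\<^sup>\<star> else 0)"
    by (intro projection_homogeneous adj_mem) auto
  then show ?case
    using homogeneous by (simp add: projection_homogeneous inv_eq_1_iff)
qed (simp add: adj_add projection_add)

lemma projection_mult_left: "b \<in> A \<one> \<Longrightarrow> p (b * a) = b * p a"
proof (induction a rule: homogeneous_induct)
  case (homogeneous g a)
  then have "p (b * a) = (if \<one> \<otimes> g = \<one> then b * a else 0)"
    by (intro projection_homogeneous mult_mem) auto
  then show ?case
    using homogeneous by (simp add: projection_homogeneous)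
qed (simp add: distrib_left projection_add)

lemma projection_mult_right: "b \<in> A \<one> \<Longrightarrow> p (a * b) = p a * b"
proof (induction a rule: homogeneous_induct)
  case (homogeneous g a)
  then have "p (a * b) = (if g \<otimes> \<one> = \<one> then a * b else 0)"
    by (intro projection_homogeneous mult_mem) auto
  then show ?case
    using homogeneous by (simp add: projection_homogeneous)
qed (simp add: distrib_right projection_add)

lemma projection_sum: "p (sum f I) = (\<Sum>i\<in>I. p (f i))"
  by (induction I rule: infinite_finite_induct) (simp_all add: projection_add)

text \<open>Cross terms \<open>(f g)\<^sup>\<star> f h\<close> of different degrees have a nontrivial degree, so only the squares of the
homogeneous components survive; hence positive characters are nonnegative on projected squares.\<close>
lemma projection_square: "p (a\<^sup>\<star> * a) \<in> sums_of_squares"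
proof -
  obtain f where f: "homogeneous_decomposition G A a f" using direct_sum by blast
  define T where "T = {g. f g \<noteq> 0}"
  have T: "finite T" "T \<subseteq> carrier G" "\<And>g. g \<in> T \<Longrightarrow> f g \<in> A g" "a = sum f T"
    using f by (auto simp: T_def homogeneous_decomposition_def)
  have "p ((f g)\<^sup>\<star> * f h) = (if g = h then (f g)\<^sup>\<star> * f h else 0)" if "g \<in> T" "h \<in> T" for g h
  proof -
    have gh: "g \<in> carrier G" "h \<in> carrier G" using that T by auto
    then have "p ((f g)\<^sup>\<star> * f h) = (if inv g \<otimes> h = \<one> then (f g)\<^sup>\<star> * f h else 0)"
      using that T by (intro projection_homogeneous mult_mem adj_mem) auto
    moreover have "inv g \<otimes> h = \<one> \<longleftrightarrow> g = h"
    proof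
      assume "inv g \<otimes> h = \<one>"
      then have "inv h = inv g" using gh by (intro inv_equality) auto
      then show "g = h" using gh by (metis inv_inv)
    qed (use gh in simp)
    ultimately show ?thesis by simp
  qed
  then have "p (a\<^sup>\<star> * a) = (\<Sum>g\<in>T. \<Sum>h\<in>T. if g = h then (f g)\<^sup>\<star> * f h else 0)"
    unfolding T(4) adj_sum sum_product projection_sum by (intro sum.cong refl) auto
  also have "\<dots> = (\<Sum>g\<in>T. (f g)\<^sup>\<star> * f g)"
    using T(1) by (intro sum.cong refl) simp
  finally have eq: "p (a\<^sup>\<star> * a) = (\<Sum>g\<in>T. (f g)\<^sup>\<star> * f g)" .
  obtain gs where gs: "set gs = T" "distinct gs" using finite_distinct_list[OF T(1)] by blast
  have "p (a\<^sup>\<star> * a) = (\<Sum>b\<leftarrow>map f gs. b\<^sup>\<star> * b)"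
    unfolding eq gs(1)[symmetric] sum.distinct_set_conv_list[OF gs(2)] by (simp add: o_def)
  then show ?thesis unfolding sums_of_squares_def by blast
qed

end

locale positive_character = induction_setting G A
  for G :: "('g, 'm) monoid_scheme" (structure)
    and A :: "'g \<Rightarrow> 'a::complex_star_algebra set" +
  fixes \<omega> :: "'a \<Rightarrow> complex"
  assumes pos_character: "\<omega> \<in> pos_characters (A \<one>)"
begin

text \<open>Generated *-algebras are unital.\<close>
lemma one_mem [simp]: "1 \<in> A \<one>"
  using unit_component_countably_generated generated_star_algebra.intros(2)
  by (auto simp: countably_generated_def)

lemma \<omega>_add: "a \<in> A \<one> \<Longrightarrow> b \<in> A \<one> \<Longrightarrow> \<omega> (a + b) = \<omega> a + \<omega> b"
  and \<omega>_mult: "a \<in> A \<one> \<Longrightarrow> b \<in> A \<one> \<Longrightarrow> \<omega> (a * b) = \<omega> a * \<omega> b"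
  and \<omega>_scaleC: "a \<in> A \<one> \<Longrightarrow> \<omega> (c *\<^sub>C a) = c * \<omega> a"
  and \<omega>_adj: "a \<in> A \<one> \<Longrightarrow> \<omega> (a\<^sup>\<star>) = cnj (\<omega> a)"
  and \<omega>_nontrivial: "\<exists>a\<in>A \<one>. \<omega> a \<noteq> 0"
  and \<omega>_nonneg: "a \<in> A \<one> \<Longrightarrow> a \<in> sums_of_squares \<Longrightarrow> \<omega> a \<in> \<real>\<^sub>\<ge>\<^sub>0"
  and \<omega>_extensional: "\<omega> \<in> extensional (A \<one>)"
  using pos_character by (auto simp: pos_characters_def characters_def)

lemma \<omega>_one [simp]: "\<omega> 1 = 1"
  using \<omega>_nontrivial \<omega>_mult[OF one_mem] by auto

lemma \<omega>_zero [simp]: "\<omega> 0 = 0"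
  using \<omega>_scaleC[OF one_mem, of 0] by simp

definition \<Phi> :: "'a \<Rightarrow> complex" where "\<Phi> a = \<omega> (p a)"

lemma \<Phi>_add: "\<Phi> (a + b) = \<Phi> a + \<Phi> b"
  by (simp add: \<Phi>_def projection_add \<omega>_add)

lemma \<Phi>_scaleC: "\<Phi> (c *\<^sub>C a) = c * \<Phi> a"
  by (simp add: \<Phi>_def projection_scaleC \<omega>_scaleC)

lemma \<Phi>_zero [simp]: "\<Phi> 0 = 0"
  by (simp add: \<Phi>_def)

lemma \<Phi>_minus: "\<Phi> (- a) = - \<Phi> a"
  using \<Phi>_scaleC[of "- 1" a] by (simp add: scaleC_minus_one)

lemma \<Phi>_diff: "\<Phi> (a - b) = \<Phi> a - \<Phi> b"
  using \<Phi>_add[of a "- b"] by (simp add: \<Phi>_minus)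

lemma \<Phi>_sum: "\<Phi> (sum f I) = (\<Sum>i\<in>I. \<Phi> (f i))"
  by (induction I rule: infinite_finite_induct) (simp_all add: \<Phi>_add)

lemma \<Phi>_adj: "\<Phi> (a\<^sup>\<star>) = cnj (\<Phi> a)"
  by (simp add: \<Phi>_def projection_adj \<omega>_adj)

lemma \<Phi>_square_nonneg: "Re (\<Phi> (a\<^sup>\<star> * a)) \<ge> 0"
  using \<omega>_nonneg[OF projection_mem projection_square[of a]]
  by (auto simp: \<Phi>_def complex_nonneg_Reals_iff)

lemma \<Phi>_mult_unit_right: "b \<in> A \<one> \<Longrightarrow> \<Phi> (a * b) = \<Phi> a * \<omega> b"
  by (simp add: \<Phi>_def projection_mult_right \<omega>_mult)

lemma \<Phi>_homogeneous: "g \<in> carrier G \<Longrightarrow> a \<in> A g \<Longrightarrow> \<Phi> a = (if g = \<one> then \<omega> a else 0)"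
  by (simp add: \<Phi>_def projection_homogeneous)

section \<open>The tensor product\<close>

abbreviation (input) FA :: "('a \<times> complex \<Rightarrow>\<^sub>0 int) monoid" where "FA \<equiv> free_Abelian_group UNIV"
abbreviation (input) K :: "'a tensor" where "K \<equiv> tensor_kernel (A \<one>) \<omega>"
abbreviation (input) tens :: "'a \<Rightarrow> 'a tensor" where "tens a \<equiv> tensor (A \<one>) \<omega> a 1"
abbreviation (input) T :: "'a tensor inner_space" where "T \<equiv> tensor_space G A \<omega>"

lemma kernel_induct [consumes 1, case_names zero relation minus add]:
  assumes "x \<in> K" and "P 0" "\<And>x. x \<in> tensor_relations (A \<one>) \<omega> \<Longrightarrow> P x"
    "\<And>x. x \<in> tensor_relations (A \<one>) \<omega> \<Longrightarrow> P (- x)" "\<And>x y. P x \<Longrightarrow> P y \<Longrightarrow> P (x + y)"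
  shows "P x"
  using assms(1) unfolding tensor_kernel_def
  by (induction x rule: generate.induct) (simp_all add: assms(2-))

lemma kernel_subgroup: "subgroup K FA"
  unfolding tensor_kernel_def
  by (rule group.generate_is_subgroup) (auto simp: carrier_free_Abelian_group_iff)

lemma kernel_normal: "K \<lhd> FA"
  by (rule comm_group.subgroup_imp_normal[OF abelian_free_Abelian_group kernel_subgroup])

lemma relation_in_kernel: "x \<in> tensor_relations (A \<one>) \<omega> \<Longrightarrow> x \<in> K"
  unfolding tensor_kernel_def by (rule generate.incl)

lemma coset_eq_iff: "K #>\<^bsub>FA\<^esub> x = K #>\<^bsub>FA\<^esub> y \<longleftrightarrow> x - y \<in> K"
proof -
  interpret F: group FA by simp
  have sub: "K \<subseteq> carrier FA" by (rule subgroup.subset[OF kernel_subgroup])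
  have car: "z \<in> carrier FA" for z by (simp add: carrier_free_Abelian_group_iff)
  show ?thesis
  proof
    assume "K #>\<^bsub>FA\<^esub> x = K #>\<^bsub>FA\<^esub> y"
    then have "x \<in> K #>\<^bsub>FA\<^esub> y"
      using F.rcos_self[OF car kernel_subgroup] by blast
    then show "x - y \<in> K" by (auto simp: r_coset_def)
  next
    assume "x - y \<in> K"
    then have "x \<in> K #>\<^bsub>FA\<^esub> y" by (force simp: r_coset_def)
    then show "K #>\<^bsub>FA\<^esub> x = K #>\<^bsub>FA\<^esub> y"
      using F.repr_independence[OF _ car kernel_subgroup] by metis
  qed
qed

lemma coset_add: "(K #>\<^bsub>FA\<^esub> x) <#>\<^bsub>FA\<^esub> (K #>\<^bsub>FA\<^esub> y) = K #>\<^bsub>FA\<^esub> (x + y)"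
  using normal.rcos_sum[OF kernel_normal, of x y] by (simp add: carrier_free_Abelian_group_iff)

lemma kernel_closed: "0 \<in> K" "x \<in> K \<Longrightarrow> y \<in> K \<Longrightarrow> x + y \<in> K" "x \<in> K \<Longrightarrow> - x \<in> K"
    "x \<in> K \<Longrightarrow> y \<in> K \<Longrightarrow> x - y \<in> K"
proof -
  show 0: "0 \<in> K" using subgroup.one_closed[OF kernel_subgroup] by simp
  show add: "x + y \<in> K" if "x \<in> K" "y \<in> K" for x y
    using subgroup.m_closed[OF kernel_subgroup that] by simp
  show minus: "- x \<in> K" if "x \<in> K" for x
    using subgroup.m_inv_closed[OF kernel_subgroup that] by simp
  show "x - y \<in> K" if "x \<in> K" "y \<in> K" for x y
    using add[OF that(1) minus[OF that(2)]] by simp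
qed

lemma tensor_add_kernel: "frag_of (a + a', z) - frag_of (a, z) - frag_of (a', z) \<in> K"
  by (rule relation_in_kernel) (unfold tensor_relations_def, blast)

lemma tensor_add_right_kernel: "frag_of (a, z + w) - frag_of (a, z) - frag_of (a, w) \<in> K"
  by (rule relation_in_kernel) (unfold tensor_relations_def, blast)

lemma tensor_balanced_kernel: "b \<in> A \<one> \<Longrightarrow> frag_of (a * b, z) - frag_of (a, \<omega> b * z) \<in> K"
  by (rule relation_in_kernel) (unfold tensor_relations_def, blast)

text \<open>The balancing relation absorbs complex numbers, as multiples of the unit of \<open>B\<close>, into the left
factor.\<close>
lemma coset_is_tensor: "\<exists>a. x - frag_of (a, 1) \<in> K"
proof -
  have "Poly_Mapping.keys x \<subseteq> UNIV" by simp
  then show ?thesis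
  proof (induction x rule: frag_induction)
    case zero
    have "frag_of (0 :: 'a, 1 :: complex) - frag_of (0, 1) - frag_of (0, 1) \<in> K"
      using tensor_add_kernel[of 0 0 1] by simp
    then show ?case by (intro exI[of _ 0]) simp
  next
    case (one x)
    obtain a z where x: "x = (a, z)" by (cases x)
    have z: "z *\<^sub>C 1 \<in> A \<one>" by (simp add: scaleC_mem)
    have "frag_of (a * (z *\<^sub>C 1), 1) - frag_of (a, z) \<in> K"
      using tensor_balanced_kernel[OF z, of a 1] by (simp add: \<omega>_scaleC)
    from kernel_closed(3)[OF this] show ?case by (auto simp: x)
  next
    case (diff x y)
    then obtain a a' where a: "x - frag_of (a, 1) \<in> K" "y - frag_of (a', 1) \<in> K" by blast
    have "frag_of (a, 1) - frag_of (a - a', 1) - frag_of (a', 1) \<in> K"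
      using tensor_add_kernel[of "a - a'" a' 1] by simp
    then have "(x - frag_of (a, 1)) - (y - frag_of (a', 1))
        + (frag_of (a, 1) - frag_of (a - a', 1) - frag_of (a', 1)) \<in> K"
      by (rule kernel_closed(2)[OF kernel_closed(4)[OF a]])
    also have "(x - frag_of (a, 1)) - (y - frag_of (a', 1))
        + (frag_of (a, 1) - frag_of (a - a', 1) - frag_of (a', 1)) = (x - y) - frag_of (a - a', 1)"
      by simp
    finally show ?case by blast
  qed
qed

lemma tensor_space_carrier: "carrier T = range tens"
proof
  show "carrier T \<subseteq> range tens"
  proof
    fix X assume "X \<in> carrier T"
    then obtain x where "X = K #>\<^bsub>FA\<^esub> x"
      by (auto simp: tensor_space_def Let_def tensor_group_def FactGroup_def RCOSETS_def)
    then show "X \<in> range tens"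
      using coset_is_tensor[of x] by (auto simp: tensor_def coset_eq_iff)
  qed
qed (auto simp: tensor_space_def Let_def tensor_group_def FactGroup_def RCOSETS_def tensor_def)

lemma tensor_space_zero: "\<zero>\<^bsub>T\<^esub> = tens 0"
proof -
  have "K #>\<^bsub>FA\<^esub> 0 = tens 0"
    using tensor_add_kernel[of 0 0 1] by (simp add: tensor_def coset_eq_iff)
  moreover have "K #>\<^bsub>FA\<^esub> 0 = K"
    using group.coset_mult_one[OF group_free_Abelian_group subgroup.subset[OF kernel_subgroup]] by simp
  ultimately show ?thesis
    by (simp add: tensor_space_def Let_def tensor_group_def)
qed

lemma tensor_space_add: "tens a \<oplus>\<^bsub>T\<^esub> tens b = tens (a + b)"
proof -
  have "(frag_of (a, 1) + frag_of (b, 1)) - frag_of (a + b, 1) \<in> K"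
    using kernel_closed(3)[OF tensor_add_kernel[of a b 1]] by (simp add: algebra_simps)
  then show ?thesis
    by (simp add: tensor_space_def Let_def tensor_group_def tensor_def coset_add coset_eq_iff)
qed

text \<open>Multiplication by \<open>c\<close> in the left factor is an endomorphism of the free group that maps relations
to relations.\<close>
lemma tensor_eq_scaleC:
  assumes "tens a = tens a'"
  shows "tens (c *\<^sub>C a) = tens (c *\<^sub>C a')"
proof -
  define e where "e = frag_extend (\<lambda>(a :: 'a, z :: complex). frag_of (c *\<^sub>C a, z))"
  have e: "e (x + y) = e x + e y" "e (x - y) = e x - e y" "e (- x) = - e x"
      "e (frag_of (a, z)) = frag_of (c *\<^sub>C a, z)" "e 0 = 0" for x y a z
    by (simp_all add: e_def frag_extend_add frag_extend_diff frag_extend_minus)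
  have rel: "e x \<in> K" if "x \<in> tensor_relations (A \<one>) \<omega>" for x
  proof -
    from that consider
        (left) a a' z where "x = frag_of (a + a', z) - frag_of (a, z) - frag_of (a', z)"
      | (right) a z w where "x = frag_of (a, z + w) - frag_of (a, z) - frag_of (a, w)"
      | (balanced) a b z where "x = frag_of (a * b, z) - frag_of (a, \<omega> b * z)" "b \<in> A \<one>"
      unfolding tensor_relations_def by blast
    then show ?thesis
    proof cases
      case left
      then show ?thesis using tensor_add_kernel by (simp add: e scaleC_add_right)
    next
      case right
      then show ?thesis using tensor_add_right_kernel by (simp add: e)
    next
      case balanced
      then show ?thesis
        using tensor_balanced_kernel[of b "c *\<^sub>C a" z] by (simp add: e mult_scaleC_left)
    qed
  qed
  have "e x \<in> K" if "x \<in> K" for x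
    using that by (induction x rule: kernel_induct) (simp_all add: e rel kernel_closed)
  from this[of "frag_of (a, 1) - frag_of (a', 1)"] show ?thesis
    using assms by (simp add: tensor_def coset_eq_iff e)
qed

lemma tensor_space_smult: "c \<odot>\<^bsub>T\<^esub> tens a = tens (c *\<^sub>C a)"
proof -
  have "(THE u. \<exists>a'. tens a = tens a' \<and> u = tens (c *\<^sub>C a')) = tens (c *\<^sub>C a)"
    using tensor_eq_scaleC by (intro the_equality) blast+
  then show ?thesis by (simp add: tensor_space_def Let_def)
qed

text \<open>The additive map with \<open>(a, z) \<mapsto> z \<Phi> (d a)\<close> kills the relations, since \<open>p\<close> is a map of right
\<open>B\<close>-modules and \<open>\<omega>\<close> is multiplicative.  So the prescribed form is well defined.\<close>
lemma tensor_eq_\<Phi>: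
  assumes "tens a = tens a'"
  shows "\<Phi> (d * a) = \<Phi> (d * a')"
proof -
  interpret C: cring complex_field by (rule cring_complex_field)
  have img: "(\<lambda>(a, z). z * \<Phi> (d * a)) ` UNIV \<subseteq> carrier (add_monoid complex_field)" by simp
  obtain h where h: "h \<in> hom FA (add_monoid complex_field)"
      "\<And>x. x \<in> UNIV \<Longrightarrow> h (frag_of x) = (\<lambda>(a, z). z * \<Phi> (d * a)) x"
    by (rule comm_group.free_Abelian_group_universal[OF C.a_comm_group img]) blast
  have add: "h (x + y) = h x + h y" for x y
    using hom_mult[OF h(1), of x y] by (simp add: carrier_free_Abelian_group_iff)
  have zero: "h 0 = 0" using add[of 0 0] by simp
  have diff: "h (x - y) = h x - h y" for x y
    using add[of "x - y" y] by simp
  have minus: "h (- x) = - h x" for x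
    using diff[of 0 x] zero by simp
  have rel: "h x = 0" if "x \<in> tensor_relations (A \<one>) \<omega>" for x
    using that h(2)
    by (auto simp: tensor_relations_def diff distrib_left distrib_right \<Phi>_add \<Phi>_mult_unit_right
        mult.assoc[of d, symmetric])
  have "h x = 0" if "x \<in> K" for x
    using that by (induction x rule: kernel_induct) (simp_all add: add minus zero rel)
  from this[of "frag_of (a, 1) - frag_of (a', 1)"] show ?thesis
    using assms h(2) by (simp add: tensor_def coset_eq_iff diff)
qed

lemma tensor_space_ip: "ip T (tens a) (tens b) = \<Phi> (b\<^sup>\<star> * a)"
proof -
  have "\<Phi> (b'\<^sup>\<star> * a') = \<Phi> (b\<^sup>\<star> * a)" if "tens a = tens a'" "tens b = tens b'" for a' b'
  proof -
    have "\<Phi> (b'\<^sup>\<star> * a') = \<Phi> (b'\<^sup>\<star> * a)" by (rule tensor_eq_\<Phi>[OF that(1)[symmetric]])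
    also have "\<dots> = cnj (\<Phi> (a\<^sup>\<star> * b'))" by (simp add: \<Phi>_adj[symmetric] adj_mult adj_adj)
    also have "\<dots> = cnj (\<Phi> (a\<^sup>\<star> * b))" using tensor_eq_\<Phi>[OF that(2)] by simp
    also have "\<dots> = \<Phi> (b\<^sup>\<star> * a)" by (simp add: \<Phi>_adj[symmetric] adj_mult adj_adj)
    finally show ?thesis .
  qed
  then have "(THE w. \<exists>a' b'. tens a = tens a' \<and> tens b = tens b' \<and> w = \<Phi> (b'\<^sup>\<star> * a')) = \<Phi> (b\<^sup>\<star> * a)"
    by (intro the_equality) blast+
  then show ?thesis by (simp add: tensor_space_def Let_def \<Phi>_def)
qed

lemma module_tensor_space: "Module.module complex_field T"
proof (rule module_image[where f=tens])
  let ?M = "\<lparr>carrier = UNIV, monoid.mult = undefined, one = undefined,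
    ring.zero = 0, add = (+), smult = scaleC\<rparr> :: (complex, 'a) module"
  show "Module.module complex_field ?M"
  proof (rule moduleI)
    show "abelian_group ?M"
    proof (rule abelian_groupI)
      show "\<exists>b\<in>carrier ?M. b \<oplus>\<^bsub>?M\<^esub> a = \<zero>\<^bsub>?M\<^esub>" for a
        by (rule bexI[of _ "- a"]) simp_all
    qed (simp_all add: add_ac)
  qed (simp_all add: cring_complex_field scaleC_add_left scaleC_add_right scaleC_scaleC scaleC_one)
qed (simp_all add: tensor_space_carrier tensor_space_zero tensor_space_add tensor_space_smult)

lemma semi_inner_product_space_tensor_space: "semi_inner_product_space T"
proof (rule semi_inner_product_space.intro[OF module_tensor_space], rule semi_inner_product_space_axioms.intro)
  fix X Y Z assume "X \<in> carrier T" "Y \<in> carrier T"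
  then obtain a b where ab: "X = tens a" "Y = tens b" by (auto simp: tensor_space_carrier)
  show "ip T (c \<odot>\<^bsub>T\<^esub> X) Y = c * ip T X Y" for c
    by (simp add: ab tensor_space_smult tensor_space_ip mult_scaleC_right \<Phi>_scaleC)
  show "ip T Y X = cnj (ip T X Y)"
    by (simp add: ab tensor_space_ip \<Phi>_adj[symmetric] adj_mult adj_adj)
  assume "Z \<in> carrier T"
  then obtain d where d: "Z = tens d" by (auto simp: tensor_space_carrier)
  show "ip T (X \<oplus>\<^bsub>T\<^esub> Y) Z = ip T X Z + ip T Y Z"
    by (simp add: ab d tensor_space_add tensor_space_ip distrib_left \<Phi>_add)
next
  fix X assume "X \<in> carrier T"
  then show "Re (ip T X X) \<ge> 0"
    by (auto simp: tensor_space_carrier tensor_space_ip \<Phi>_square_nonneg)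
qed

section \<open>The induced representation\<close>

abbreviation (input) Q where "Q \<equiv> quotient_space T"
abbreviation (input) \<H> where "\<H> \<equiv> hilbert_completion Q"
abbreviation (input) v where "v \<equiv> ind_vector G A \<omega>"

lemma inner_product_space_Q: "inner_product_space Q"
  by (rule quotient_space_inner_product_space[OF semi_inner_product_space_tensor_space])

lemma tens_carrier: "tens a \<in> carrier T"
  by (simp add: tensor_space_carrier)

lemma coset_carrier: "form_kernel T +>\<^bsub>T\<^esub> tens a \<in> carrier Q"
  by (simp add: quotient_space_carrier tens_carrier)

lemma hilbert_space_\<H>: "hilbert_space \<H>"
  by (rule hilbert_space_completion[OF inner_product_space_Q])

lemma v_carrier [simp]: "v a \<in> carrier \<H>"
  unfolding ind_vector_def Let_def
  by (rule completion_embedding_carrier[OF inner_product_space_Q coset_carrier])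

lemma v_add: "v a \<oplus>\<^bsub>\<H>\<^esub> v b = v (a + b)"
  unfolding ind_vector_def Let_def
  by (simp add: completion_embedding_add[OF inner_product_space_Q] coset_carrier
      quotient_space_add[OF semi_inner_product_space_tensor_space] tens_carrier tensor_space_add)

lemma v_smult: "c \<odot>\<^bsub>\<H>\<^esub> v a = v (c *\<^sub>C a)"
  unfolding ind_vector_def Let_def
  by (simp add: completion_embedding_smult[OF inner_product_space_Q] coset_carrier
      quotient_space_smult[OF semi_inner_product_space_tensor_space] tens_carrier tensor_space_smult)

lemma v_ip: "ip \<H> (v a) (v b) = \<Phi> (b\<^sup>\<star> * a)"
  unfolding ind_vector_def Let_def
  by (simp add: completion_embedding_ip[OF inner_product_space_Q] coset_carrier
      quotient_space_ip[OF semi_inner_product_space_tensor_space] tens_carrier tensor_space_ip)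

lemma v_dense:
  assumes "x \<in> carrier \<H>" "\<epsilon> > 0"
  shows "\<exists>a. vdist \<H> (v a) x < \<epsilon>"
proof -
  obtain y where y: "y \<in> carrier Q" "vdist \<H> (completion_embedding Q y) x < \<epsilon>"
    using completion_embedding_dense[OF inner_product_space_Q assms] by blast
  then obtain a where "y = form_kernel T +>\<^bsub>T\<^esub> tens a"
    by (auto simp: quotient_space_carrier tensor_space_carrier)
  then show ?thesis
    using y by (auto simp: ind_vector_def Let_def)
qed

lemma v_zero: "\<zero>\<^bsub>\<H>\<^esub> = v 0"
proof -
  interpret hilbert_space \<H> by (rule hilbert_space_\<H>)
  show ?thesis using v_smult[of 0 0] by simp
qed

lemma v_eq_0_iff: "v a = v 0 \<longleftrightarrow> \<Phi> (a\<^sup>\<star> * a) = 0"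
proof -
  interpret hilbert_space \<H> by (rule hilbert_space_\<H>)
  show ?thesis
    using ip_definite[OF v_carrier, of a] v_ip[of a a] v_zero ip_zero_left[OF v_carrier, of a]
    by metis
qed

lemma v_eq_iff: "v a = v b \<longleftrightarrow> (\<forall>d. \<Phi> (d * a) = \<Phi> (d * b))"
proof -
  interpret hilbert_space \<H> by (rule hilbert_space_\<H>)
  show ?thesis
  proof
    assume "v a = v b"
    then have "ip \<H> (v a) (v (d\<^sup>\<star>)) = ip \<H> (v b) (v (d\<^sup>\<star>))" for d by simp
    then show "\<forall>d. \<Phi> (d * a) = \<Phi> (d * b)" by (simp add: v_ip adj_adj)
  next
    assume *: "\<forall>d. \<Phi> (d * a) = \<Phi> (d * b)"
    show "v a = v b"
      by (rule eq_if_ip_eq_on_dense[where D="range v"]) (use * v_dense in \<open>auto simp: v_ip\<close>)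
  qed
qed

text \<open>The kernel of the form is a left ideal, so left multiplication acts on the quotient.\<close>
lemma v_eq_mult: "v a = v b \<Longrightarrow> v (d * a) = v (d * b)"
  unfolding v_eq_iff by (metis mult.assoc)

lemma pre_induced_op: "rep_op (pre_induced_rep G A \<omega>) a (v b) = v (a * b)"
proof -
  have "(THE \<psi>. \<exists>b'. v b = v b' \<and> \<psi> = v (a * b')) = v (a * b)"
    using v_eq_mult by (intro the_equality) blast+
  then show ?thesis by (simp add: pre_induced_rep_def)
qed

lemma pre_induced_space: "rep_space (pre_induced_rep G A \<omega>) = \<H>"
  and pre_induced_dom: "rep_dom (pre_induced_rep G A \<omega>) = range v"
  by (simp_all add: pre_induced_rep_def)

theorem star_representation_pre_induced: "star_representation (pre_induced_rep G A \<omega>)"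
proof -
  interpret hilbert_space \<H> by (rule hilbert_space_\<H>)
  show ?thesis
  proof (rule star_representation.intro)
    show "hilbert_space (rep_space (pre_induced_rep G A \<omega>))"
      by (simp add: pre_induced_space hilbert_space_\<H>)
    show "star_representation_axioms (pre_induced_rep G A \<omega>)"
    proof (rule star_representation_axioms.intro; (unfold pre_induced_space pre_induced_dom)?)
      show "submodule (range v) complex_field \<H>"
        by (rule submoduleI) (auto simp: v_zero a_inv_eq_smult v_smult v_add)
      show "\<exists>\<phi>\<in>range v. vdist \<H> \<phi> x < \<epsilon>" if "x \<in> carrier \<H>" "\<epsilon> > 0" for x \<epsilon>
        using v_dense[OF that] by blast
    qed (auto simp: pre_induced_op v_add v_smult v_ip distrib_left distrib_right
        mult_scaleC_left mult_scaleC_right mult.assoc adj_mult adj_adj)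
  qed
qed

end

section \<open>Trivial stabilizer\<close>

lemma (in complex_star_algebra) scaleC_diff_right: "c *\<^sub>C (a - b) = c *\<^sub>C a - c *\<^sub>C b"
  using scaleC_add_right[of c "a - b" b] by (simp add: algebra_simps)

context positive_character
begin

lemma unit_closed: "\<one> \<in> carrier G"
  by simp

lemma eq_if_ip_v_eq:
  assumes "x \<in> carrier \<H>" "y \<in> carrier \<H>" and eq: "\<And>a. ip \<H> x (v a) = ip \<H> y (v a)"
  shows "x = y"
proof -
  interpret hilbert_space \<H> by (rule hilbert_space_\<H>)
  show ?thesis
  proof (rule eq_if_ip_eq_on_dense[OF assms(1,2)])
    show "range v \<subseteq> carrier \<H>" by auto
    show "\<exists>\<phi>\<in>range v. vdist \<H> \<phi> z < \<epsilon>" if "z \<in> carrier \<H>" "\<epsilon> > 0" for z \<epsilon>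
      using v_dense[OF that] by blast
  qed (use eq in auto)
qed

lemma homogeneous_square_mem: "g \<in> carrier G \<Longrightarrow> c \<in> A g \<Longrightarrow> d \<in> A g \<Longrightarrow> c\<^sup>\<star> * d \<in> A \<one>"
  using mult_mem[of "inv g" g "c\<^sup>\<star>" d] by (simp add: adj_mem)

text \<open>The standing assumption on positive characters says that the Cauchy-Schwarz inequality is an
equality for homogeneous elements of the same degree, so each degree contributes at most one
dimension.  The coefficient is that of the orthogonal projection onto \<open>v c\<close>.\<close>
lemma v_proportional:
  assumes g: "g \<in> carrier G" and c: "c \<in> A g" and d: "d \<in> A g" and nz: "\<omega> (c\<^sup>\<star> * c) \<noteq> 0"
  shows "v d = (\<omega> (c\<^sup>\<star> * d) / \<omega> (c\<^sup>\<star> * c)) \<odot>\<^bsub>\<H>\<^esub> v c"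
proof -
  define l where "l = \<omega> (c\<^sup>\<star> * d) / \<omega> (c\<^sup>\<star> * c)"
  note mem = homogeneous_square_mem[OF g c c] homogeneous_square_mem[OF g c d]
    homogeneous_square_mem[OF g d c] homogeneous_square_mem[OF g d d]
  have \<Phi>: "\<Phi> b = \<omega> b" if "b \<in> A \<one>" for b
    using that by (simp add: \<Phi>_homogeneous[OF unit_closed])
  have dc: "\<omega> (d\<^sup>\<star> * c) = cnj (\<omega> (c\<^sup>\<star> * d))"
    using \<omega>_adj[OF mem(2)] by (simp add: adj_mult adj_adj)
  have cc: "cnj (\<omega> (c\<^sup>\<star> * c)) = \<omega> (c\<^sup>\<star> * c)"
    using \<omega>_adj[OF mem(1)] by (simp add: adj_mult adj_adj)
  have rel: "\<omega> (c\<^sup>\<star> * d) * \<omega> (d\<^sup>\<star> * c) = \<omega> (c\<^sup>\<star> * c) * \<omega> (d\<^sup>\<star> * d)"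
    using pos_characters_mult[OF pos_character g c d] .
  have "(d - l *\<^sub>C c)\<^sup>\<star> * (d - l *\<^sub>C c)
      = d\<^sup>\<star> * d - l *\<^sub>C (d\<^sup>\<star> * c) - cnj l *\<^sub>C (c\<^sup>\<star> * d) + (cnj l * l) *\<^sub>C (c\<^sup>\<star> * c)"
    by (simp add: adj_diff adj_scaleC algebra_simps mult_scaleC_left mult_scaleC_right scaleC_scaleC scaleC_diff_right)
  then have "\<Phi> ((d - l *\<^sub>C c)\<^sup>\<star> * (d - l *\<^sub>C c))
      = \<omega> (d\<^sup>\<star> * d) - l * \<omega> (d\<^sup>\<star> * c) - cnj l * \<omega> (c\<^sup>\<star> * d) + cnj l * l * \<omega> (c\<^sup>\<star> * c)"
    by (simp add: \<Phi>_add \<Phi>_diff \<Phi>_scaleC \<Phi> mem)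
  also have "\<dots> = 0"
  proof -
    have "l * \<omega> (c\<^sup>\<star> * c) = \<omega> (c\<^sup>\<star> * d)" "l * \<omega> (d\<^sup>\<star> * c) = \<omega> (d\<^sup>\<star> * d)"
      using nz rel by (simp_all add: l_def)
    then show ?thesis by (simp add: mult.assoc)
  qed
  finally have "v (d - l *\<^sub>C c) = v 0" by (simp add: v_eq_0_iff)
  then have "v ((d - l *\<^sub>C c) + l *\<^sub>C c) = v (0 + l *\<^sub>C c)"
    by (simp only: v_add[symmetric])
  then show ?thesis by (simp add: l_def v_smult)
qed

text \<open>Left multiplication by \<open>B\<close> preserves the degree, so it acts on the line of that degree by
scalars, and these are the values of the conjugate character.\<close>
lemma conj_character_eigenvector:
  assumes g: "g \<in> carrier G" and "conj_character_defined A \<omega> g"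
  obtains c where "c \<in> A g" "\<omega> (c\<^sup>\<star> * c) \<noteq> 0"
    "conj_character G A \<omega> g = restrict (\<lambda>b. \<omega> (c\<^sup>\<star> * b * c) / \<omega> (c\<^sup>\<star> * c)) (A \<one>)"
    "\<And>b. b \<in> A \<one> \<Longrightarrow> v (b * c) = conj_character G A \<omega> g b \<odot>\<^bsub>\<H>\<^esub> v c"
proof -
  define c where "c = (SOME a. a \<in> A g \<and> \<omega> (a\<^sup>\<star> * a) \<noteq> 0)"
  have "\<exists>a. a \<in> A g \<and> \<omega> (a\<^sup>\<star> * a) \<noteq> 0"
    using assms(2) by (auto simp: conj_character_defined_def)
  from someI_ex[OF this] have c: "c \<in> A g" "\<omega> (c\<^sup>\<star> * c) \<noteq> 0"
    unfolding c_def by auto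
  have eq: "conj_character G A \<omega> g = restrict (\<lambda>b. \<omega> (c\<^sup>\<star> * b * c) / \<omega> (c\<^sup>\<star> * c)) (A \<one>)"
    by (simp add: conj_character_def Let_def c_def)
  have "v (b * c) = conj_character G A \<omega> g b \<odot>\<^bsub>\<H>\<^esub> v c" if "b \<in> A \<one>" for b
  proof -
    have "b * c \<in> A g" using mult_mem[OF unit_closed g that c(1)] g by simp
    from v_proportional[OF g c(1) this c(2)] show ?thesis
      using that by (simp add: eq mult.assoc)
  qed
  with c eq show ?thesis using that by blast
qed

text \<open>The eigenvalue equation is tested against the vectors \<open>v a\<close> only, which is the form that the
adjoint relation of a direct summand provides.  In a degree whose character differs from \<open>\<omega>\<close>, the
two eigenvalues force \<open>x\<close> to be orthogonal to that degree.\<close>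
lemma eigenvector_of_trivial_stabilizer:
  assumes St: "character_stabilizer G A \<omega> = {\<one>}" and x: "x \<in> carrier \<H>"
    and eigen: "\<And>a b. b \<in> A \<one> \<Longrightarrow> ip \<H> x (v (b\<^sup>\<star> * a)) = \<omega> b * ip \<H> x (v a)"
  shows "x = ip \<H> x (v 1) \<odot>\<^bsub>\<H>\<^esub> v 1"
proof -
  interpret hilbert_space \<H> by (rule hilbert_space_\<H>)
  have eq: "ip \<H> x (v a) = ip \<H> x (v 1) * \<Phi> (a\<^sup>\<star>)" for a
  proof (induction a rule: homogeneous_induct)
    case (add a b)
    then show ?case
      using x by (simp add: v_add[symmetric] ip_add_right adj_add \<Phi>_add distrib_left)
  next
    case (homogeneous g a)
    show ?case
    proof (cases "g = \<one>")
      case True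
      then have a: "a \<in> A \<one>" using homogeneous by simp
      have "v a = \<omega> a \<odot>\<^bsub>\<H>\<^esub> v 1"
        using v_proportional[OF unit_closed one_mem a] by simp
      moreover have "\<Phi> (a\<^sup>\<star>) = cnj (\<omega> a)"
        using a by (simp add: \<Phi>_adj \<Phi>_homogeneous[OF unit_closed])
      ultimately show ?thesis using x by (simp add: ip_smult_right)
    next
      case False
      then have "\<Phi> (a\<^sup>\<star>) = 0"
        using homogeneous by (simp add: \<Phi>_adj \<Phi>_homogeneous)
      moreover have "ip \<H> x (v a) = 0"
      proof (cases "conj_character_defined A \<omega> g")
        case undef: False
        then have "\<omega> (a\<^sup>\<star> * a) = 0"
          using homogeneous by (auto simp: conj_character_defined_def)
        then have "\<Phi> (a\<^sup>\<star> * a) = 0"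
          using homogeneous by (simp add: \<Phi>_homogeneous[OF unit_closed homogeneous_square_mem])
        then have "v a = \<zero>\<^bsub>\<H>\<^esub>" by (simp add: v_zero v_eq_0_iff)
        then show ?thesis using x by simp
      next
        case True
        obtain c where c: "c \<in> A g" "\<omega> (c\<^sup>\<star> * c) \<noteq> 0"
            "conj_character G A \<omega> g = restrict (\<lambda>b. \<omega> (c\<^sup>\<star> * b * c) / \<omega> (c\<^sup>\<star> * c)) (A \<one>)"
            "\<And>b. b \<in> A \<one> \<Longrightarrow> v (b * c) = conj_character G A \<omega> g b \<odot>\<^bsub>\<H>\<^esub> v c"
          by (rule conj_character_eigenvector[OF homogeneous(1) True]) blast
        have ne: "conj_character G A \<omega> g \<noteq> \<omega>"
          using St \<open>g \<noteq> \<one>\<close> homogeneous(1) True by (auto simp: character_stabilizer_def)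
        have ext: "conj_character G A \<omega> g \<in> extensional (A \<one>)"
          by (simp add: c(3))
        have "\<exists>b\<in>A \<one>. conj_character G A \<omega> g b \<noteq> \<omega> b"
        proof (rule ccontr)
          assume "\<not> ?thesis"
          then have "conj_character G A \<omega> g = \<omega>"
            by (intro extensionalityI[OF ext \<omega>_extensional]) blast
          with ne show False by contradiction
        qed
        then obtain b where b: "b \<in> A \<one>" "conj_character G A \<omega> g b \<noteq> \<omega> b" by blast
        have b': "b\<^sup>\<star> \<in> A \<one>" using adj_mem[OF unit_closed b(1)] by simp
        have "cnj (conj_character G A \<omega> g b) * ip \<H> x (v c) = cnj (\<omega> b) * ip \<H> x (v c)"
          using eigen[OF b', of c] c(4)[OF b(1)] \<omega>_adj[OF b(1)] x
          by (simp add: adj_adj ip_smult_right)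
        then have "ip \<H> x (v c) = 0" using b(2) by simp
        then show ?thesis
          using v_proportional[OF homogeneous(1) c(1) homogeneous(2) c(2)] x
          by (simp add: ip_smult_right)
      qed
      ultimately show ?thesis by simp
    qed
  qed
  show ?thesis
  proof (rule eq_if_ip_v_eq)
    show "ip \<H> x (v a) = ip \<H> (ip \<H> x (v 1) \<odot>\<^bsub>\<H>\<^esub> v 1) (v a)" for a
      using eq[of a] by (simp add: ip_smult_left v_ip)
  qed (use x in auto)
qed

lemma induced_space: "rep_space (induced_rep G A \<omega>) = \<H>"
  and induced_dom: "v a \<in> rep_dom (induced_rep G A \<omega>)"
  and induced_op: "rep_op (induced_rep G A \<omega>) a (v b) = v (a * b)"
proof -
  interpret R0: star_representation "pre_induced_rep G A \<omega>"
    by (rule star_representation_pre_induced)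
  have dom: "v a \<in> rep_dom (pre_induced_rep G A \<omega>)" for a
    by (simp add: pre_induced_dom)
  show "rep_space (induced_rep G A \<omega>) = \<H>"
    by (simp add: induced_rep_def pre_induced_space)
  show "v a \<in> rep_dom (induced_rep G A \<omega>)"
    unfolding induced_rep_def by (rule R0.rep_closure_extends(1)[OF dom])
  show "rep_op (induced_rep G A \<omega>) a (v b) = v (a * b)"
    unfolding induced_rep_def by (simp add: R0.rep_closure_extends(2)[OF dom] pre_induced_op)
qed

text \<open>The component \<open>\<xi>1\<close> of the cyclic vector is an eigenvector for \<open>\<omega>\<close>, hence \<open>\<xi>1 = l v 1\<close>; orthogonality
of the components gives \<open>l = \<bar>l\<bar>\<^sup>2\<close>.  So one of the components is zero, and it generates its summand.\<close>
theorem irreducible_if_trivial_stabilizer: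
  assumes St: "character_stabilizer G A \<omega> = {\<one>}"
  shows "irreducible_rep (induced_rep G A \<omega>)"
  unfolding irreducible_rep_def
proof (intro allI impI, elim conjE)
  fix R1 R2 :: "('a, 'a ind_vector) representation"
  assume R1: "star_representation R1" and R2: "star_representation R2"
    and sum: "orthogonal_sum_of (induced_rep G A \<omega>) R1 R2"
  interpret hilbert_space \<H> by (rule hilbert_space_\<H>)
  interpret R1: star_representation R1 by (rule R1)
  interpret R2: star_representation R2 by (rule R2)
  have V1: "rep_space R1 = \<H>\<lparr>carrier := carrier (rep_space R1)\<rparr>"
    and V2: "rep_space R2 = \<H>\<lparr>carrier := carrier (rep_space R2)\<rparr>"
    and carrier: "carrier \<H> = carrier (rep_space R1) <+>\<^bsub>\<H>\<^esub> carrier (rep_space R2)"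
    and orth: "\<And>x y. x \<in> carrier (rep_space R1) \<Longrightarrow> y \<in> carrier (rep_space R2) \<Longrightarrow> ip \<H> x y = 0"
    and dom: "rep_dom (induced_rep G A \<omega>) = rep_dom R1 <+>\<^bsub>\<H>\<^esub> rep_dom R2"
    and op: "\<And>a \<phi> \<psi>. \<phi> \<in> rep_dom R1 \<Longrightarrow> \<psi> \<in> rep_dom R2 \<Longrightarrow>
      rep_op (induced_rep G A \<omega>) a (\<phi> \<oplus>\<^bsub>\<H>\<^esub> \<psi>) = rep_op R1 a \<phi> \<oplus>\<^bsub>\<H>\<^esub> rep_op R2 a \<psi>"
    using sum unfolding orthogonal_sum_of_def Let_def induced_space by blast+
  have ip1: "ip (rep_space R1) = ip \<H>" and zero1: "\<zero>\<^bsub>rep_space R1\<^esub> = \<zero>\<^bsub>\<H>\<^esub>"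
    using arg_cong[OF V1, of ip] arg_cong[OF V1, of "ring.zero"] by simp_all
  have ip2: "ip (rep_space R2) = ip \<H>" and zero2: "\<zero>\<^bsub>rep_space R2\<^esub> = \<zero>\<^bsub>\<H>\<^esub>"
    using arg_cong[OF V2, of ip] arg_cong[OF V2, of "ring.zero"] by simp_all
  have add1: "add (rep_space R1) = add \<H>" and add2: "add (rep_space R2) = add \<H>"
    using arg_cong[OF V1, of add] arg_cong[OF V2, of add] by simp_all
  \<comment> \<open>the summands contain zero, and their additions and zeros are those of the whole space\<close>
  have sub1: "x \<in> carrier \<H>" if "x \<in> carrier (rep_space R1)" for x
  proof -
    have "x = x \<oplus>\<^bsub>\<H>\<^esub> \<zero>\<^bsub>rep_space R2\<^esub>"
      using R1.M.r_zero[OF that] by (simp add: add1 zero1 zero2)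
    then show ?thesis
      unfolding carrier set_add_def' using that R2.M.zero_closed by blast
  qed
  have sub2: "x \<in> carrier \<H>" if "x \<in> carrier (rep_space R2)" for x
  proof -
    have "x = \<zero>\<^bsub>rep_space R1\<^esub> \<oplus>\<^bsub>\<H>\<^esub> x"
      using R2.M.l_zero[OF that] by (simp add: add2 zero1 zero2)
    then show ?thesis
      unfolding carrier set_add_def' using that R1.M.zero_closed by blast
  qed
  have orth': "ip \<H> y x = 0" if "x \<in> carrier (rep_space R1)" "y \<in> carrier (rep_space R2)" for x y
    using ip_cnj[of x y] orth[OF that] sub1[OF that(1)] sub2[OF that(2)] by simp
  obtain \<xi>1 \<xi>2 where \<xi>: "\<xi>1 \<in> rep_dom R1" "\<xi>2 \<in> rep_dom R2" "v 1 = \<xi>1 \<oplus>\<^bsub>\<H>\<^esub> \<xi>2"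
    using induced_dom[of 1] unfolding dom set_add_def' by blast
  show "rep_dom R1 = {\<zero>\<^bsub>rep_space (induced_rep G A \<omega>)\<^esub>} \<or>
      rep_dom R2 = {\<zero>\<^bsub>rep_space (induced_rep G A \<omega>)\<^esub>}"
  proof -
    note \<xi>1 = R1.dom_carrier[OF \<xi>(1)] sub1[OF R1.dom_carrier[OF \<xi>(1)]]
    note \<xi>2 = R2.dom_carrier[OF \<xi>(2)] sub2[OF R2.dom_carrier[OF \<xi>(2)]]
    \<comment> \<open>the components of every vector \<open>v a\<close> come from those of the cyclic vector\<close>
    have va: "v a = rep_op R1 a \<xi>1 \<oplus>\<^bsub>\<H>\<^esub> rep_op R2 a \<xi>2" for a
      using induced_op[of a 1] op[OF \<xi>(1,2)] \<xi>(3) by simp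
    note op1 = R1.op_carrier[OF \<xi>(1)] sub1[OF R1.op_carrier[OF \<xi>(1)]]
    note op2 = R2.op_carrier[OF \<xi>(2)] sub2[OF R2.op_carrier[OF \<xi>(2)]]
    have ip1_v: "ip \<H> x (v a) = ip \<H> x (rep_op R1 a \<xi>1)" if "x \<in> carrier (rep_space R1)" for x a
      using orth[OF that op2(1)] sub1[OF that] by (simp add: va ip_add_right op1 op2)
    have ip2_v: "ip \<H> x (v a) = ip \<H> x (rep_op R2 a \<xi>2)" if "x \<in> carrier (rep_space R2)" for x a
      using orth'[OF op1(1) that] sub2[OF that] by (simp add: va ip_add_right op1 op2)
    have dom1_null: "rep_dom R1 = {\<zero>\<^bsub>\<H>\<^esub>}" if "\<xi>1 = \<zero>\<^bsub>\<H>\<^esub>"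
    proof -
      have "x = \<zero>\<^bsub>\<H>\<^esub>" if x: "x \<in> rep_dom R1" for x
      proof (rule eq_if_ip_v_eq)
        note xc = R1.dom_carrier[OF x]
        show "x \<in> carrier \<H>" "\<zero>\<^bsub>\<H>\<^esub> \<in> carrier \<H>" using sub1[OF xc] by auto
        have "ip \<H> x (v a) = ip \<H> (rep_op R1 (a\<^sup>\<star>) x) \<xi>1" for a
          using R1.op_adj[OF x \<xi>(1), of "a\<^sup>\<star>"] ip1_v[OF xc, of a] by (simp add: ip1 adj_adj)
        then show "ip \<H> x (v a) = ip \<H> \<zero>\<^bsub>\<H>\<^esub> (v a)" for a
          using \<open>\<xi>1 = \<zero>\<^bsub>\<H>\<^esub>\<close> sub1[OF R1.op_carrier[OF x]] by simp
      qed
      moreover have "\<zero>\<^bsub>\<H>\<^esub> \<in> rep_dom R1" using \<xi>(1) that by simp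
      ultimately show ?thesis by blast
    qed
    have dom2_null: "rep_dom R2 = {\<zero>\<^bsub>\<H>\<^esub>}" if "\<xi>2 = \<zero>\<^bsub>\<H>\<^esub>"
    proof -
      have "x = \<zero>\<^bsub>\<H>\<^esub>" if x: "x \<in> rep_dom R2" for x
      proof (rule eq_if_ip_v_eq)
        note xc = R2.dom_carrier[OF x]
        show "x \<in> carrier \<H>" "\<zero>\<^bsub>\<H>\<^esub> \<in> carrier \<H>" using sub2[OF xc] by auto
        have "ip \<H> x (v a) = ip \<H> (rep_op R2 (a\<^sup>\<star>) x) \<xi>2" for a
          using R2.op_adj[OF x \<xi>(2), of "a\<^sup>\<star>"] ip2_v[OF xc, of a] by (simp add: ip2 adj_adj)
        then show "ip \<H> x (v a) = ip \<H> \<zero>\<^bsub>\<H>\<^esub> (v a)" for a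
          using \<open>\<xi>2 = \<zero>\<^bsub>\<H>\<^esub>\<close> sub2[OF R2.op_carrier[OF x]] by simp
      qed
      moreover have "\<zero>\<^bsub>\<H>\<^esub> \<in> rep_dom R2" using \<xi>(2) that by simp
      ultimately show ?thesis by blast
    qed
    define l where "l = ip \<H> \<xi>1 (v 1)"
    have \<xi>1_eq: "\<xi>1 = l \<odot>\<^bsub>\<H>\<^esub> v 1"
      unfolding l_def
    proof (rule eigenvector_of_trivial_stabilizer[OF St \<xi>1(2)])
      fix a b assume b: "b \<in> A \<one>"
      define z where "z = rep_op R1 a \<xi>1"
      have z: "z \<in> rep_dom R1" "z \<in> carrier (rep_space R1)" "z \<in> carrier \<H>"
        using R1.op_closed[OF \<xi>(1)] op1 by (simp_all add: z_def)
      have "ip \<H> \<xi>1 (v (b\<^sup>\<star> * a)) = ip \<H> \<xi>1 (rep_op R1 (b\<^sup>\<star>) z)"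
        using ip1_v[OF \<xi>1(1)] R1.op_mult[OF \<xi>(1)] by (simp add: z_def)
      also have "\<dots> = ip \<H> (rep_op R1 b \<xi>1) z"
        using R1.op_adj[OF \<xi>(1) z(1), of b] by (simp add: ip1)
      also have "\<dots> = ip \<H> (v b) z"
        using orth'[OF z(2) op2(1)] z(3) by (simp add: va ip_add_left op1 op2)
      also have "v b = \<omega> b \<odot>\<^bsub>\<H>\<^esub> v 1"
        using v_proportional[OF unit_closed one_mem b] by simp
      also have "ip \<H> (\<omega> b \<odot>\<^bsub>\<H>\<^esub> v 1) z = \<omega> b * ip \<H> \<xi>1 z"
        using orth'[OF z(2) \<xi>2(1)] z(3) \<xi>1 \<xi>2 by (simp only: \<xi>(3)) (simp add: ip_smult_left ip_add_left)
      also have "ip \<H> \<xi>1 z = ip \<H> \<xi>1 (v a)"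
        using ip1_v[OF \<xi>1(1)] by (simp add: z_def)
      finally show "ip \<H> \<xi>1 (v (b\<^sup>\<star> * a)) = \<omega> b * ip \<H> \<xi>1 (v a)" .
    qed
    have v1: "ip \<H> (v 1) (v 1) = 1"
      by (simp add: v_ip \<Phi>_homogeneous[OF unit_closed one_mem])
    have "l = ip \<H> \<xi>1 \<xi>1"
      unfolding l_def using ip1_v[OF \<xi>1(1), of 1] R1.op_one[OF \<xi>(1)] by simp
    also have "\<dots> = l * cnj l"
      by (subst (1 2) \<xi>1_eq) (simp add: ip_smult_left ip_smult_right v1)
    finally have "l * (1 - cnj l) = 0" by (simp add: algebra_simps)
    then consider "l = 0" | "l = 1" by auto
    then show ?thesis
    proof cases
      case 1
      then have "\<xi>1 = \<zero>\<^bsub>\<H>\<^esub>" using \<xi>1_eq by simp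
      then show ?thesis using dom1_null by (simp add: induced_space)
    next
      case 2
      then have "\<xi>1 = v 1" using \<xi>1_eq by simp
      then have "\<xi>1 = \<xi>1 \<oplus>\<^bsub>\<H>\<^esub> \<xi>2" using \<xi>(3) by simp
      then have "\<xi>2 = \<zero>\<^bsub>\<H>\<^esub>"
        using M.add.l_cancel_one'[OF \<xi>1(2) \<xi>2(2)] by simp
      then show ?thesis using dom2_null by (simp add: induced_space)
    qed
  qed
qed

end

section \<open>Reflections from approximately unitary central elements\<close>

text \<open>A sequence of elements of the algebra that are central and self-adjoint modulo the kernel of
the form, and whose products \<open>x m x n\<close> converge weakly to the unit as both indices grow.  The joint
limit yields not only that the limit of the right multiplications is isometric but also that it exists.\<close>
locale approximate_reflection = positive_character G A \<omega>
  for G :: "('g, 'm) monoid_scheme" (structure)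
    and A :: "'g \<Rightarrow> 'a::complex_star_algebra set"
    and \<omega> :: "'a \<Rightarrow> complex" +
  fixes x :: "nat \<Rightarrow> 'a"
  assumes central: "\<Phi> (d * x n) = \<Phi> (x n * d)"
    and self_adjoint: "\<Phi> (d * (x n)\<^sup>\<star>) = \<Phi> (d * x n)"
    and square: "\<epsilon> > 0 \<Longrightarrow> \<exists>N. \<forall>m\<ge>N. \<forall>n\<ge>N. cmod (\<Phi> (d * x m * x n) - \<Phi> d) < \<epsilon>"
begin

lemma central_adj: "\<Phi> ((x n)\<^sup>\<star> * d) = \<Phi> (d * x n)"
proof -
  have "\<Phi> ((x n)\<^sup>\<star> * d) = cnj (\<Phi> (d\<^sup>\<star> * x n))"
    by (simp add: \<Phi>_adj[symmetric] adj_mult adj_adj)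
  also have "\<dots> = \<Phi> (d * (x n)\<^sup>\<star>)"
    unfolding central by (simp add: \<Phi>_adj[symmetric] adj_mult adj_adj)
  finally show ?thesis by (simp add: self_adjoint)
qed

lemma ip_v_mult: "ip \<H> (v (a * x m)) (v (b * x n)) = \<Phi> (b\<^sup>\<star> * a * x m * x n)"
  using central_adj[of n "b\<^sup>\<star> * a * x m"] by (simp add: v_ip adj_mult mult.assoc)

text \<open>The squared distance is an alternating sum of four values that all converge to \<open>\<Phi> (a\<^sup>\<star> a)\<close>.\<close>
lemma cauchy_v_mult: "(\<lambda>n. v (a * x n)) \<in> cauchy_sequences \<H>"
proof -
  interpret hilbert_space \<H> by (rule hilbert_space_\<H>)
  show ?thesis
  proof (rule cauchy_sequencesI)
    fix \<epsilon> :: real assume e: "\<epsilon> > 0"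
    define c where "c = a\<^sup>\<star> * a"
    have e2: "\<epsilon>\<^sup>2 / 4 > 0" using e by simp
    obtain N where N: "\<forall>m\<ge>N. \<forall>n\<ge>N. cmod (\<Phi> (c * x m * x n) - \<Phi> c) < \<epsilon>\<^sup>2 / 4"
      using square[OF e2] by blast
    have close: "\<bar>Re (\<Phi> (c * x m * x n)) - Re (\<Phi> c)\<bar> < \<epsilon>\<^sup>2 / 4" if "m \<ge> N" "n \<ge> N" for m n
    proof -
      have "\<bar>Re (\<Phi> (c * x m * x n)) - Re (\<Phi> c)\<bar> \<le> cmod (\<Phi> (c * x m * x n) - \<Phi> c)"
        using abs_Re_le_cmod[of "\<Phi> (c * x m * x n) - \<Phi> c"] by simp
      also have "\<dots> < \<epsilon>\<^sup>2 / 4" using N that by blast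
      finally show ?thesis .
    qed
    show "\<exists>N. \<forall>m\<ge>N. \<forall>n\<ge>N. vdist \<H> (v (a * x m)) (v (a * x n)) < \<epsilon>"
    proof (intro exI[of _ N] allI impI)
      fix m n assume mn: "N \<le> m" "N \<le> n"
      have "(vdist \<H> (v (a * x m)) (v (a * x n)))\<^sup>2
          = Re (\<Phi> (c * x m * x m)) - Re (\<Phi> (c * x m * x n)) - Re (\<Phi> (c * x n * x m)) + Re (\<Phi> (c * x n * x n))"
        by (simp add: vdist_sq ip_v_mult c_def)
      also have "\<dots> < \<epsilon>\<^sup>2"
        using close[of m m] close[of m n] close[of n m] close[of n n] mn by linarith
      finally show "vdist \<H> (v (a * x m)) (v (a * x n)) < \<epsilon>"
        using e by (simp add: power2_less_imp_less)
    qed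
  qed simp
qed

definition s :: "'a \<Rightarrow> 'a ind_vector" where
  "s a = (SOME y. y \<in> carrier \<H> \<and> (\<lambda>n. vdist \<H> (v (a * x n)) y) \<longlonglongrightarrow> 0)"

lemma s_carrier [simp]: "s a \<in> carrier \<H>"
  and s_limit: "(\<lambda>n. vdist \<H> (v (a * x n)) (s a)) \<longlonglongrightarrow> 0"
proof -
  interpret hilbert_space \<H> by (rule hilbert_space_\<H>)
  have "\<exists>y. y \<in> carrier \<H> \<and> (\<lambda>n. vdist \<H> (v (a * x n)) y) \<longlonglongrightarrow> 0"
    using complete[OF cauchy_v_mult] by blast
  from someI_ex[OF this]
  show "s a \<in> carrier \<H>" "(\<lambda>n. vdist \<H> (v (a * x n)) (s a)) \<longlonglongrightarrow> 0"
    unfolding s_def by auto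
qed

lemma s_ip_v: "(\<lambda>n. \<Phi> (b\<^sup>\<star> * a * x n)) \<longlonglongrightarrow> ip \<H> (s a) (v b)"
proof -
  interpret hilbert_space \<H> by (rule hilbert_space_\<H>)
  have "(\<lambda>n. ip \<H> (v (a * x n)) (v b)) \<longlonglongrightarrow> ip \<H> (s a) (v b)"
    by (rule ip_tendsto[OF s_limit]) auto
  then show ?thesis by (simp add: v_ip mult.assoc)
qed

lemma s_symmetric: "ip \<H> (s a) (v b) = ip \<H> (v a) (s b)"
proof -
  interpret hilbert_space \<H> by (rule hilbert_space_\<H>)
  have "(\<lambda>n. ip \<H> (v a) (v (b * x n))) \<longlonglongrightarrow> ip \<H> (v a) (s b)"
    by (rule ip_tendsto[OF _ s_limit]) auto
  moreover have "ip \<H> (v a) (v (b * x n)) = \<Phi> (b\<^sup>\<star> * a * x n)" for n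
    using central_adj[of n "b\<^sup>\<star> * a"] by (simp add: v_ip adj_mult mult.assoc)
  ultimately show ?thesis
    using LIMSEQ_unique[OF s_ip_v] by simp
qed

lemma s_isometry: "ip \<H> (s a) (s b) = ip \<H> (v a) (v b)"
proof -
  interpret hilbert_space \<H> by (rule hilbert_space_\<H>)
  have "(\<lambda>n. ip \<H> (v (a * x n)) (v (b * x n))) \<longlonglongrightarrow> ip \<H> (s a) (s b)"
    by (rule ip_tendsto[OF s_limit s_limit]) auto
  moreover have "(\<lambda>n. ip \<H> (v (a * x n)) (v (b * x n))) \<longlonglongrightarrow> \<Phi> (b\<^sup>\<star> * a)"
  proof (rule LIMSEQ_I)
    fix r :: real assume "r > 0"
    from square[OF this, of "b\<^sup>\<star> * a"]
    show "\<exists>N. \<forall>n\<ge>N. cmod (ip \<H> (v (a * x n)) (v (b * x n)) - \<Phi> (b\<^sup>\<star> * a)) < r"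
      unfolding ip_v_mult by blast
  qed
  ultimately show ?thesis
    using LIMSEQ_unique by (simp add: v_ip)
qed

text \<open>The values \<open>s b\<close> of the reflection on the vectors \<open>v b\<close> are known, so its symmetry determines it
everywhere.\<close>
definition S :: "'a ind_vector \<Rightarrow> 'a ind_vector" where
  "S y = (THE z. z \<in> carrier \<H> \<and> (\<forall>b. ip \<H> z (v b) = ip \<H> y (s b)))"

text \<open>Since \<open>v a \<mapsto> s a\<close> is isometric, it maps an approximating sequence of \<open>y\<close> to a Cauchy sequence;
the limit of the latter satisfies the equations that define \<open>S y\<close>.\<close>
lemma S_approx:
  assumes y: "y \<in> carrier \<H>"
  obtains \<alpha> where "(\<lambda>n. vdist \<H> (v (\<alpha> n)) y) \<longlonglongrightarrow> 0"
    "(\<lambda>n. vdist \<H> (s (\<alpha> n)) (S y)) \<longlonglongrightarrow> 0" "S y \<in> carrier \<H>" "\<And>b. ip \<H> (S y) (v b) = ip \<H> y (s b)"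
proof -
  interpret hilbert_space \<H> by (rule hilbert_space_\<H>)
  have "\<exists>a. vdist \<H> (v a) y < inverse (real (Suc n))" for n
    using v_dense[OF y] by simp
  then obtain \<alpha> where \<alpha>: "\<And>n. vdist \<H> (v (\<alpha> n)) y < inverse (real (Suc n))"
    by metis
  have lim: "(\<lambda>n. vdist \<H> (v (\<alpha> n)) y) \<longlonglongrightarrow> 0"
    by (rule tendsto_zero_le[OF LIMSEQ_inverse_real_of_nat]) (use \<alpha> y in \<open>simp_all add: less_imp_le\<close>)
  have vdist: "vdist \<H> (s a) (s b) = vdist \<H> (v a) (v b)" for a b
  proof -
    have "(vdist \<H> (s a) (s b))\<^sup>2 = (vdist \<H> (v a) (v b))\<^sup>2"
      by (simp add: vdist_sq s_isometry)
    then show ?thesis by simp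
  qed
  have "(\<lambda>n. s (\<alpha> n)) \<in> cauchy_sequences \<H>"
  proof (rule cauchy_sequencesI)
    fix \<epsilon> :: real assume "\<epsilon> > 0"
    then have "\<epsilon> / 2 > 0" by simp
    from order_tendstoD(2)[OF lim this] obtain N where N: "\<And>n. n \<ge> N \<Longrightarrow> vdist \<H> (v (\<alpha> n)) y < \<epsilon> / 2"
      unfolding eventually_sequentially by blast
    have "vdist \<H> (s (\<alpha> m)) (s (\<alpha> n)) < \<epsilon>" if "m \<ge> N" "n \<ge> N" for m n
      using vdist_triangle[OF v_carrier y v_carrier, of "\<alpha> m" "\<alpha> n"] vdist_commute[OF v_carrier y, of "\<alpha> n"]
        N[OF that(1)] N[OF that(2)] by (simp add: vdist)
    then show "\<exists>N. \<forall>m\<ge>N. \<forall>n\<ge>N. vdist \<H> (s (\<alpha> m)) (s (\<alpha> n)) < \<epsilon>" by blast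
  qed simp
  then obtain z where z: "z \<in> carrier \<H>" "(\<lambda>n. vdist \<H> (s (\<alpha> n)) z) \<longlonglongrightarrow> 0"
    using complete by blast
  have z_ip: "ip \<H> z (v b) = ip \<H> y (s b)" for b
  proof (rule LIMSEQ_unique)
    show "(\<lambda>n. ip \<H> (s (\<alpha> n)) (v b)) \<longlonglongrightarrow> ip \<H> z (v b)"
      by (rule ip_tendsto[OF z(2)]) (use z in auto)
    show "(\<lambda>n. ip \<H> (s (\<alpha> n)) (v b)) \<longlonglongrightarrow> ip \<H> y (s b)"
      unfolding s_symmetric by (rule ip_tendsto[OF lim]) (use y in auto)
  qed
  have "S y = z"
    unfolding S_def
  proof (rule the_equality)
    fix z' assume "z' \<in> carrier \<H> \<and> (\<forall>b. ip \<H> z' (v b) = ip \<H> y (s b))"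
    then show "z' = z" using z(1) z_ip by (intro eq_if_ip_v_eq) auto
  qed (use z z_ip in blast)
  with that lim z z_ip show ?thesis by metis
qed

lemma S_carrier': "y \<in> carrier \<H> \<Longrightarrow> S y \<in> carrier \<H>"
  and S_ip: "y \<in> carrier \<H> \<Longrightarrow> ip \<H> (S y) (v b) = ip \<H> y (s b)"
  by (rule S_approx, assumption, assumption)+

lemma S_v: "S (v a) = s a"
  by (rule eq_if_ip_v_eq) (simp_all add: S_carrier' S_ip s_symmetric)

lemma S_isometry':
  assumes "y \<in> carrier \<H>" "z \<in> carrier \<H>"
  shows "ip \<H> (S y) (S z) = ip \<H> y z"
proof -
  interpret hilbert_space \<H> by (rule hilbert_space_\<H>)
  obtain \<alpha> where \<alpha>: "(\<lambda>n. vdist \<H> (v (\<alpha> n)) y) \<longlonglongrightarrow> 0" "(\<lambda>n. vdist \<H> (s (\<alpha> n)) (S y)) \<longlonglongrightarrow> 0"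
    by (rule S_approx[OF assms(1)])
  obtain \<beta> where \<beta>: "(\<lambda>n. vdist \<H> (v (\<beta> n)) z) \<longlonglongrightarrow> 0" "(\<lambda>n. vdist \<H> (s (\<beta> n)) (S z)) \<longlonglongrightarrow> 0"
    by (rule S_approx[OF assms(2)])
  show ?thesis
  proof (rule LIMSEQ_unique)
    show "(\<lambda>n. ip \<H> (s (\<alpha> n)) (s (\<beta> n))) \<longlonglongrightarrow> ip \<H> (S y) (S z)"
      by (rule ip_tendsto[OF \<alpha>(2) \<beta>(2)]) (use assms S_carrier' in auto)
    show "(\<lambda>n. ip \<H> (s (\<alpha> n)) (s (\<beta> n))) \<longlonglongrightarrow> ip \<H> y z"
      unfolding s_isometry by (rule ip_tendsto[OF \<alpha>(1) \<beta>(1)]) (use assms in auto)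
  qed
qed

text \<open>If \<open>v a\<close> approximates \<open>\<phi>\<close> in the graph norms of finitely many operators, then so does \<open>s a\<close> for
\<open>S \<phi>\<close>, and \<open>s a\<close> is approximated by the vectors \<open>v (a x n)\<close> of the original domain.\<close>
lemma graph_limit_S:
  assumes gl: "graph_limit (pre_induced_rep G A \<omega>) \<phi> \<psi>"
  shows "graph_limit (pre_induced_rep G A \<omega>) (S \<phi>) (\<lambda>b. S (\<psi> b))"
proof -
  interpret R0: star_representation "pre_induced_rep G A \<omega>"
    by (rule star_representation_pre_induced)
  interpret hilbert_space \<H> by (rule hilbert_space_\<H>)
  note c = R0.graph_limit_carrier[OF gl, unfolded pre_induced_space]
  have S_vdist: "vdist \<H> (S y) (S z) = vdist \<H> y z" if "y \<in> carrier \<H>" "z \<in> carrier \<H>" for y z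
  proof -
    have "(vdist \<H> (S y) (S z))\<^sup>2 = (vdist \<H> y z)\<^sup>2"
      using that by (simp add: vdist_sq S_isometry' S_carrier')
    then show ?thesis using that by (simp add: S_carrier')
  qed
  show ?thesis
  proof (rule R0.graph_limitI, unfold pre_induced_space)
    fix F :: "'a set" and \<epsilon> :: real assume F: "finite F" and "\<epsilon> > 0"
    then have e2: "\<epsilon> / 2 > 0" by simp
    obtain \<xi> where \<xi>: "\<xi> \<in> rep_dom (pre_induced_rep G A \<omega>)" "vdist \<H> \<xi> \<phi> < \<epsilon> / 2"
        "\<And>b. b \<in> F \<Longrightarrow> vdist \<H> (rep_op (pre_induced_rep G A \<omega>) b \<xi>) (\<psi> b) < \<epsilon> / 2"
      by (rule R0.graph_limit_approx[OF gl F e2, unfolded pre_induced_space]) blast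
    then obtain a where a: "\<xi> = v a" by (auto simp: pre_induced_dom)
    have "eventually (\<lambda>n. \<forall>b\<in>F. vdist \<H> (v (b * a * x n)) (s (b * a)) < \<epsilon> / 2) sequentially"
      using F order_tendstoD(2)[OF s_limit e2] by (intro eventually_ball_finite) auto
    with order_tendstoD(2)[OF s_limit[of a] e2]
    have "eventually (\<lambda>n. vdist \<H> (v (a * x n)) (s a) < \<epsilon> / 2 \<and>
        (\<forall>b\<in>F. vdist \<H> (v (b * a * x n)) (s (b * a)) < \<epsilon> / 2)) sequentially"
      by (rule eventually_conj)
    then obtain n where n: "vdist \<H> (v (a * x n)) (s a) < \<epsilon> / 2"
        "\<And>b. b \<in> F \<Longrightarrow> vdist \<H> (v (b * a * x n)) (s (b * a)) < \<epsilon> / 2"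
      using eventually_happens'[OF sequentially_bot] by blast
    show "\<exists>\<xi>\<in>rep_dom (pre_induced_rep G A \<omega>). vdist \<H> \<xi> (S \<phi>) < \<epsilon> \<and>
        (\<forall>b\<in>F. vdist \<H> (rep_op (pre_induced_rep G A \<omega>) b \<xi>) (S (\<psi> b)) < \<epsilon>)"
    proof (intro bexI[of _ "v (a * x n)"] conjI ballI)
      have "vdist \<H> (s a) (S \<phi>) < \<epsilon> / 2"
        using S_vdist[OF v_carrier c(1), of a] \<xi>(2) by (simp add: a S_v)
      then show "vdist \<H> (v (a * x n)) (S \<phi>) < \<epsilon>"
        using vdist_triangle[OF v_carrier s_carrier S_carrier'[OF c(1)], of "a * x n" a] n(1) by simp
    next
      fix b assume b: "b \<in> F"
      have "vdist \<H> (s (b * a)) (S (\<psi> b)) < \<epsilon> / 2"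
        using S_vdist[OF v_carrier c(2), of "b * a" b] \<xi>(3)[OF b] by (simp add: a S_v pre_induced_op)
      then show "vdist \<H> (rep_op (pre_induced_rep G A \<omega>) b (v (a * x n))) (S (\<psi> b)) < \<epsilon>"
        using vdist_triangle[OF v_carrier s_carrier S_carrier'[OF c(2)], of "b * a * x n" b "b * a"] n(2)[OF b]
        by (simp add: pre_induced_op mult.assoc)
    qed (simp add: pre_induced_dom)
  qed (use c S_carrier' in auto)
qed

lemma commuting_reflection_S: "commuting_reflection (induced_rep G A \<omega>) S"
proof -
  interpret R0: star_representation "pre_induced_rep G A \<omega>"
    by (rule star_representation_pre_induced)
  interpret hilbert_space \<H> by (rule hilbert_space_\<H>)
  interpret R: star_representation "induced_rep G A \<omega>"
    unfolding induced_rep_def by (rule R0.star_representation_closure)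
  show ?thesis
  proof (rule commuting_reflection.intro[OF R.star_representation_axioms],
      rule commuting_reflection_axioms.intro, unfold induced_space)
    fix y z assume y: "y \<in> carrier \<H>"
    show "S y \<in> carrier \<H>" using y by (rule S_carrier')
    show "S (c \<odot>\<^bsub>\<H>\<^esub> y) = c \<odot>\<^bsub>\<H>\<^esub> S y" for c
      by (rule eq_if_ip_v_eq) (use y in \<open>simp_all add: S_carrier' S_ip ip_smult_left\<close>)
    show "S (S y) = y"
    proof (rule eq_if_ip_v_eq)
      show "ip \<H> (S (S y)) (v b) = ip \<H> y (v b)" for b
        using y S_isometry'[OF y v_carrier, of b] by (simp add: S_carrier' S_ip S_v)
    qed (use y in \<open>simp_all add: S_carrier'\<close>)
    assume z: "z \<in> carrier \<H>"
    show "S (y \<oplus>\<^bsub>\<H>\<^esub> z) = S y \<oplus>\<^bsub>\<H>\<^esub> S z"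
      by (rule eq_if_ip_v_eq) (use y z in \<open>simp_all add: S_carrier' S_ip ip_add_left\<close>)
    show "ip \<H> (S y) (S z) = ip \<H> y z" using y z by (rule S_isometry')
  next
    fix \<phi> a assume "\<phi> \<in> rep_dom (induced_rep G A \<omega>)"
    then obtain \<psi> where \<psi>: "graph_limit (pre_induced_rep G A \<omega>) \<phi> \<psi>"
      by (auto simp: induced_rep_def R0.rep_closure_dom)
    show "S \<phi> \<in> rep_dom (induced_rep G A \<omega>)"
      using graph_limit_S[OF \<psi>] by (auto simp: induced_rep_def R0.rep_closure_dom)
    show "rep_op (induced_rep G A \<omega>) a (S \<phi>) = S (rep_op (induced_rep G A \<omega>) a \<phi>)"
      using R0.rep_closure_op[OF graph_limit_S[OF \<psi>]] R0.rep_closure_op[OF \<psi>]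
      by (simp add: induced_rep_def)
  qed
qed

text \<open>The hypotheses exhibit a vector orthogonal to \<open>v 1\<close> that is not orthogonal to \<open>S (v 1)\<close>.\<close>
theorem not_irreducible_if_not_scalar:
  assumes d: "\<Phi> d = 0" and nonscalar: "\<not> (\<lambda>n. \<Phi> (d * x n)) \<longlonglongrightarrow> 0"
  shows "\<not> irreducible_rep (induced_rep G A \<omega>)"
proof -
  interpret R: commuting_reflection "induced_rep G A \<omega>" S
    by (rule commuting_reflection_S)
  interpret hilbert_space \<H> by (rule hilbert_space_\<H>)
  have "(\<lambda>n. \<Phi> (d * x n)) \<longlonglongrightarrow> ip \<H> (S (v 1)) (v (d\<^sup>\<star>))"
    using s_ip_v[of "d\<^sup>\<star>" 1] by (simp add: S_v adj_adj)
  then have ne: "ip \<H> (S (v 1)) (v (d\<^sup>\<star>)) \<noteq> 0"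
    using nonscalar by auto
  have "ip \<H> (c \<odot>\<^bsub>\<H>\<^esub> v 1) (v (d\<^sup>\<star>)) = 0" for c
    using d by (simp add: ip_smult_left v_ip adj_adj)
  then have "S (v 1) \<noteq> c \<odot>\<^bsub>\<H>\<^esub> v 1" for c
    using ne by metis
  from this[of 1] this[of "- 1"] show ?thesis
    by (intro R.not_irreducible bexI[of _ "v 1"]) (simp_all add: induced_space induced_dom)
qed

end

section \<open>The Fourier coefficients of a square wave\<close>

lemma has_sum_int:
  fixes f :: "int \<Rightarrow> real"
  assumes "((\<lambda>n. f (int n)) has_sum a) UNIV" "((\<lambda>n. f (- int n - 1)) has_sum b) UNIV"
  shows "(f has_sum (a + b)) UNIV"
proof -
  have "(f has_sum a) (range int)"
    using assms(1) by (subst has_sum_reindex) (auto simp: o_def)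
  moreover have "(f has_sum b) (range (\<lambda>n. - int n - 1))"
    using assms(2) by (subst has_sum_reindex) (auto simp: o_def inj_on_def)
  ultimately have "(f has_sum (a + b)) (range int \<union> range (\<lambda>n. - int n - 1))"
    by (rule has_sum_Un_disjoint) auto
  moreover have "range int \<union> range (\<lambda>n. - int n - 1) = UNIV"
  proof -
    have "i \<in> range int \<union> range (\<lambda>n. - int n - 1)" for i
    proof (cases "i \<ge> 0")
      case True
      then have "i = int (nat i)" by simp
      then show ?thesis by blast
    next
      case False
      then have "i = - int (nat (- i - 1)) - 1" by simp
      then show ?thesis by blast
    qed
    then show ?thesis by blast
  qed
  ultimately show ?thesis by simp
qed

lemma has_sum_int_shift:
  fixes f :: "int \<Rightarrow> real"
  assumes "(f has_sum a) UNIV"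
  shows "((\<lambda>i. f (i + k)) has_sum a) UNIV"
proof -
  have "range (\<lambda>i. i + k) = UNIV" by (rule surj_plus_right)
  then show ?thesis
    using has_sum_reindex[of "\<lambda>i. i + k" UNIV f a] assms by (simp add: o_def)
qed

text \<open>The reciprocal of the odd integer with index \<open>i\<close>.\<close>
definition odd_inverse :: "int \<Rightarrow> real" where
  "odd_inverse i = 1 / (2 * real_of_int i + 1)"

lemma odd_nonzero: "2 * real_of_int i + 1 \<noteq> 0"
proof
  assume "2 * real_of_int i + 1 = 0"
  then have "real_of_int (2 * i + 1) = real_of_int 0" by simp
  then have "2 * i + 1 = 0" unfolding of_int_eq_iff .
  then show False by presburger
qed

lemma odd_squares_sums: "(\<lambda>n. 1 / (2 * real n + 1)\<^sup>2) sums (pi\<^sup>2 / 8)"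
proof -
  have all: "(\<lambda>n. 1 / (real n + 1)\<^sup>2) sums (pi\<^sup>2 / 6)"
    using inverse_squares_sums by (simp add: add.commute)
  \<comment> \<open>pair an odd square with the even square after it, and subtract a quarter of the whole series\<close>
  from sums_group[OF all, of 2]
  have "(\<lambda>n. 1 / (2 * real n + 1)\<^sup>2 + 1 / (2 * real n + 2)\<^sup>2) sums (pi\<^sup>2 / 6)"
    by (simp add: numeral_2_eq_2 algebra_simps)
  from sums_diff[OF this sums_mult[OF all, of "1 / 4"]]
  have "(\<lambda>n. 1 / (2 * real n + 1)\<^sup>2 + 1 / (2 * real n + 2)\<^sup>2 - 1 / 4 * (1 / (real n + 1)\<^sup>2))
      sums (pi\<^sup>2 / 6 - 1 / 4 * (pi\<^sup>2 / 6))" .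
  moreover have "1 / (2 * real n + 2)\<^sup>2 = 1 / 4 * (1 / (real n + 1)\<^sup>2)" for n
  proof -
    have "(2 * real n + 2)\<^sup>2 = 4 * (real n + 1)\<^sup>2" by (simp add: power2_eq_square algebra_simps)
    then show ?thesis by simp
  qed
  ultimately show ?thesis by simp
qed

lemma odd_squares_has_sum: "((\<lambda>i. (odd_inverse i)\<^sup>2) has_sum (pi\<^sup>2 / 4)) UNIV"
proof -
  have pos: "((\<lambda>n. 1 / (2 * real n + 1)\<^sup>2) has_sum (pi\<^sup>2 / 8)) UNIV"
    by (rule sums_nonneg_imp_has_sum[OF odd_squares_sums]) simp
  have "(odd_inverse (int n))\<^sup>2 = 1 / (2 * real n + 1)\<^sup>2" for n
    by (simp add: odd_inverse_def power_divide)
  moreover have "(odd_inverse (- int n - 1))\<^sup>2 = 1 / (2 * real n + 1)\<^sup>2" for n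
  proof -
    have "2 * real_of_int (- int n - 1) + 1 = - (2 * real n + 1)" by simp
    then show ?thesis by (simp only: odd_inverse_def power_divide power2_minus power_one)
  qed
  ultimately have "((\<lambda>i. (odd_inverse i)\<^sup>2) has_sum (pi\<^sup>2 / 8 + pi\<^sup>2 / 8)) UNIV"
    using pos by (intro has_sum_int) simp_all
  then show ?thesis by simp
qed

text \<open>The reciprocals of the odd integers tend to zero at both ends, and the sum telescopes on either
side; the first term for \<open>i \<ge> 0\<close> is negative because the reciprocals jump from \<open>- 1\<close> to \<open>1\<close>.\<close>
lemma odd_inverse_telescope: "((\<lambda>i. odd_inverse (i - 1) - odd_inverse i) has_sum 0) UNIV"
proof -
  let ?h = "\<lambda>n. 1 / (2 * real n + 1)" and ?g = "\<lambda>n. 1 / (2 * real n - 1)"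
  have "?h \<longlonglongrightarrow> 0" "?g \<longlonglongrightarrow> 0" by real_asymp+
  note sums = this[THEN telescope_sums']
  have h: "((\<lambda>n. ?h n - ?h (Suc n)) has_sum 1) UNIV"
    using sums(1) by (intro sums_nonneg_imp_has_sum) (simp_all add: frac_le)
  have "eventually (\<lambda>n. ?g n - ?g (Suc n) \<ge> 0) sequentially"
    unfolding eventually_sequentially by (rule exI[of _ 1]) (auto intro!: frac_le)
  then have g: "((\<lambda>n. ?g n - ?g (Suc n)) has_sum (- 1)) UNIV"
    using sums(2) by (intro sums_nonneg_imp_has_sum_strong) simp_all
  have "odd_inverse (- int n - 1 - 1) - odd_inverse (- int n - 1) = ?h n - ?h (Suc n)" for n
  proof -
    have "2 * real_of_int (- int n - 1 - 1) + 1 = - (2 * real (Suc n) + 1)"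
        "2 * real_of_int (- int n - 1) + 1 = - (2 * real n + 1)" by simp_all
    then show ?thesis by (simp only: odd_inverse_def divide_minus_right)
  qed
  moreover have "odd_inverse (int n - 1) - odd_inverse (int n) = ?g n - ?g (Suc n)" for n
    by (simp add: odd_inverse_def algebra_simps)
  ultimately have "((\<lambda>i. odd_inverse (i - 1) - odd_inverse i) has_sum (- 1 + 1)) UNIV"
    using g h by (intro has_sum_int) simp_all
  then show ?thesis by simp
qed

lemma odd_inverse_telescope': "((\<lambda>i. odd_inverse (i - int r) - odd_inverse i) has_sum 0) UNIV"
proof (induction r)
  case 0
  then show ?case by simp
next
  case (Suc r)
  from has_sum_add[OF has_sum_int_shift[OF odd_inverse_telescope, of "- int r"] Suc]
  show ?case by (simp add: algebra_simps)
qed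

text \<open>By partial fractions, the product of the reciprocals is a multiple of their difference.\<close>
lemma odd_inverse_mult_has_sum:
  assumes "r \<noteq> 0"
  shows "((\<lambda>i. odd_inverse i * odd_inverse (i - r)) has_sum 0) UNIV"
proof -
  have diff: "((\<lambda>i. odd_inverse (i - r) - odd_inverse i) has_sum 0) UNIV"
  proof (cases "r \<ge> 0")
    case True
    then show ?thesis using odd_inverse_telescope'[of "nat r"] by simp
  next
    case False
    have "((\<lambda>i. odd_inverse (i - r - int (nat (- r))) - odd_inverse (i - r)) has_sum 0) UNIV"
      using has_sum_int_shift[OF odd_inverse_telescope'[of "nat (- r)"], of "- r"] by simp
    then have "((\<lambda>i. odd_inverse i - odd_inverse (i - r)) has_sum 0) UNIV"
      using False by simp
    from has_sum_cmult_right[OF this, of "- 1"] show ?thesis by simp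
  qed
  have "odd_inverse i * odd_inverse (i - r)
      = 1 / (2 * real_of_int r) * (odd_inverse (i - r) - odd_inverse i)" for i
    using odd_nonzero[of i] odd_nonzero[of "i - r"] assms
    by (simp add: odd_inverse_def field_simps)
  then show ?thesis
    using has_sum_cmult_right[OF diff, of "1 / (2 * real_of_int r)"] by simp
qed

text \<open>The Fourier coefficients of the function of period \<open>2 \<pi>\<close> with the value \<open>1\<close> on \<open>(0, \<pi>)\<close> and \<open>- 1\<close> on \<open>(- \<pi>, 0)\<close>.\<close>
definition square_wave_coeff :: "int \<Rightarrow> complex" where
  "square_wave_coeff m = (if odd m then 2 / (\<i> * of_real pi * of_int m) else 0)"

lemma square_wave_coeff_uminus: "cnj (square_wave_coeff (- m)) = square_wave_coeff m"
  by (simp add: square_wave_coeff_def)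

text \<open>The square of the square wave is the constant function \<open>1\<close>.  The proof is by direct summation: a
product of two coefficients with an odd index sum vanishes; for an even index sum, partial
fractions give zero, except for \<open>j = 0\<close>, where the sum over the squares of the odd integers remains.\<close>
theorem square_wave_convolution:
  "((\<lambda>l. square_wave_coeff l * square_wave_coeff (j - l)) has_sum (if j = 0 then 1 else 0)) UNIV"
proof (cases "odd j")
  case True
  then have "square_wave_coeff l * square_wave_coeff (j - l) = 0" for l
    by (auto simp: square_wave_coeff_def)
  then show ?thesis using True by (auto intro: has_sum_0)
next
  case False
  then obtain r where r: "j = 2 * r" by (auto elim: evenE)
  have real: "((\<lambda>i. odd_inverse i * odd_inverse (i - r)) has_sum (if r = 0 then pi\<^sup>2 / 4 else 0)) UNIV"
    using odd_inverse_mult_has_sum[of r] odd_squares_has_sum by (auto simp: power2_eq_square)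
  from has_sum_cmult_right[OF has_sum_of_real[OF real, where 'a=complex], of "4 / (of_real pi)\<^sup>2"]
  have "((\<lambda>i. 4 / (of_real pi)\<^sup>2 * complex_of_real (odd_inverse i * odd_inverse (i - r)))
      has_sum (if j = 0 then 1 else 0)) UNIV"
    by (auto simp: r)
  moreover have "4 / (of_real pi)\<^sup>2 * complex_of_real (odd_inverse i * odd_inverse (i - r))
      = square_wave_coeff (2 * i + 1) * square_wave_coeff (j - (2 * i + 1))" for i
  proof -
    have odd: "odd (2 * i + 1)" "odd (j - (2 * i + 1))" by (auto simp: r)
    define y z where "y = complex_of_real (2 * real_of_int i + 1)"
      and "z = complex_of_real (2 * real_of_int (i - r) + 1)"
    have "of_int (2 * i + 1) = y" "of_int (j - (2 * i + 1)) = - z"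
      by (simp_all add: y_def z_def r)
    then have "square_wave_coeff (2 * i + 1) * square_wave_coeff (j - (2 * i + 1))
        = 2 / (\<i> * of_real pi * y) * (2 / (\<i> * of_real pi * (- z)))"
      using odd by (simp only: square_wave_coeff_def if_True not_False_eq_True)
    also have "\<dots> = 4 / (of_real pi)\<^sup>2 * (1 / y * (1 / z))"
      by (simp add: power2_eq_square mult_ac)
    finally show ?thesis
      by (simp add: odd_inverse_def y_def z_def)
  qed
  ultimately have "((\<lambda>l. square_wave_coeff l * square_wave_coeff (j - l)) has_sum (if j = 0 then 1 else 0))
      (range (\<lambda>i. 2 * i + 1))"
    by (subst has_sum_reindex) (auto simp: o_def inj_on_def)
  moreover have "l \<in> range (\<lambda>i. 2 * i + 1)" if "odd l" for l :: int
    using that by (auto elim: oddE)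
  then have "square_wave_coeff l = 0" if "l \<notin> range (\<lambda>i. 2 * i + 1)" for l
    using that by (auto simp: square_wave_coeff_def)
  ultimately show ?thesis
    by (subst has_sum_cong_neutral[where T="range (\<lambda>i. 2 * i + 1)"
          and g="\<lambda>l. square_wave_coeff l * square_wave_coeff (j - l)"]) auto
qed

section \<open>Nontrivial stabilizer\<close>

text \<open>If \<open>c\<close> is a normalised element whose degree stabilizes \<open>\<omega>\<close>, its adjoint is its inverse modulo the
kernel of the form, so these elements play the role of the integer powers of \<open>c\<close>.\<close>
definition star_power :: "'a::complex_star_algebra \<Rightarrow> int \<Rightarrow> 'a" where
  "star_power c m = (if m \<ge> 0 then c ^ nat m else (c\<^sup>\<star>) ^ nat (- m))"

lemma adj_power: "(c ^ n)\<^sup>\<star> = (c\<^sup>\<star>) ^ n" for c :: "'a::complex_star_algebra"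
  by (induction n) (simp_all add: adj_mult power_commutes)

lemma star_power_zero [simp]: "star_power c 0 = 1"
  by (simp add: star_power_def)

lemma star_power_int: "star_power c (int n) = c ^ n"
  by (simp add: star_power_def)

lemma star_power_uminus_int: "star_power c (- int n) = (c\<^sup>\<star>) ^ n"
  by (simp add: star_power_def)

lemma star_power_adj: "star_power (c\<^sup>\<star>) m = star_power c (- m)"
  by (cases "m = 0") (auto simp: star_power_def adj_adj)

lemma adj_star_power: "(star_power c m)\<^sup>\<star> = star_power c (- m)"
  by (cases "m = 0") (auto simp: star_power_def adj_adj adj_power)

context positive_character
begin

text \<open>\<open>c\<close> is a normalised element of degree \<open>k\<close> that witnesses that \<open>k\<close> stabilizes \<open>\<omega>\<close>.\<close>
definition stabilizing :: "'g \<Rightarrow> 'a \<Rightarrow> bool" where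
  "stabilizing k c \<longleftrightarrow> k \<in> carrier G \<and> c \<in> A k \<and> \<omega> (c\<^sup>\<star> * c) = 1 \<and>
    (\<forall>b\<in>A \<one>. \<omega> (c\<^sup>\<star> * b * c) = \<omega> b)"

text \<open>For such \<open>u\<close>, right multiplication by \<open>u\<close> is well defined on the classes \<open>v a\<close>, and its adjoint
is right multiplication by \<open>u\<^sup>\<star>\<close>.\<close>
definition central_mod_kernel :: "'a \<Rightarrow> bool" where
  "central_mod_kernel u \<longleftrightarrow> (\<forall>d. \<Phi> (d * u) = \<Phi> (u * d))"

lemma mem_adj_mult: "k \<in> carrier G \<Longrightarrow> c \<in> A k \<Longrightarrow> d \<in> A k \<Longrightarrow> c * d\<^sup>\<star> \<in> A \<one>"
  using mult_mem[of k "inv k" c "d\<^sup>\<star>"] by (simp add: adj_mem)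

text \<open>The symmetry under \<open>c \<mapsto> c\<^sup>\<star>\<close> replaces separate arguments for negative powers.\<close>
lemma stabilizing_adj:
  assumes "stabilizing k c" shows "stabilizing (inv k) (c\<^sup>\<star>)"
proof -
  have k: "k \<in> carrier G" and c: "c \<in> A k" "\<omega> (c\<^sup>\<star> * c) = 1"
    and inv: "\<And>b. b \<in> A \<one> \<Longrightarrow> \<omega> (c\<^sup>\<star> * b * c) = \<omega> b"
    using assms by (auto simp: stabilizing_def)
  note cc = homogeneous_square_mem[OF k c(1) c(1)]
  have "\<omega> (c * b * c\<^sup>\<star>) = \<omega> b" if b: "b \<in> A \<one>" for b
  proof -
    have "c * b \<in> A k" using mult_mem[OF k one_closed c(1) b] k by simp
    then have "c * b * c\<^sup>\<star> \<in> A \<one>" by (rule mem_adj_mult[OF k _ c(1)])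
    then have "\<omega> (c * b * c\<^sup>\<star>) = \<omega> (c\<^sup>\<star> * (c * b * c\<^sup>\<star>) * c)" by (simp only: inv)
    also have "\<dots> = \<omega> ((c\<^sup>\<star> * c) * (b * (c\<^sup>\<star> * c)))" by (simp only: mult.assoc)
    also have "\<dots> = \<omega> b"
      using cc b mult_mem[OF one_closed one_closed b cc] by (simp add: \<omega>_mult c(2))
    finally show ?thesis .
  qed
  moreover from this[OF one_mem] have "\<omega> (c * c\<^sup>\<star>) = 1" by simp
  ultimately show ?thesis
    using k c by (simp add: stabilizing_def adj_mem adj_adj)
qed

text \<open>Only elements \<open>d\<close> of degree \<open>inv k\<close> matter, and for them \<open>\<omega> (c d) = \<omega> (c\<^sup>\<star> (c d) c) =
\<omega> (c\<^sup>\<star> c) \<omega> (d c)\<close> by invariance.\<close>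
lemma central_stabilizing:
  assumes "stabilizing k c" shows "central_mod_kernel c"
  unfolding central_mod_kernel_def
proof
  have k: "k \<in> carrier G" and c: "c \<in> A k" "\<omega> (c\<^sup>\<star> * c) = 1"
    and inv: "\<And>b. b \<in> A \<one> \<Longrightarrow> \<omega> (c\<^sup>\<star> * b * c) = \<omega> b"
    using assms by (auto simp: stabilizing_def)
  fix d show "\<Phi> (d * c) = \<Phi> (c * d)"
  proof (induction d rule: homogeneous_induct)
    case (homogeneous h d)
    have dc: "d * c \<in> A (h \<otimes> k)" and cd: "c * d \<in> A (k \<otimes> h)"
      using homogeneous k c(1) by (auto intro: mult_mem)
    have iff: "h \<otimes> k = \<one> \<longleftrightarrow> k \<otimes> h = \<one>"
      using homogeneous(1) k inv_comm by blast
    show ?case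
    proof (cases "h \<otimes> k = \<one>")
      case True
      then have mem: "d * c \<in> A \<one>" "c * d \<in> A \<one>" using dc cd iff by auto
      have "\<omega> (c * d) = \<omega> (c\<^sup>\<star> * (c * d) * c)" using mem by (simp only: inv)
      also have "\<dots> = \<omega> ((c\<^sup>\<star> * c) * (d * c))" by (simp only: mult.assoc)
      also have "\<dots> = \<omega> (d * c)"
        using mem homogeneous_square_mem[OF k c(1) c(1)] by (simp add: \<omega>_mult c(2))
      finally show ?thesis
        using \<Phi>_homogeneous[OF one_closed mem(1)] \<Phi>_homogeneous[OF one_closed mem(2)] by simp
    next
      case False
      then show ?thesis
        using \<Phi>_homogeneous[OF _ dc] \<Phi>_homogeneous[OF _ cd] homogeneous(1) k iff by simp
    qed
  qed (simp add: distrib_left distrib_right \<Phi>_add)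
qed

lemma central_one [simp]: "central_mod_kernel 1"
  and central_add: "central_mod_kernel u \<Longrightarrow> central_mod_kernel w \<Longrightarrow> central_mod_kernel (u + w)"
  and central_scaleC: "central_mod_kernel u \<Longrightarrow> central_mod_kernel (t *\<^sub>C u)"
  and central_zero [simp]: "central_mod_kernel 0"
  by (simp_all add: central_mod_kernel_def distrib_left distrib_right \<Phi>_add \<Phi>_scaleC
      mult_scaleC_left mult_scaleC_right)

lemma central_mult:
  assumes "central_mod_kernel u" "central_mod_kernel w" shows "central_mod_kernel (u * w)"
  unfolding central_mod_kernel_def
proof
  fix d
  have "\<Phi> (d * (u * w)) = \<Phi> (w * (d * u))"
    using assms(2) by (simp add: central_mod_kernel_def flip: mult.assoc)
  also have "\<dots> = \<Phi> (u * (w * d))"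
    using assms(1) by (simp add: central_mod_kernel_def flip: mult.assoc)
  also have "\<dots> = \<Phi> (u * w * d)" by (simp add: mult.assoc)
  finally show "\<Phi> (d * (u * w)) = \<Phi> (u * w * d)" .
qed

lemma central_power: "central_mod_kernel u \<Longrightarrow> central_mod_kernel (u ^ n)"
  by (induction n) (simp_all add: central_mult)

lemma central_sum: "(\<And>i. i \<in> I \<Longrightarrow> central_mod_kernel (f i)) \<Longrightarrow> central_mod_kernel (sum f I)"
  by (induction I rule: infinite_finite_induct) (simp_all add: central_add)

lemma central_star_power:
  assumes "stabilizing k c" shows "central_mod_kernel (star_power c m)"
  using central_stabilizing[OF assms] central_stabilizing[OF stabilizing_adj[OF assms]]
  by (simp add: star_power_def central_power)

text \<open>Centrality of \<open>w\<close> moves the factor \<open>c\<^sup>\<star> c\<close> to the right end, where it acts as the scalar \<open>1\<close>.\<close>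
lemma \<Phi>_cancel:
  assumes "stabilizing k c" "central_mod_kernel w"
  shows "\<Phi> (d * (c\<^sup>\<star> * (c * w))) = \<Phi> (d * w)"
proof -
  have mem: "c\<^sup>\<star> * c \<in> A \<one>" "\<omega> (c\<^sup>\<star> * c) = 1"
    using assms(1) homogeneous_square_mem by (auto simp: stabilizing_def)
  have "\<Phi> (d * (c\<^sup>\<star> * (c * w))) = \<Phi> ((d * (c\<^sup>\<star> * c)) * w)" by (simp only: mult.assoc)
  also have "\<dots> = \<Phi> (w * (d * (c\<^sup>\<star> * c)))"
    using assms(2) by (simp only: central_mod_kernel_def)
  also have "\<dots> = \<Phi> (w * d * (c\<^sup>\<star> * c))" by (simp only: mult.assoc)
  also have "\<dots> = \<Phi> (w * d)" by (simp add: \<Phi>_mult_unit_right mem)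
  also have "\<dots> = \<Phi> (d * w)"
    using assms(2) by (simp only: central_mod_kernel_def)
  finally show ?thesis .
qed

lemma \<Phi>_mult_star_power:
  assumes "stabilizing k c"
  shows "\<Phi> (d * (c * star_power c m)) = \<Phi> (d * star_power c (m + 1))"
proof (cases "m \<ge> 0")
  case True
  then have "c * star_power c m = star_power c (m + 1)"
    by (simp add: star_power_def nat_add_distrib)
  then show ?thesis by simp
next
  case False
  define n where "n = nat (- m - 1)"
  have m: "m = - int (Suc n)" "m + 1 = - int n" using False by (simp_all add: n_def)
  have "central_mod_kernel ((c\<^sup>\<star>) ^ n)"
    by (rule central_power[OF central_stabilizing[OF stabilizing_adj[OF assms]]])
  from \<Phi>_cancel[OF stabilizing_adj[OF assms] this, of d]
  show ?thesis
    unfolding m(2) unfolding m(1) star_power_uminus_int by (simp add: adj_adj)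
qed

lemma \<Phi>_power_star_power:
  assumes "stabilizing k c"
  shows "\<Phi> (d * (c ^ n * star_power c m)) = \<Phi> (d * star_power c (int n + m))"
proof (induction n arbitrary: m)
  case (Suc n)
  have "\<Phi> (d * (c ^ Suc n * star_power c m)) = \<Phi> (d * c ^ n * (c * star_power c m))"
    by (simp only: power_Suc2 mult.assoc)
  also have "\<dots> = \<Phi> (d * (c ^ n * star_power c (m + 1)))"
    unfolding \<Phi>_mult_star_power[OF assms] by (simp only: mult.assoc)
  also have "\<dots> = \<Phi> (d * star_power c (int (Suc n) + m))"
    unfolding Suc by (simp add: algebra_simps)
  finally show ?case .
qed simp

lemma \<Phi>_star_power_mult:
  assumes "stabilizing k c"
  shows "\<Phi> (d * (star_power c l * star_power c m)) = \<Phi> (d * star_power c (l + m))"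
proof (cases "l \<ge> 0")
  case True
  then show ?thesis
    using \<Phi>_power_star_power[OF assms, of d "nat l" m] by (simp add: star_power_def[of c l])
next
  case False
  then show ?thesis
    using \<Phi>_power_star_power[OF stabilizing_adj[OF assms], of d "nat (- l)" "- m"]
    by (simp add: star_power_adj star_power_def[of c l] algebra_simps)
qed

lemma star_power_mem:
  assumes "stabilizing k c" shows "star_power c m \<in> A (k [^] m)"
proof -
  have pow: "u ^ n \<in> A (h [^] n)" if "h \<in> carrier G" "u \<in> A h" for u h and n :: nat
  proof (induction n)
    case (Suc n)
    then have "u ^ n * u \<in> A (h [^] n \<otimes> h)" using that by (intro mult_mem) auto
    then show ?case by (simp add: power_commutes)
  qed simp
  have k: "k \<in> carrier G" and c: "c \<in> A k" using assms by (auto simp: stabilizing_def)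
  show ?thesis
  proof (cases m rule: int_cases2)
    case (nonneg n)
    then show ?thesis using pow[OF k c, of n] by (simp add: star_power_int int_pow_int)
  next
    case (nonpos n)
    then show ?thesis
      using pow[OF inv_closed[OF k] adj_mem[OF k c], of n] nat_pow_inv[OF k, of n] int_pow_neg_int[OF k, of n]
      by (simp add: star_power_uminus_int)
  qed
qed

lemma \<Phi>_star_power:
  assumes "stabilizing k c" "k [^] m \<noteq> \<one>" shows "\<Phi> (star_power c m) = 0"
proof -
  have "k [^] m \<in> carrier G" using assms(1) by (simp add: stabilizing_def)
  from \<Phi>_homogeneous[OF this star_power_mem[OF assms(1)]] show ?thesis using assms(2) by simp
qed

lemma \<Phi>_mult_star_power_eq_0:
  assumes "stabilizing k c" "g \<in> carrier G" "d \<in> A g" "g \<otimes> k [^] m \<noteq> \<one>"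
  shows "\<Phi> (d * star_power c m) = 0"
proof -
  have k: "k \<in> carrier G" using assms(1) by (simp add: stabilizing_def)
  have "d * star_power c m \<in> A (g \<otimes> k [^] m)"
    using assms k by (intro mult_mem star_power_mem) auto
  then show ?thesis
    using \<Phi>_homogeneous[of "g \<otimes> k [^] m"] assms k by simp
qed

subsection \<open>Stabilizing elements of finite order\<close>

text \<open>With \<open>P = \<Sum>j<n. c ^ j\<close>, the class of \<open>P / n\<close> is that of a projection, and \<open>(2 / n) P - 1\<close> is the
corresponding reflection; the sequence of the approximate reflection is constant.  The coefficient
of \<open>c\<close> in it is \<open>2 / n\<close>, so it is not scalar.\<close>
lemma not_irreducible_finite_order:
  assumes st: "stabilizing k c" and n: "n > 1" "k [^] n = \<one>"
    and min: "\<And>j::nat. 0 < j \<Longrightarrow> j < n \<Longrightarrow> k [^] j \<noteq> \<one>"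
    and unit: "\<omega> (c ^ n) = 1"
  shows "\<not> irreducible_rep (induced_rep G A \<omega>)"
proof -
  have k: "k \<in> carrier G" using st by (simp add: stabilizing_def)
  have mem: "c ^ n \<in> A \<one>"
    using star_power_mem[OF st, of "int n"] n k by (simp add: star_power_int int_pow_int)
  have \<Phi>n: "\<Phi> (d * c ^ n) = \<Phi> d" for d
    using \<Phi>_mult_unit_right[OF mem, of d] by (simp add: unit)
  define P where "P = (\<Sum>j<n. c ^ j)"
  have central_P: "central_mod_kernel P"
    unfolding P_def by (intro central_sum central_power central_stabilizing[OF st])
  have cP: "\<Phi> (d * (c * P)) = \<Phi> (d * P)" for d
  proof -
    have "c * P + 1 = P + c ^ n"
    proof -
      have "c * P = (\<Sum>j<n. c ^ Suc j)" by (simp add: P_def sum_distrib_left)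
      then have "c * P + 1 = (\<Sum>j<Suc n. c ^ j)"
        by (simp add: sum.lessThan_Suc_shift del: sum.lessThan_Suc)
      then show ?thesis by (simp add: P_def)
    qed
    then have "\<Phi> (d * (c * P + 1)) = \<Phi> (d * (P + c ^ n))" by simp
    then show ?thesis by (simp add: distrib_left \<Phi>_add \<Phi>n)
  qed
  have cjP: "\<Phi> (d * (c ^ j * P)) = \<Phi> (d * P)" for d j
  proof (induction j)
    case (Suc j)
    have "\<Phi> (d * (c ^ Suc j * P)) = \<Phi> ((d * c ^ j) * (c * P))"
      by (simp only: power_Suc2 mult.assoc)
    then show ?case using Suc unfolding cP by (simp add: mult.assoc)
  qed simp
  have PP: "\<Phi> (d * (P * P)) = of_nat n * \<Phi> (d * P)" for d
  proof -
    have "\<Phi> (d * (P * P)) = (\<Sum>j<n. \<Phi> (d * (c ^ j * P)))"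
      by (subst (1) P_def) (simp add: sum_distrib_left sum_distrib_right \<Phi>_sum)
    then show ?thesis by (simp add: cjP)
  qed
  have adj_cj: "\<Phi> (d * (c ^ j)\<^sup>\<star>) = \<Phi> (d * c ^ (n - j))" if "j < n" for d j
  proof -
    have "\<Phi> (d * (c ^ j)\<^sup>\<star>) = \<Phi> (d * star_power c (- int j) * c ^ n)"
      by (simp add: \<Phi>n adj_power star_power_uminus_int)
    also have "\<dots> = \<Phi> (d * (star_power c (- int j) * star_power c (int n)))"
      by (simp add: mult.assoc star_power_int)
    also have "\<dots> = \<Phi> (d * star_power c (int (n - j)))"
      unfolding \<Phi>_star_power_mult[OF st] using that by (simp add: of_nat_diff)
    finally show ?thesis by (simp add: star_power_int)
  qed
  have adj_P: "\<Phi> (d * P\<^sup>\<star>) = \<Phi> (d * P)" for d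
  proof -
    have "\<Phi> (d * P\<^sup>\<star>) = (\<Sum>j<n. \<Phi> (d * (c ^ j)\<^sup>\<star>))"
      by (simp add: P_def adj_sum sum_distrib_left \<Phi>_sum)
    also have "\<dots> = (\<Sum>j<n. \<Phi> (d * c ^ (n - j)))"
      by (intro sum.cong refl adj_cj) simp
    also have "\<dots> = (\<Sum>j<n. \<Phi> (d * c ^ Suc (n - Suc j)))"
      by (intro sum.cong refl) (simp add: Suc_diff_Suc)
    also have "\<dots> = (\<Sum>j<n. \<Phi> (d * c ^ Suc j))"
      by (rule sum.nat_diff_reindex)
    also have "\<dots> = \<Phi> (d * (c * P))"
      by (simp add: P_def sum_distrib_left \<Phi>_sum)
    finally show ?thesis by (simp add: cP)
  qed
  define t where "t = 2 / (of_nat n :: complex)"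
  have tn: "t * of_nat n = 2" "cnj t = t" "t \<noteq> 0" using n by (simp_all add: t_def)
  define y where "y = t *\<^sub>C P - 1"
  have y: "\<Phi> (d * y) = t * \<Phi> (d * P) - \<Phi> d" for d
    by (simp add: y_def right_diff_distrib \<Phi>_diff mult_scaleC_right \<Phi>_scaleC)
  interpret approximate_reflection G A \<omega> "\<lambda>_. y"
  proof unfold_locales
    show "\<Phi> (d * y) = \<Phi> (y * d)" for d
      using central_P unfolding central_mod_kernel_def y_def
      by (simp add: left_diff_distrib right_diff_distrib \<Phi>_diff mult_scaleC_left mult_scaleC_right \<Phi>_scaleC)
    show "\<Phi> (d * y\<^sup>\<star>) = \<Phi> (d * y)" for d
      unfolding y by (simp add: y_def adj_diff adj_scaleC tn right_diff_distrib \<Phi>_diff mult_scaleC_right \<Phi>_scaleC adj_P)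
    fix d and \<epsilon> :: real assume "\<epsilon> > 0"
    have "\<Phi> (d * y * y) = t * \<Phi> (d * y * P) - \<Phi> (d * y)" by (rule y)
    also have "d * y * P = t *\<^sub>C (d * (P * P)) - d * P"
      by (simp add: y_def left_diff_distrib right_diff_distrib mult_scaleC_left mult_scaleC_right mult.assoc)
    also have "t * \<Phi> (t *\<^sub>C (d * (P * P)) - d * P) - \<Phi> (d * y)
        = (t * of_nat n) * (t * \<Phi> (d * P)) - 2 * (t * \<Phi> (d * P)) + \<Phi> d"
      by (simp add: \<Phi>_diff \<Phi>_scaleC PP y algebra_simps)
    also have "\<dots> = \<Phi> d" by (simp add: tn)
    finally show "\<exists>N::nat. \<forall>m\<ge>N. \<forall>n\<ge>N. cmod (\<Phi> (d * y * y) - \<Phi> d) < \<epsilon>"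
      using \<open>\<epsilon> > 0\<close> by simp
  qed
  have c0: "\<Phi> (c\<^sup>\<star> * c ^ j) = (if j = 1 then 1 else 0)" if "j < n" for j
  proof -
    have "\<Phi> (c\<^sup>\<star> * c ^ j) = \<Phi> (1 * (star_power c (- int 1) * star_power c (int j)))"
      unfolding star_power_int star_power_uminus_int by simp
    also have "\<dots> = \<Phi> (star_power c (int j - 1))"
      unfolding \<Phi>_star_power_mult[OF st] by simp
    also have "\<dots> = (if j = 1 then 1 else 0)"
    proof -
      have "k [^] (int j - 1) \<noteq> \<one>" if "j \<noteq> 1"
      proof (cases "j = 0")
        case True
        then show ?thesis using min[of 1] n k by (simp add: int_pow_neg)
      next
        case False
        then have "int j - 1 = int (j - 1)" by (simp add: of_nat_diff)
        then have "k [^] (int j - 1) = k [^] (j - 1)" by (simp only: int_pow_int)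
        moreover have "k [^] (j - 1) \<noteq> \<one>"
          using False \<open>j \<noteq> 1\<close> \<open>j < n\<close> by (intro min) simp_all
        ultimately show ?thesis by simp
      qed
      then show ?thesis using \<Phi>_star_power[OF st] by (auto simp: \<Phi>_homogeneous[OF one_closed one_mem])
    qed
    finally show ?thesis .
  qed
  have "\<Phi> (c\<^sup>\<star>) = 0"
    using c0[of 0] n by simp
  moreover have "\<Phi> (c\<^sup>\<star> * y) = t"
  proof -
    have "\<Phi> (c\<^sup>\<star> * P) = (\<Sum>j<n. \<Phi> (c\<^sup>\<star> * c ^ j))" by (simp add: P_def sum_distrib_left \<Phi>_sum)
    also have "\<dots> = (\<Sum>j<n. if j = 1 then 1 else 0)" by (intro sum.cong refl c0) simp
    also have "\<dots> = 1" using n by simp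
    finally show ?thesis using \<open>\<Phi> (c\<^sup>\<star>) = 0\<close> by (simp add: y)
  qed
  ultimately show ?thesis
    using tn(3) by (intro not_irreducible_if_not_scalar[of "c\<^sup>\<star>"]) (simp_all add: LIMSEQ_const_iff)
qed

subsection \<open>Stabilizing elements of infinite order\<close>

text \<open>The index sets of the truncated convolution exhaust the integers as both truncations grow, so
unconditional summability of the convolution yields the joint limit.\<close>
lemma filterlim_truncated_convolution:
  "filterlim (\<lambda>(M, N). {- int M..int M} \<inter> {l. j - l \<in> {- int N..int N}})
    (finite_subsets_at_top UNIV) (sequentially \<times>\<^sub>F sequentially)"
  unfolding filterlim_finite_subsets_at_top
proof (intro allI impI)
  fix X :: "int set" assume "finite X \<and> X \<subseteq> UNIV"
  then have X: "finite X" by simp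
  define L where "L = (\<Sum>l\<in>X. nat \<bar>l\<bar> + nat \<bar>j - l\<bar>)"
  have L: "nat \<bar>l\<bar> + nat \<bar>j - l\<bar> \<le> L" if "l \<in> X" for l
    unfolding L_def by (rule member_le_sum[OF that]) (use X in auto)
  show "\<forall>\<^sub>F p in sequentially \<times>\<^sub>F sequentially.
      finite (case p of (M, N) \<Rightarrow> {- int M..int M} \<inter> {l. j - l \<in> {- int N..int N}}) \<and>
      X \<subseteq> (case p of (M, N) \<Rightarrow> {- int M..int M} \<inter> {l. j - l \<in> {- int N..int N}}) \<and>
      (case p of (M, N) \<Rightarrow> {- int M..int M} \<inter> {l. j - l \<in> {- int N..int N}}) \<subseteq> UNIV"
    unfolding eventually_prod_sequentially
  proof (intro exI[of _ L] allI impI)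
    fix M N assume "L \<le> M" "L \<le> N"
    then have "l \<in> {- int N..int N} \<and> j - l \<in> {- int M..int M}" if "l \<in> X" for l
      using L[OF that] by auto
    then show "finite (case (N, M) of (M, N) \<Rightarrow> {- int M..int M} \<inter> {l. j - l \<in> {- int N..int N}}) \<and>
      X \<subseteq> (case (N, M) of (M, N) \<Rightarrow> {- int M..int M} \<inter> {l. j - l \<in> {- int N..int N}}) \<and>
      (case (N, M) of (M, N) \<Rightarrow> {- int M..int M} \<inter> {l. j - l \<in> {- int N..int N}}) \<subseteq> UNIV"
      by auto
  qed
qed

text \<open>Here the powers of \<open>c\<close> have different degrees, so a homogeneous \<open>d\<close> sees at most one coefficient
of the product of two truncated square waves; it converges to the corresponding coefficient of the
convolution.\<close>
lemma not_irreducible_infinite_order: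
  assumes st: "stabilizing k c" and inf: "\<And>m::int. k [^] m = \<one> \<Longrightarrow> m = 0"
  shows "\<not> irreducible_rep (induced_rep G A \<omega>)"
proof -
  have k: "k \<in> carrier G" using st by (simp add: stabilizing_def)
  define \<beta> where "\<beta> = square_wave_coeff"
  define y where "y N = (\<Sum>m\<in>{- int N..int N}. \<beta> m *\<^sub>C star_power c m)" for N
  have y: "\<Phi> (d * y N) = (\<Sum>m\<in>{- int N..int N}. \<beta> m * \<Phi> (d * star_power c m))" for d N
    by (simp add: y_def sum_distrib_left \<Phi>_sum mult_scaleC_right \<Phi>_scaleC)
  have adj_y: "(y N)\<^sup>\<star> = y N" for N
  proof -
    have "(y N)\<^sup>\<star> = (\<Sum>m\<in>{- int N..int N}. cnj (\<beta> m) *\<^sub>C star_power c (- m))"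
      by (simp add: y_def adj_sum adj_scaleC adj_star_power)
    also have "\<dots> = (\<Sum>m\<in>{- int N..int N}. cnj (\<beta> (- m)) *\<^sub>C star_power c m)"
      by (rule sum.reindex_bij_witness[of _ uminus uminus]) auto
    finally show ?thesis by (simp add: y_def \<beta>_def square_wave_coeff_uminus)
  qed
  have lim: "((\<lambda>(M, N). \<Phi> (d * y M * y N)) \<longlongrightarrow> \<Phi> d) (sequentially \<times>\<^sub>F sequentially)" for d
  proof (induction d rule: homogeneous_induct)
    case (add d e)
    from tendsto_add[OF this] show ?case
      by (simp add: distrib_right \<Phi>_add case_prod_unfold)
  next
    case (homogeneous g d)
    define h where "h j = \<Phi> (d * star_power c j)" for j
    have eq: "\<Phi> (d * y M * y N)
        = (\<Sum>l\<in>{- int M..int M}. \<Sum>m\<in>{- int N..int N}. \<beta> l * \<beta> m * h (l + m))" for M N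
    proof -
      have "\<Phi> (d * y M * y N) = (\<Sum>m\<in>{- int N..int N}. \<beta> m * \<Phi> (d * y M * star_power c m))"
        by (rule y)
      also have "\<dots> = (\<Sum>m\<in>{- int N..int N}. \<beta> m * (\<Sum>l\<in>{- int M..int M}. \<beta> l * h (l + m)))"
      proof (intro sum.cong refl arg_cong2[where f="(*)"])
        fix m
        have "d * y M * star_power c m
            = (\<Sum>l\<in>{- int M..int M}. \<beta> l *\<^sub>C (d * (star_power c l * star_power c m)))"
          by (simp add: y_def sum_distrib_left sum_distrib_right mult_scaleC_left mult_scaleC_right mult.assoc)
        then show "\<Phi> (d * y M * star_power c m) = (\<Sum>l\<in>{- int M..int M}. \<beta> l * h (l + m))"
          by (simp add: \<Phi>_sum \<Phi>_scaleC \<Phi>_star_power_mult[OF st] h_def)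
      qed
      also have "\<dots> = (\<Sum>m\<in>{- int N..int N}. \<Sum>l\<in>{- int M..int M}. \<beta> l * \<beta> m * h (l + m))"
        by (simp add: sum_distrib_left mult_ac)
      also have "\<dots> = (\<Sum>l\<in>{- int M..int M}. \<Sum>m\<in>{- int N..int N}. \<beta> l * \<beta> m * h (l + m))"
        by (rule sum.swap)
      finally show ?thesis .
    qed
    have d: "\<Phi> d = h 0" by (simp add: h_def)
    show ?case
    proof (cases "\<exists>j. h j \<noteq> 0")
      case False
      then show ?thesis by (simp add: eq d)
    next
      case True
      then obtain j where j: "h j \<noteq> 0" by blast
      have zero: "h m = 0" if "m \<noteq> j" for m
      proof (rule ccontr)
        assume "h m \<noteq> 0"
        then have "g \<otimes> k [^] m = \<one>" "g \<otimes> k [^] j = \<one>"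
          using j \<Phi>_mult_star_power_eq_0[OF st homogeneous] by (auto simp: h_def)
        then have "inv (k [^] m) = inv (k [^] j)"
          using inv_equality[of g "k [^] m"] inv_equality[of g "k [^] j"] homogeneous(1) k by simp
        then have "k [^] m = k [^] j" using k by (metis int_pow_closed inv_inv)
        then have "k [^] (m - j) = \<one>"
          using k by (simp add: int_pow_diff)
        then show False using inf[of "m - j"] that by simp
      qed
      have inner: "(\<Sum>m\<in>{- int N..int N}. \<beta> l * \<beta> m * h (l + m))
          = (if j - l \<in> {- int N..int N} then \<beta> l * \<beta> (j - l) * h j else 0)" for l N
      proof -
        have "(\<Sum>m\<in>{- int N..int N}. \<beta> l * \<beta> m * h (l + m))
            = (\<Sum>m\<in>{- int N..int N}. if m = j - l then \<beta> l * \<beta> (j - l) * h j else 0)"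
          by (intro sum.cong refl) (auto simp: zero)
        then show ?thesis by simp
      qed
      have "(\<lambda>(M, N). \<Phi> (d * y M * y N)) = (\<lambda>p. sum (\<lambda>l. \<beta> l * \<beta> (j - l))
          (case p of (M, N) \<Rightarrow> {- int M..int M} \<inter> {l. j - l \<in> {- int N..int N}}) * h j)"
        unfolding eq inner by (auto simp: fun_eq_iff sum_distrib_right sum.inter_restrict)
      moreover have "((\<lambda>p. sum (\<lambda>l. \<beta> l * \<beta> (j - l))
          (case p of (M, N) \<Rightarrow> {- int M..int M} \<inter> {l. j - l \<in> {- int N..int N}}) * h j)
          \<longlongrightarrow> (if j = 0 then 1 else 0) * h j) (sequentially \<times>\<^sub>F sequentially)"
        by (intro tendsto_mult_right filterlim_compose[OF _ filterlim_truncated_convolution]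
            square_wave_convolution[unfolded has_sum_def, folded \<beta>_def])
      moreover have "(if j = 0 then 1 else 0) * h j = \<Phi> d"
        using zero[of 0] by (auto simp: d)
      ultimately show ?thesis by simp
    qed
  qed
  interpret approximate_reflection G A \<omega> y
  proof unfold_locales
    have "central_mod_kernel (y n)" for n
      unfolding y_def by (intro central_sum central_scaleC central_star_power[OF st])
    then show "\<Phi> (d * y n) = \<Phi> (y n * d)" for d n
      by (simp add: central_mod_kernel_def)
    show "\<Phi> (d * (y n)\<^sup>\<star>) = \<Phi> (d * y n)" for d n
      by (simp add: adj_y)
    fix d and \<epsilon> :: real assume "\<epsilon> > 0"
    from tendstoD[OF lim this, of d]
    show "\<exists>N. \<forall>m\<ge>N. \<forall>n\<ge>N. cmod (\<Phi> (d * y m * y n) - \<Phi> d) < \<epsilon>"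
      unfolding eventually_prod_sequentially by (auto simp: dist_norm)
  qed
  have c0: "\<Phi> (c\<^sup>\<star> * star_power c m) = (if m = 1 then 1 else 0)" for m
  proof -
    have "\<Phi> (c\<^sup>\<star> * star_power c m) = \<Phi> (1 * (star_power c (- int 1) * star_power c m))"
      unfolding star_power_uminus_int by simp
    also have "\<dots> = \<Phi> (star_power c (m - 1))"
      unfolding \<Phi>_star_power_mult[OF st] by simp
    also have "\<dots> = (if m = 1 then 1 else 0)"
      using \<Phi>_star_power[OF st, of "m - 1"] inf[of "m - 1"]
      by (auto simp: \<Phi>_homogeneous[OF one_closed one_mem])
    finally show ?thesis .
  qed
  have "\<Phi> (c\<^sup>\<star>) = 0"
    using c0[of 0] by simp
  moreover have "\<not> (\<lambda>n. \<Phi> (c\<^sup>\<star> * y n)) \<longlonglongrightarrow> 0"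
  proof
    assume "(\<lambda>n. \<Phi> (c\<^sup>\<star> * y n)) \<longlonglongrightarrow> 0"
    moreover have "eventually (\<lambda>n. \<Phi> (c\<^sup>\<star> * y n) = \<beta> 1) sequentially"
      unfolding eventually_sequentially
    proof (intro exI[of _ 1] allI impI)
      fix n :: nat assume n: "1 \<le> n"
      have "\<Phi> (c\<^sup>\<star> * y n) = (\<Sum>m\<in>{- int n..int n}. if m = 1 then \<beta> 1 else 0)"
        unfolding y c0 by (intro sum.cong refl) auto
      then show "\<Phi> (c\<^sup>\<star> * y n) = \<beta> 1" using n by simp
    qed
    ultimately have "(\<lambda>n::nat. \<beta> 1) \<longlonglongrightarrow> 0"
      by (rule Lim_transform_eventually)
    then show False by (simp add: LIMSEQ_const_iff \<beta>_def square_wave_coeff_def)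
  qed
  ultimately show ?thesis
    by (intro not_irreducible_if_not_scalar[of "c\<^sup>\<star>"])
qed

lemma stabilizing_scaleC:
  assumes "stabilizing k c" "cmod t = 1" shows "stabilizing k (t *\<^sub>C c)"
proof -
  have t: "cnj t * t = 1" using assms(2) complex_norm_square[of t] by (simp add: mult.commute)
  have "\<omega> ((t *\<^sub>C c)\<^sup>\<star> * b * (t *\<^sub>C c)) = \<omega> (c\<^sup>\<star> * b * c)" for b
    by (simp add: adj_scaleC mult_scaleC_left mult_scaleC_right scaleC_scaleC t mult.commute[of t] scaleC_one)
  from this this[of 1] show ?thesis
    using assms(1) by (auto simp: stabilizing_def scaleC_mem)
qed

lemma power_scaleC: "(t *\<^sub>C c) ^ n = t ^ n *\<^sub>C c ^ n" for c :: 'a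
  by (induction n)
    (simp_all add: scaleC_one mult_scaleC_left mult_scaleC_right scaleC_scaleC mult.commute[of _ t])

text \<open>If \<open>n\<close> is the order of \<open>k\<close>, then \<open>c ^ n\<close> has the trivial degree and \<open>\<omega> (c ^ n)\<close> has absolute
value one; multiplying \<open>c\<close> by an \<open>n\<close>-th root of its inverse makes it equal to one.\<close>
lemma not_irreducible_if_stabilizing:
  assumes st: "stabilizing k c" and k1: "k \<noteq> \<one>"
  shows "\<not> irreducible_rep (induced_rep G A \<omega>)"
proof (cases "\<exists>m::int. m \<noteq> 0 \<and> k [^] m = \<one>")
  case False
  then show ?thesis using not_irreducible_infinite_order[OF st] by blast
next
  case True
  have k: "k \<in> carrier G" using st by (simp add: stabilizing_def)
  obtain m :: int where m: "m \<noteq> 0" "k [^] m = \<one>" using True by blast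
  have ex: "\<exists>n::nat. 0 < n \<and> k [^] n = \<one>"
  proof (cases m rule: int_cases2)
    case (nonneg n)
    then show ?thesis using m by (intro exI[of _ n]) (simp add: int_pow_int)
  next
    case (nonpos n)
    then have "inv (k [^] n) = \<one>" using m(2) int_pow_neg_int[OF k, of n] by simp
    then have "k [^] n = \<one>" using k by (simp add: inv_eq_1_iff)
    then show ?thesis using m(1) nonpos by (intro exI[of _ n]) simp
  qed
  define n where "n = (LEAST n::nat. 0 < n \<and> k [^] n = \<one>)"
  have n: "0 < n" "k [^] n = \<one>" using LeastI_ex[OF ex] by (auto simp: n_def)
  have min: "k [^] j \<noteq> \<one>" if "0 < j" "j < n" for j :: nat
    using not_less_Least[of j "\<lambda>n. 0 < n \<and> k [^] n = \<one>"] that by (auto simp: n_def)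
  have n1: "n > 1"
  proof (rule ccontr)
    assume "\<not> n > 1"
    then have "n = 1" using n by simp
    then show False using n(2) k k1 by simp
  qed
  define l where "l = \<omega> (c ^ n)"
  have mem: "c ^ n \<in> A \<one>"
    using star_power_mem[OF st, of "int n"] n k by (simp add: star_power_int int_pow_int)
  have "cnj l * l = 1"
  proof -
    have "cnj l * l = \<Phi> (1 * (star_power c (- int n) * star_power c (int n)))"
      unfolding star_power_int star_power_uminus_int adj_power[symmetric]
      using mem adj_mem[OF one_closed mem]
      by (simp add: \<Phi>_mult_unit_right \<Phi>_homogeneous[OF one_closed] l_def \<omega>_adj)
    also have "\<dots> = 1"
      unfolding \<Phi>_star_power_mult[OF st] by (simp add: \<Phi>_homogeneous[OF one_closed one_mem])
    finally show ?thesis .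
  qed
  then have "(cmod l)\<^sup>2 = 1"
    by (metis complex_norm_square mult.commute of_real_eq_1_iff)
  then have norm_l: "cmod l = 1" by (simp add: power2_eq_1_iff) (smt (verit) norm_ge_zero)
  define t where "t = cis (- Arg l / n)"
  have "l = cis (Arg l)"
    using norm_l rcis_cmod_Arg[of l] by (simp add: rcis_def)
  moreover have "t ^ n = cis (- Arg l)"
  proof -
    have "real n * (- Arg l / real n) = - Arg l" using n(1) by simp
    then show ?thesis by (simp only: t_def Complex.DeMoivre)
  qed
  ultimately have tl: "t ^ n * l = 1"
    by (metis cis_mult add.left_inverse cis_zero)
  have "\<omega> ((t *\<^sub>C c) ^ n) = 1"
    using tl mem by (simp add: power_scaleC \<omega>_scaleC l_def)
  then show ?thesis
    using n1 n(2) min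
    by (intro not_irreducible_finite_order[OF stabilizing_scaleC[OF st, of t]]) (auto simp: t_def)
qed

lemma exists_stabilizing:
  assumes "k \<in> character_stabilizer G A \<omega>"
  shows "\<exists>c. stabilizing k c"
proof -
  have k: "k \<in> carrier G" and def: "conj_character_defined A \<omega> k" and eq: "conj_character G A \<omega> k = \<omega>"
    using assms by (auto simp: character_stabilizer_def)
  obtain c where c: "c \<in> A k" "\<omega> (c\<^sup>\<star> * c) \<noteq> 0"
      "conj_character G A \<omega> k = restrict (\<lambda>b. \<omega> (c\<^sup>\<star> * b * c) / \<omega> (c\<^sup>\<star> * c)) (A \<one>)"
    by (rule conj_character_eigenvector[OF k def]) blast
  define r where "r = Re (\<omega> (c\<^sup>\<star> * c))"
  note cc = homogeneous_square_mem[OF k c(1) c(1)]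
  have "c\<^sup>\<star> * c = (\<Sum>a\<leftarrow>[c]. a\<^sup>\<star> * a)" by simp
  then have "c\<^sup>\<star> * c \<in> sums_of_squares" unfolding sums_of_squares_def by blast
  then have "\<omega> (c\<^sup>\<star> * c) \<in> \<real>\<^sub>\<ge>\<^sub>0" by (rule \<omega>_nonneg[OF cc])
  then have r: "\<omega> (c\<^sup>\<star> * c) = of_real r" "r \<ge> 0"
    by (auto simp: r_def complex_nonneg_Reals_iff complex_eq_iff)
  then have r0: "r > 0" using c(2) by (cases "r = 0") auto
  \<comment> \<open>normalise to square length one\<close>
  define t where "t = complex_of_real (1 / sqrt r)"
  have "cnj t * t = complex_of_real (1 / sqrt r * (1 / sqrt r))"
    by (simp only: t_def complex_cnj_complex_of_real of_real_mult)
  also have "1 / sqrt r * (1 / sqrt r) = 1 / r" using r0 by simp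
  finally have t: "cnj t * t * of_real r = 1" using r0 by simp
  have conj: "\<omega> ((t *\<^sub>C c)\<^sup>\<star> * b * (t *\<^sub>C c)) = \<omega> b" if b: "b \<in> A \<one>" for b
  proof -
    have "b * c \<in> A k" using mult_mem[OF one_closed k b c(1)] k by simp
    then have mem: "c\<^sup>\<star> * b * c \<in> A \<one>"
      using homogeneous_square_mem[OF k c(1)] by (simp add: mult.assoc)
    have "\<omega> (c\<^sup>\<star> * b * c) = \<omega> b * of_real r"
      using fun_cong[OF eq[unfolded c(3)], of b] b r0 by (simp add: r(1) field_simps)
    moreover have "(t *\<^sub>C c)\<^sup>\<star> * b * (t *\<^sub>C c) = (cnj t * t) *\<^sub>C (c\<^sup>\<star> * b * c)"
      by (simp add: adj_scaleC mult_scaleC_left mult_scaleC_right scaleC_scaleC mult.commute)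
    ultimately have "\<omega> ((t *\<^sub>C c)\<^sup>\<star> * b * (t *\<^sub>C c)) = \<omega> b * (cnj t * t * of_real r)"
      using mem by (simp add: \<omega>_scaleC mult_ac)
    then show ?thesis by (simp add: t)
  qed
  from conj[OF one_mem] conj have "stabilizing k (t *\<^sub>C c)"
    using k c(1) by (simp add: stabilizing_def scaleC_mem)
  then show ?thesis by blast
qed

lemma unit_in_stabilizer: "\<one> \<in> character_stabilizer G A \<omega>"
proof -
  have def: "conj_character_defined A \<omega> \<one>"
    unfolding conj_character_defined_def by (rule bexI[of _ 1]) simp_all
  obtain c where c: "c \<in> A \<one>" "\<omega> (c\<^sup>\<star> * c) \<noteq> 0"
      "conj_character G A \<omega> \<one> = restrict (\<lambda>b. \<omega> (c\<^sup>\<star> * b * c) / \<omega> (c\<^sup>\<star> * c)) (A \<one>)"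
    by (rule conj_character_eigenvector[OF one_closed def]) blast
  have c': "c\<^sup>\<star> \<in> A \<one>" using adj_mem[OF one_closed c(1)] by simp
  have mem: "a * b \<in> A \<one>" if "a \<in> A \<one>" "b \<in> A \<one>" for a b
    using mult_mem[OF one_closed one_closed that] by simp
  have "conj_character G A \<omega> \<one> = \<omega>"
  proof (rule extensionalityI[OF _ \<omega>_extensional])
    show "conj_character G A \<omega> \<one> \<in> extensional (A \<one>)" by (simp add: c(3))
    show "conj_character G A \<omega> \<one> b = \<omega> b" if "b \<in> A \<one>" for b
      using c(2) that c(1) c' by (simp add: c(3) \<omega>_mult mem)
  qed
  then show ?thesis using def by (simp add: character_stabilizer_def)
qed

end

theorem proposition26:
  fixes G :: "('g, 'm) monoid_scheme"
    and A :: "'g \<Rightarrow> 'a::complex_star_algebra set"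
    and \<omega> :: "'a \<Rightarrow> complex"
  assumes "induction_setting G A"
    and "\<omega> \<in> pos_characters (A \<one>\<^bsub>G\<^esub>)"
  shows "irreducible_rep (induced_rep G A \<omega>) \<longleftrightarrow> character_stabilizer G A \<omega> = {\<one>\<^bsub>G\<^esub>}"
proof -
  interpret positive_character G A \<omega>
    using assms by (intro positive_character.intro positive_character_axioms.intro)
  show ?thesis
  proof
    assume irr: "irreducible_rep (induced_rep G A \<omega>)"
    have "k = \<one>\<^bsub>G\<^esub>" if "k \<in> character_stabilizer G A \<omega>" for k
      using exists_stabilizing[OF that] not_irreducible_if_stabilizing irr by blast
    then show "character_stabilizer G A \<omega> = {\<one>\<^bsub>G\<^esub>}"
      using unit_in_stabilizer by blast
  qed (rule irreducible_if_trivial_stabilizer)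
qed

end
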